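(* Assume that $(A_1)$–$(A_3)$ hold and that $\varepsilon>0$ is sufficiently small. Then the invariant manifold $\mathcal M^\varepsilon(\omega)=\{(x_0,\hat h^\varepsilon(\omega,x_0)):x_0\in\mathbb R^{n_1}\}$ of the random dynamical system $\hat\phi^\varepsilon$ generated by $$d\hat x^\varepsilon=S\hat x^\varepsilon dt+g_1(\hat x^\varepsilon,\hat y^\varepsilon+\sigma\eta^{\frac1\varepsilon}(\theta_t\omega))dt,\qquad d\hat y^\varepsilon=\tfrac1\varepsilon F\hat y^\varepsilon dt+\tfrac1\varepsilon g_2(\hat x^\varepsilon,\hat y^\varepsilon+\sigma\eta^{\frac1\varepsilon}(\theta_t\omega))dt$$ has the exponential tracking property in the following sense: there are constants $C>0$ and $c>0$ such that for every $\omega\in\Omega$ and any $z_0=(x_0,y_0)\in\mathbb R^n$ there is a $z_0'=(x_0',y_0')\in\mathcal M^\varepsilon(\omega)$ with $$|\hat\phi^\varepsilon(t,\omega,z_0')-\hat\phi^\varepsilon(t,\omega,z_0)|\le Ce^{-ct}|z_0'-z_0|,\qquad t\ge0 .$$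
   Context: Setting. $|\cdot|$ is the Euclidean norm, $n=n_1+n_2$, $\sigma>0$, $1<\alpha<2$. $S$ is an $n_1\times n_1$ matrix all of whose eigenvalues have non-negative real part, $F$ is an $n_2\times n_2$ matrix all of whose eigenvalues have negative real part, and $g_i:\mathbb R^{n_1}\times\mathbb R^{n_2}\to\mathbb R^{n_i}$ ($i=1,2$) are Lipschitz continuous with $g_i(0,0)=0$. Hypotheses. $(A_1)$: there are constants $\gamma_s>0$ and $\gamma_f<0$ such that $|e^{St}x|\le e^{\gamma_st}|x|$ for $t\le0$, $x\in\mathbb R^{n_1}$, and $|e^{Ft}y|\le e^{\gamma_ft}|y|$ for $t\ge0$, $y\in\mathbb R^{n_2}$. $(A_2)$: there is $K>0$ with $|g_i(x_1,y_1)-g_i(x_2,y_2)|\le K(|x_1-x_2|+|y_1-y_2|)$ for all $(x_j,y_j)\in\mathbb R^n$, $i=1,2$. $(A_3)$: $K<-\gamma_f$. A number $\gamma>0$ with $K<-(\gamma+\gamma_f)$ is fixed, and $\beta=-\gamma/\varepsilon$. Noise. $\Omega=\mathcal D_0(\mathbb R,\mathbb R^{n_2})$ is the space of càdlàg functions $\omega:\mathbb R\to\mathbb R^{n_2}$ with $\omega(0)=0$, with the Borel $\sigma$-algebra of the Skorokhod topology; $\mathbb P$ is the law making $L_t^\alpha(\omega)=\omega(t)$ a two-sided $\alpha$-stable Lévy process; $\theta_t\omega=\omega(\cdot+t)-\omega(t)$ is the shift flow, which preserves $\mathbb P$. $\Omega$ is replaced, without change of notation, by a $\theta$-invariant subset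 of full measure on which $\eta^{\frac1\varepsilon}(\omega)=\varepsilon^{-\frac1\alpha}\int_{-\infty}^0e^{-Fs/\varepsilon}dL_s^\alpha(\omega)$ is defined, $t\mapsto\eta^{\frac1\varepsilon}(\theta_t\omega)$ is the càdlàg stationary solution of $d\eta=\frac1\varepsilon F\eta\,dt+\varepsilon^{-1/\alpha}dL_t^\alpha$ (with sublinear growth in $t$), and the system in the claim is solvable for every initial condition. $\hat\phi^\varepsilon(t,\omega,(x_0,y_0))=(\hat x^\varepsilon(t),\hat y^\varepsilon(t))$, $t\in\mathbb R$, is the solution of the system in the claim starting at $(x_0,y_0)$ at $t=0$. The manifold. $C_\beta^-$ is the Banach space of continuous $(\phi^s,\phi^f):(-\infty,0]\to\mathbb R^{n_1}\times\mathbb R^{n_2}$ with finite norm $\sup_{t\le0}|e^{-\beta t}\phi^s_t|+\sup_{t\le0}|e^{-\beta t}\phi^f_t|$, and $\mathcal M^\varepsilon(\omega)=\{(x_0,y_0)\in\mathbb R^n:\hat\phi^\varepsilon(\cdot,\omega,(x_0,y_0))\in C_\beta^-\}$. For sufficiently small $\varepsilon$ this set is the graph of a function $\hat h^\varepsilon(\omega,\cdot):\mathbb R^{n_1}\to\mathbb R^{n_2}$, Lipschitz in $x_0$, and it is invariant: $\hat\phi^\varepsilon(s,\omega,\mathcal M^\varepsilon(\omega))\subset\mathcal M^\varepsilon(\theta_s\omega)$ for $s\ge0$. The function is $\hat h^\varepsilon(\omega,x_0)=\frac1\varepsilon\int_{-\infty}^0e^{-Fs/\varepsilon}g_2(\hat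 x^\varepsilon(s),\hat y^\varepsilon(s)+\sigma\eta^{\frac1\varepsilon}(\theta_s\omega))ds$, where $(\hat x^\varepsilon,\hat y^\varepsilon)$ is the unique element of $C_\beta^-$ satisfying, for $t\le0$, $\hat x^\varepsilon(t)=e^{St}x_0+\int_0^te^{S(t-s)}g_1(\hat x^\varepsilon(s),\hat y^\varepsilon(s)+\sigma\eta^{\frac1\varepsilon}(\theta_s\omega))ds$ and $\hat y^\varepsilon(t)=\frac1\varepsilon\int_{-\infty}^te^{F(t-s)/\varepsilon}g_2(\hat x^\varepsilon(s),\hat y^\varepsilon(s)+\sigma\eta^{\frac1\varepsilon}(\theta_s\omega))ds$. *)

theory Defs
  imports "HOL-Probability.Probability"
begin

section \<open>Matrices\<close>

text \<open>Multiplication on \<^typ>\<open>real^'n^'n\<close> is componentwise, so the library function \<^const>\<open>exp\<close>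
  is not the matrix exponential; the latter is defined by its power series.\<close>

definition mat_exp :: "real^'n^'n \<Rightarrow> real^'n^'n" where
  "mat_exp A = (\<Sum>k. (1 / fact k) *\<^sub>R (((**) A ^^ k) (mat 1)))"

definition complex_eigenvalue :: "real^'n^'n \<Rightarrow> complex \<Rightarrow> bool" where
  "complex_eigenvalue A z \<longleftrightarrow>
     (\<exists>v::complex^'n. v \<noteq> 0 \<and> (\<chi> i j. complex_of_real (A $ i $ j)) *v v = z *s v)"


section \<open>The space of cadlag paths\<close>

definition cadlag :: "(real \<Rightarrow> 'a::topological_space) \<Rightarrow> bool" where
  "cadlag w \<longleftrightarrow> (\<forall>t. (w \<longlongrightarrow> w t) (at_right t) \<and> (\<exists>l. (w \<longlongrightarrow> l) (at_left t)))"

definition D0 :: "(real \<Rightarrow> real^'n) set" where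
  "D0 = {w. cadlag w \<and> w 0 = 0}"

definition path_shift :: "real \<Rightarrow> (real \<Rightarrow> real^'n) \<Rightarrow> real \<Rightarrow> real^'n" where
  "path_shift t w = (\<lambda>s. w (s + t) - w t)"

text \<open>The Skorokhod topology is given by Billingsley's metric, adapted to the two-sided time axis:
  paths are tapered to \<open>[-m, m]\<close>, and a time change is penalised by the logarithms of its slopes.
  The infimum below is that of
  \<open>max (SUP s<t. \<bar>ln ((l t - l s) / (t - s))\<bar>) (SUP t. norm (u t - v (l t)))\<close>, written
  through upper bounds because the first supremum may be infinite.\<close>

definition time_changes :: "real \<Rightarrow> (real \<Rightarrow> real) set" where
  "time_changes m =
     {l. continuous_on {-m..m} l \<and> strict_mono_on {-m..m} l \<and> l (-m) = -m \<and> l m = m}"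

definition taper :: "real \<Rightarrow> (real \<Rightarrow> real^'n) \<Rightarrow> real \<Rightarrow> real^'n" where
  "taper m w t = max 0 (min 1 (m - \<bar>t\<bar>)) *\<^sub>R w t"

definition skorokhod_dist_on ::
    "real \<Rightarrow> (real \<Rightarrow> real^'n) \<Rightarrow> (real \<Rightarrow> real^'n) \<Rightarrow> real" where
  "skorokhod_dist_on m u v =
     Inf {r. \<exists>l\<in>time_changes m.
           (\<forall>s\<in>{-m..m}. \<forall>t\<in>{-m..m}. s < t \<longrightarrow> \<bar>ln ((l t - l s) / (t - s))\<bar> \<le> r) \<and>
           (\<forall>t\<in>{-m..m}. norm (u t - v (l t)) \<le> r)}"

definition skorokhod_dist :: "(real \<Rightarrow> real^'n) \<Rightarrow> (real \<Rightarrow> real^'n) \<Rightarrow> real" where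
  "skorokhod_dist u v =
     (\<Sum>k. (1/2) ^ Suc k *
        min 1 (skorokhod_dist_on (real (Suc k)) (taper (real (Suc k)) u) (taper (real (Suc k)) v)))"

definition skorokhod_borel :: "(real \<Rightarrow> real^'n) measure" where
  "skorokhod_borel = sigma D0 {U. openin (Metric_space.mtopology D0 skorokhod_dist) U}"


section \<open>Two-sided stable Levy processes\<close>

text \<open>Laws \<open>P\<close> on path space under which the coordinate process is a two-sided Levy process;
  cadlag paths starting at \<open>0\<close> are built into \<^const>\<open>D0\<close>.\<close>

definition two_sided_levy :: "(real \<Rightarrow> real^'n) measure \<Rightarrow> bool" where
  "two_sided_levy P \<longleftrightarrow>
     prob_space P \<and> sets P = sets skorokhod_borel \<and>
     (\<forall>(k::nat) (t::nat \<Rightarrow> real). (\<forall>i<k. t i < t (Suc i)) \<longrightarrow>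
        prob_space.indep_vars P (\<lambda>_. borel) (\<lambda>i w. w (t (Suc i)) - w (t i)) {..<k}) \<and>
     (\<forall>s t h. s \<le> t \<longrightarrow>
        distr P borel (\<lambda>w. w (t + h) - w (s + h)) = distr P borel (\<lambda>w. w t - w s)) \<and>
     (\<forall>r>0. ((\<lambda>t. measure P {w \<in> space P. r < norm (w t)}) \<longlongrightarrow> 0) (at 0))"

text \<open>Stability of index \<open>\<alpha>\<close>: the processes \<open>L (c t)\<close> and \<open>c\<^bsup>1/\<alpha>\<^esup> L t + t b\<close> agree in law for some
  drift \<open>b\<close> depending on \<open>c\<close>. For Levy processes this is a condition on one-dimensional
  marginals. Deterministic processes are excluded.\<close>

definition stable_levy :: "real \<Rightarrow> (real \<Rightarrow> real^'n) measure \<Rightarrow> bool" where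
  "stable_levy \<alpha> P \<longleftrightarrow>
     two_sided_levy P \<and>
     (\<forall>c>0. \<exists>b. \<forall>t.
        distr P borel (\<lambda>w. w (c * t)) = distr P borel (\<lambda>w. c powr (1/\<alpha>) *\<^sub>R w t + t *\<^sub>R b)) \<and>
     \<not> (\<exists>v. AE w in P. w 1 = v)"

definition stationary_process ::
    "'w measure \<Rightarrow> (real \<Rightarrow> 'w \<Rightarrow> 'b::topological_space) \<Rightarrow> bool" where
  "stationary_process M X \<longleftrightarrow>
     (\<forall>t. X t \<in> borel_measurable M) \<and>
     (\<forall>J h. finite J \<longrightarrow>
        distr M (PiM J (\<lambda>_. borel)) (\<lambda>w. \<lambda>j\<in>J. X (j + h) w) =
        distr M (PiM J (\<lambda>_. borel)) (\<lambda>w. \<lambda>j\<in>J. X j w))"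


section \<open>The stationary Ornstein-Uhlenbeck process\<close>

text \<open>The integrands needed here are deterministic and smooth, so the integral against a cadlag
  path exists pathwise as a limit of Riemann-Stieltjes sums as the mesh tends to \<open>0\<close>.
  The constant gauge \<open>\<lambda>x. ball x d\<close> controls the mesh.\<close>

definition has_RS_integral ::
    "(real \<Rightarrow> real^'n^'n) \<Rightarrow> (real \<Rightarrow> real^'n) \<Rightarrow> real^'n \<Rightarrow> real \<Rightarrow> real \<Rightarrow> bool" where
  "has_RS_integral f w I a b \<longleftrightarrow>
     (\<forall>e>0. \<exists>d>0. \<forall>p. p tagged_division_of {a..b} \<and> (\<lambda>x. ball x d) fine p \<longrightarrow>
        norm ((\<Sum>(x, k)\<in>p. f x *v (w (Sup k) - w (Inf k))) - I) < e)"

definition has_RS_integral_neg ::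
    "(real \<Rightarrow> real^'n^'n) \<Rightarrow> (real \<Rightarrow> real^'n) \<Rightarrow> real^'n \<Rightarrow> bool" where
  "has_RS_integral_neg f w I \<longleftrightarrow>
     (\<exists>J. (\<forall>a<0. has_RS_integral f w (J a) a 0) \<and> (J \<longlongrightarrow> I) at_bot)"

definition eta_defined :: "real^'n^'n \<Rightarrow> real \<Rightarrow> (real \<Rightarrow> real^'n) \<Rightarrow> bool" where
  "eta_defined F \<epsilon> w \<longleftrightarrow> (\<exists>I. has_RS_integral_neg (\<lambda>s. mat_exp ((- s / \<epsilon>) *\<^sub>R F)) w I)"

definition eta :: "real^'n^'n \<Rightarrow> real \<Rightarrow> real \<Rightarrow> (real \<Rightarrow> real^'n) \<Rightarrow> real^'n" where
  "eta F \<alpha> \<epsilon> w =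
     \<epsilon> powr (- 1 / \<alpha>) *\<^sub>R (THE I. has_RS_integral_neg (\<lambda>s. mat_exp ((- s / \<epsilon>) *\<^sub>R F)) w I)"

definition eta_path_ok :: "real^'n^'n \<Rightarrow> real \<Rightarrow> real \<Rightarrow> (real \<Rightarrow> real^'n) \<Rightarrow> bool" where
  "eta_path_ok F \<alpha> \<epsilon> w \<longleftrightarrow>
     eta_defined F \<epsilon> w \<and>
     cadlag (\<lambda>t. eta F \<alpha> \<epsilon> (path_shift t w)) \<and>
     (\<forall>r t. r \<le> t \<longrightarrow>
        eta F \<alpha> \<epsilon> (path_shift t w) - eta F \<alpha> \<epsilon> (path_shift r w) =
          (LBINT s=ereal r..ereal t. (1/\<epsilon>) *\<^sub>R (F *v eta F \<alpha> \<epsilon> (path_shift s w))) +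
          \<epsilon> powr (- 1 / \<alpha>) *\<^sub>R (w t - w r)) \<and>
     ((\<lambda>t. norm (eta F \<alpha> \<epsilon> (path_shift t w)) / \<bar>t\<bar>) \<longlongrightarrow> 0) at_infinity"


section \<open>The slow-fast random system\<close>

text \<open>States are pairs \<open>(x, y)\<close>; the product norm is the Euclidean norm of the combined space.\<close>

definition slow_fast_field ::
    "real^'n1^'n1 \<Rightarrow> real^'n2^'n2 \<Rightarrow> ((real^'n1) \<times> (real^'n2) \<Rightarrow> real^'n1) \<Rightarrow>
     ((real^'n1) \<times> (real^'n2) \<Rightarrow> real^'n2) \<Rightarrow> real \<Rightarrow> real \<Rightarrow> real \<Rightarrow> (real \<Rightarrow> real^'n2) \<Rightarrow>
     real \<Rightarrow> (real^'n1) \<times> (real^'n2) \<Rightarrow> (real^'n1) \<times> (real^'n2)" where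
  "slow_fast_field S F g1 g2 \<sigma> \<alpha> \<epsilon> w t = (\<lambda>(x, y).
     (S *v x + g1 (x, y + \<sigma> *\<^sub>R eta F \<alpha> \<epsilon> (path_shift t w)),
      (1/\<epsilon>) *\<^sub>R (F *v y) + (1/\<epsilon>) *\<^sub>R g2 (x, y + \<sigma> *\<^sub>R eta F \<alpha> \<epsilon> (path_shift t w))))"

text \<open>The forcing has jumps, so the equations are understood in integrated form. The interval
  integral is oriented, which covers \<open>t < 0\<close>.\<close>

definition slow_fast_solution ::
    "real^'n1^'n1 \<Rightarrow> real^'n2^'n2 \<Rightarrow> ((real^'n1) \<times> (real^'n2) \<Rightarrow> real^'n1) \<Rightarrow>
     ((real^'n1) \<times> (real^'n2) \<Rightarrow> real^'n2) \<Rightarrow> real \<Rightarrow> real \<Rightarrow> real \<Rightarrow> (real \<Rightarrow> real^'n2) \<Rightarrow>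
     (real^'n1) \<times> (real^'n2) \<Rightarrow> (real \<Rightarrow> (real^'n1) \<times> (real^'n2)) \<Rightarrow> bool" where
  "slow_fast_solution S F g1 g2 \<sigma> \<alpha> \<epsilon> w z0 z \<longleftrightarrow>
     continuous_on UNIV z \<and>
     (\<forall>t. interval_lebesgue_integrable lborel 0 (ereal t)
            (\<lambda>s. slow_fast_field S F g1 g2 \<sigma> \<alpha> \<epsilon> w s (z s)) \<and>
          z t = z0 + (LBINT s=0..ereal t. slow_fast_field S F g1 g2 \<sigma> \<alpha> \<epsilon> w s (z s)))"

definition phi_hat ::
    "real^'n1^'n1 \<Rightarrow> real^'n2^'n2 \<Rightarrow> ((real^'n1) \<times> (real^'n2) \<Rightarrow> real^'n1) \<Rightarrow>
     ((real^'n1) \<times> (real^'n2) \<Rightarrow> real^'n2) \<Rightarrow> real \<Rightarrow> real \<Rightarrow> real \<Rightarrow>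
     real \<Rightarrow> (real \<Rightarrow> real^'n2) \<Rightarrow> (real^'n1) \<times> (real^'n2) \<Rightarrow> (real^'n1) \<times> (real^'n2)" where
  "phi_hat S F g1 g2 \<sigma> \<alpha> \<epsilon> t w z0 = (THE z. slow_fast_solution S F g1 g2 \<sigma> \<alpha> \<epsilon> w z0 z) t"

text \<open>The sets to which the path space may be reduced for a given \<open>\<epsilon>\<close>.\<close>

definition admissible_noise_set ::
    "real^'n1^'n1 \<Rightarrow> real^'n2^'n2 \<Rightarrow> ((real^'n1) \<times> (real^'n2) \<Rightarrow> real^'n1) \<Rightarrow>
     ((real^'n1) \<times> (real^'n2) \<Rightarrow> real^'n2) \<Rightarrow> real \<Rightarrow> real \<Rightarrow> real \<Rightarrow> (real \<Rightarrow> real^'n2) measure \<Rightarrow>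
     (real \<Rightarrow> real^'n2) set \<Rightarrow> bool" where
  "admissible_noise_set S F g1 g2 \<sigma> \<alpha> \<epsilon> P \<Omega> \<longleftrightarrow>
     \<Omega> \<in> sets P \<and> measure P \<Omega> = 1 \<and>
     (\<forall>w\<in>\<Omega>. \<forall>t. path_shift t w \<in> \<Omega>) \<and>
     (\<forall>w\<in>\<Omega>. eta_path_ok F \<alpha> \<epsilon> w) \<and>
     stationary_process (restrict_space P \<Omega>) (\<lambda>t w. eta F \<alpha> \<epsilon> (path_shift t w)) \<and>
     (\<forall>w\<in>\<Omega>. \<forall>z0. \<exists>z. slow_fast_solution S F g1 g2 \<sigma> \<alpha> \<epsilon> w z0 z)"


section \<open>The slow manifold\<close>

text \<open>Functions on \<open>(-\<infinity>, 0]\<close> are represented by extensional functions, so that uniqueness in this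
  space is meaningful.\<close>

definition C_minus :: "real \<Rightarrow> (real \<Rightarrow> 'a::real_normed_vector \<times> 'b::real_normed_vector) set" where
  "C_minus \<beta> = {z \<in> extensional {..0}. continuous_on {..0} z \<and>
     bdd_above ((\<lambda>t. norm (exp (- \<beta> * t) *\<^sub>R fst (z t))) ` {..0}) \<and>
     bdd_above ((\<lambda>t. norm (exp (- \<beta> * t) *\<^sub>R snd (z t))) ` {..0})}"

definition slow_manifold ::
    "real^'n1^'n1 \<Rightarrow> real^'n2^'n2 \<Rightarrow> ((real^'n1) \<times> (real^'n2) \<Rightarrow> real^'n1) \<Rightarrow>
     ((real^'n1) \<times> (real^'n2) \<Rightarrow> real^'n2) \<Rightarrow> real \<Rightarrow> real \<Rightarrow> real \<Rightarrow> real \<Rightarrow>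
     (real \<Rightarrow> real^'n2) \<Rightarrow> ((real^'n1) \<times> (real^'n2)) set" where
  "slow_manifold S F g1 g2 \<sigma> \<alpha> \<gamma> \<epsilon> w =
     {z0. restrict (\<lambda>t. phi_hat S F g1 g2 \<sigma> \<alpha> \<epsilon> t w z0) {..0} \<in> C_minus (- \<gamma> / \<epsilon>)}"

text \<open>Along \<open>z \<in> C_minus \<beta>\<close> and a cadlag forcing of sublinear growth all integrals below converge
  absolutely under the growth assumptions on \<open>F\<close>.\<close>

definition backward_orbit ::
    "real^'n1^'n1 \<Rightarrow> real^'n2^'n2 \<Rightarrow> ((real^'n1) \<times> (real^'n2) \<Rightarrow> real^'n1) \<Rightarrow>
     ((real^'n1) \<times> (real^'n2) \<Rightarrow> real^'n2) \<Rightarrow> real \<Rightarrow> real \<Rightarrow> real \<Rightarrow> real \<Rightarrow>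
     (real \<Rightarrow> real^'n2) \<Rightarrow> real^'n1 \<Rightarrow> (real \<Rightarrow> (real^'n1) \<times> (real^'n2)) \<Rightarrow> bool" where
  "backward_orbit S F g1 g2 \<sigma> \<alpha> \<gamma> \<epsilon> w x0 z \<longleftrightarrow>
     z \<in> C_minus (- \<gamma> / \<epsilon>) \<and>
     (\<forall>t\<le>0.
        fst (z t) = mat_exp (t *\<^sub>R S) *v x0 +
          (LBINT s=0..ereal t. mat_exp ((t - s) *\<^sub>R S) *v
             g1 (fst (z s), snd (z s) + \<sigma> *\<^sub>R eta F \<alpha> \<epsilon> (path_shift s w))) \<and>
        snd (z t) = (1/\<epsilon>) *\<^sub>R
          (LBINT s=-\<infinity>..ereal t. mat_exp (((t - s) / \<epsilon>) *\<^sub>R F) *v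
             g2 (fst (z s), snd (z s) + \<sigma> *\<^sub>R eta F \<alpha> \<epsilon> (path_shift s w))))"

definition h_hat ::
    "real^'n1^'n1 \<Rightarrow> real^'n2^'n2 \<Rightarrow> ((real^'n1) \<times> (real^'n2) \<Rightarrow> real^'n1) \<Rightarrow>
     ((real^'n1) \<times> (real^'n2) \<Rightarrow> real^'n2) \<Rightarrow> real \<Rightarrow> real \<Rightarrow> real \<Rightarrow> real \<Rightarrow>
     (real \<Rightarrow> real^'n2) \<Rightarrow> real^'n1 \<Rightarrow> real^'n2" where
  "h_hat S F g1 g2 \<sigma> \<alpha> \<gamma> \<epsilon> w x0 =
     (let z = (THE z. backward_orbit S F g1 g2 \<sigma> \<alpha> \<gamma> \<epsilon> w x0 z) in
      (1/\<epsilon>) *\<^sub>R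
        (LBINT s=-\<infinity>..0. mat_exp ((- s / \<epsilon>) *\<^sub>R F) *v
           g2 (fst (z s), snd (z s) + \<sigma> *\<^sub>R eta F \<alpha> \<epsilon> (path_shift s w))))"

end

theory Submission
  imports Defs "HOL-Real_Asymp.Real_Asymp"
begin

text \<open>
  Tracking is a fixed point problem on the whole time axis. Let \<open>z\<close> be the orbit to be tracked on
  \<open>[0, \<infinity>)\<close>, frozen at its initial value for negative times. One looks for a perturbation \<open>\<psi>\<close> with
  \<open>exp (\<gamma> t / \<epsilon>) * \<psi> t\<close> bounded on all of \<open>\<real>\<close> such that \<open>z + \<psi>\<close> solves the system: on the left the
  weight says that \<open>z + \<psi>\<close> starts on the manifold, on the right it says that \<open>\<psi>\<close> decays. Solving
  the slow equation from \<open>+\<infinity>\<close> and the fast one from \<open>-\<infinity>\<close> gives a contraction with constant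
  \<open>\<rho> = K / (\<gamma>s + \<gamma> / \<epsilon>) + K / - (\<gamma> + \<gamma>f) < 1\<close>. Freezing at \<open>(x0, 0)\<close> and suppressing the nonlinearity
  for positive times, the same fixed point yields the point of the manifold above \<open>x0\<close>.

  The noise is only right-continuous, so trajectories have right derivatives everywhere but no
  derivative at jump times; all calculus is done with right derivatives.
\<close>

section \<open>Right derivatives and right-continuous functions\<close>

text \<open>The fixed point is used only qualitatively. Its norm depends on the noise and on the
  initial value, because for negative times the equation for \<psi> is inhomogeneous, so it cannot
  supply a uniform constant. On [0, \<infinity>) that equation is homogeneous, and a solution in the
  weighted space is controlled by its fast component at time 0 alone, the slow one being fixed by
  its decay at +\<infinity>. Absorbing the nonlinear terms into a weighted supremum, finite by the
  fixed point, gives the factor 1 / (1 - \<rho>), the same for all paths and initial values. The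
  same absorption with zero data on the negative half-line makes the manifold a graph: two of its
  points with equal slow component coincide. Freezing is harmless for t < 0, where the admissible
  size exp(- \<gamma> t / \<epsilon>) is at least 1; for t \<ge> 0 that size decays, so there the
  moving orbit itself is subtracted. In \<rho> the fast share K / - (\<gamma> + \<gamma>f) is free
  of \<epsilon> and below 1 by assumption, while the slow share is at most K \<epsilon> / \<gamma>.
  Smallness of \<epsilon> serves to keep their sum below 1.\<close>

lemma right_derivative_nonneg_imp_le:
  fixes f :: "real \<Rightarrow> real"
  assumes "a \<le> b" and cont: "continuous_on {a..b} f"
    and deriv: "\<And>t. a \<le> t \<Longrightarrow> t < b \<Longrightarrow> (f has_vector_derivative f' t) (at_right t)"
    and nonneg: "\<And>t. a \<le> t \<Longrightarrow> t < b \<Longrightarrow> 0 \<le> f' t"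
  shows "f a \<le> f b"
proof (rule ccontr)
  assume "\<not> f a \<le> f b"
  then have less: "f b < f a" and "a < b"
    using \<open>a \<le> b\<close> by (auto simp: not_le less_le)
  \<comment> \<open>Half the mean slope of the assumed drop: the tilted function \<open>g\<close>
    still falls from a to b, yet its right derivative is at least \<open>e\<close> > 0. This is
    contradictory at the last point \<open>c\<close> with g a \<le> g c, since \<open>g\<close>
    rises immediately to the right of \<open>c\<close>.\<close>
  define e where "e = (f a - f b) / (2 * (b - a))"
  have "e > 0" using less \<open>a < b\<close> by (simp add: e_def)
  have eb: "e * (b - a) < f a - f b"
  proof -
    have "b - a \<noteq> 0" using \<open>a < b\<close> by simp
    then have "e * (b - a) = (f a - f b) / 2"
      unfolding e_def by (metis nonzero_mult_divide_mult_cancel_right2 mult.commute times_divide_eq_left)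
    then show ?thesis using less by (simp only:) simp
  qed
  define g where "g t = f t + e * (t - a)" for t
  define C where "C = {t \<in> {a..b}. g a \<le> g t}"
  have "continuous_on {a..b} g"
    unfolding g_def by (intro continuous_intros cont)
  then have "closed C"
    unfolding C_def by (intro continuous_on_closed_Collect_le continuous_on_const closed_atLeastAtMost)
  moreover have "bounded C"
    by (rule bounded_subset[OF bounded_closed_interval[of a b]]) (auto simp: C_def)
  ultimately have "compact C" by (simp add: compact_eq_bounded_closed)
  moreover have "a \<in> C" using \<open>a < b\<close> by (simp add: C_def)
  ultimately obtain c where "c \<in> C" and max: "\<And>t. t \<in> C \<Longrightarrow> t \<le> c"
    using compact_attains_sup[of C] by blast
  have "g b < g a" using eb by (simp add: g_def)
  then have c: "a \<le> c" "c < b" "g a \<le> g c"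
    using \<open>c \<in> C\<close> by (auto simp: C_def less_le)
  have "(g has_vector_derivative f' c + e) (at_right c)"
    unfolding g_def by (auto intro!: derivative_eq_intros deriv c)
  then have "(g has_real_derivative f' c + e) (at c within {c<..})"
    by (simp add: has_real_derivative_iff_has_vector_derivative)
  from has_real_derivative_pos_inc_right[OF this] nonneg[OF c(1,2)] \<open>e > 0\<close>
  obtain d where "d > 0" and d: "\<And>h. 0 < h \<Longrightarrow> h < d \<Longrightarrow> g c < g (c + h)"
    by auto
  define h where "h = min (d / 2) (b - c)"
  have "0 < h" "h < d" "c + h \<le> b"
    using \<open>d > 0\<close> c by (auto simp: h_def min_def)
  then have "c + h \<in> C"
    using d[of h] c by (auto simp: C_def)
  then show False using max[of "c + h"] \<open>0 < h\<close> by simp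
qed

text \<open>Projecting the increment on its own direction \<open>e\<close> turns its norm into an
  inner product and reduces the claim to the scalar function
  \<open>\<phi> t - f t \<bullet> e\<close>. If the increment is 0 then \<open>e\<close> = 0, which
  the bound norm e \<le> 1 still covers.\<close>

lemma right_derivative_mean_value:
  fixes f :: "real \<Rightarrow> 'a::real_inner"
  assumes "a \<le> b" and cont: "continuous_on {a..b} f" "continuous_on {a..b} \<phi>"
    and deriv: "\<And>t. a \<le> t \<Longrightarrow> t < b \<Longrightarrow> (f has_vector_derivative f' t) (at_right t)"
      "\<And>t. a \<le> t \<Longrightarrow> t < b \<Longrightarrow> (\<phi> has_vector_derivative \<phi>' t) (at_right t)"
    and bound: "\<And>t. a \<le> t \<Longrightarrow> t < b \<Longrightarrow> norm (f' t) \<le> \<phi>' t"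
  shows "norm (f b - f a) \<le> \<phi> b - \<phi> a"
proof -
  define e where "e = sgn (f b - f a)"
  have "norm e \<le> 1" by (simp add: e_def norm_sgn)
  have "\<phi> a - f a \<bullet> e \<le> \<phi> b - f b \<bullet> e"
  proof (rule right_derivative_nonneg_imp_le[OF \<open>a \<le> b\<close>, where f' = "\<lambda>t. \<phi>' t - f' t \<bullet> e"])
    show "continuous_on {a..b} (\<lambda>t. \<phi> t - f t \<bullet> e)"
      by (intro continuous_intros cont)
    fix t assume t: "a \<le> t" "t < b"
    show "((\<lambda>t. \<phi> t - f t \<bullet> e) has_vector_derivative \<phi>' t - f' t \<bullet> e) (at_right t)"
      by (intro has_vector_derivative_diff deriv t
          bounded_linear.has_vector_derivative[OF bounded_linear_inner_left])
    have "f' t \<bullet> e \<le> norm (f' t) * norm e" by (rule norm_cauchy_schwarz)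
    also have "\<dots> \<le> \<phi>' t * 1"
      using bound[OF t] \<open>norm e \<le> 1\<close> by (intro mult_mono) (auto intro: order_trans[OF norm_ge_zero])
    finally show "0 \<le> \<phi>' t - f' t \<bullet> e" by simp
  qed
  moreover have "(f b - f a) \<bullet> e = norm (f b - f a)"
    by (cases "f b = f a") (simp_all add: e_def sgn_div_norm power2_norm_eq_inner[symmetric] power2_eq_square divide_simps)
  ultimately show ?thesis by (simp add: inner_diff_left)
qed

lemma right_continuous_imp_borel_measurable:
  fixes f :: "real \<Rightarrow> 'a::{second_countable_topology, metric_space}"
  assumes rc: "\<And>t. (f \<longlongrightarrow> f t) (at_right t)"
  shows "f \<in> borel_measurable borel"
proof (rule borel_measurable_LIMSEQ_metric)
  \<comment> \<open>The first point of the grid of step 1 / (n + 1) strictly to the right of t.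
    Floor plus one instead of ceiling keeps it strict when t is itself a grid point, so that right
    continuity applies. Each sampled function factors through the integers and is therefore
    measurable.\<close>
  define s :: "nat \<Rightarrow> real \<Rightarrow> real" where "s n t = (of_int \<lfloor>t * (real n + 1)\<rfloor> + 1) / (real n + 1)" for n t
  show "(\<lambda>t. f (s n t)) \<in> borel_measurable borel" for n
  proof -
    have "(\<lambda>t. (\<lambda>k::int. f ((of_int k + 1) / (real n + 1))) \<lfloor>t * (real n + 1)\<rfloor>) \<in> borel_measurable borel"
      by measurable
    then show ?thesis by (simp add: s_def)
  qed
  fix t :: real
  have s: "t < s n t" "s n t \<le> t + 1 / (real n + 1)" for n
  proof -
    have "s n t = t + (of_int \<lfloor>t * (real n + 1)\<rfloor> + 1 - t * (real n + 1)) / (real n + 1)"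
      unfolding s_def by (simp add: divide_simps)
    moreover have "0 < of_int \<lfloor>t * (real n + 1)\<rfloor> + 1 - t * (real n + 1)"
      "of_int \<lfloor>t * (real n + 1)\<rfloor> + 1 - t * (real n + 1) \<le> 1"
      by linarith+
    ultimately show "t < s n t" "s n t \<le> t + 1 / (real n + 1)"
      by (simp_all add: divide_right_mono)
  qed
  have "(\<lambda>n. s n t) \<longlonglongrightarrow> t"
  proof (rule tendsto_sandwich[of "\<lambda>_. t"])
    have "(\<lambda>n. t + inverse (real (Suc n))) \<longlonglongrightarrow> t + 0"
      by (intro tendsto_intros LIMSEQ_inverse_real_of_nat)
    then show "(\<lambda>n. t + 1 / (real n + 1)) \<longlonglongrightarrow> t"
      by (simp add: inverse_eq_divide add.commute)
  qed (use s in \<open>auto intro!: always_eventually less_imp_le\<close>)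
  then have "filterlim (\<lambda>n. s n t) (at_right t) sequentially"
    using s(1) by (simp add: filterlim_at less_imp_neq[symmetric] always_eventually)
  then show "(\<lambda>n. f (s n t)) \<longlonglongrightarrow> f t"
    by (rule filterlim_compose[OF rc])
qed

text \<open>The one-sided limits bound the function near each point, and compactness leaves finitely
  many such neighbourhoods.\<close>

lemma cadlag_bounded_on_Icc:
  fixes w :: "real \<Rightarrow> 'a::real_normed_vector"
  assumes "cadlag w"
  shows "bounded (w ` {a..b})"
proof -
  have "\<exists>U. open U \<and> t \<in> U \<and> bounded (w ` U)" for t
  proof -
    have bdd: "\<exists>B. \<forall>\<^sub>F s in F. norm (w s) < B" if "(w \<longlongrightarrow> l) F" for l F
    proof -
      have "\<forall>\<^sub>F s in F. norm (w s) < norm l + 1"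
        using tendsto_norm[OF that] by (rule order_tendstoD) simp
      then show ?thesis by blast
    qed
    obtain l where "(w \<longlongrightarrow> w t) (at_right t)" "(w \<longlongrightarrow> l) (at_left t)"
      using assms unfolding cadlag_def by blast
    then obtain B1 B2 where "\<forall>\<^sub>F s in at_right t. norm (w s) < B1" "\<forall>\<^sub>F s in at_left t. norm (w s) < B2"
      using bdd by blast
    then have "\<forall>\<^sub>F s in at t. norm (w s) \<le> max B1 B2"
      unfolding eventually_at_split by (auto elim!: eventually_mono)
    then obtain U where U: "open U" "t \<in> U" "\<forall>s\<in>U. s \<noteq> t \<longrightarrow> norm (w s) \<le> max B1 B2"
      unfolding eventually_at_topological by blast
    then have "\<forall>s\<in>U. norm (w s) \<le> max (norm (w t)) (max B1 B2)"
      by (metis max.cobounded1 max.coboundedI2)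
    then have "bounded (w ` U)" by (auto simp: bounded_iff)
    with U show ?thesis by blast
  qed
  then obtain U where U: "\<And>t. open (U t)" "\<And>t. t \<in> U t" "\<And>t. bounded (w ` U t)"
    by metis
  have "{a..b} \<subseteq> (\<Union>t\<in>{a..b}. U t)" using U(2) by blast
  from compactE_image[OF compact_Icc _ this] U(1)
  obtain C where "finite C" "{a..b} \<subseteq> (\<Union>t\<in>C. U t)" by metis
  moreover from this have "bounded (\<Union>t\<in>C. w ` U t)"
    using U(3) by (intro bounded_UN) auto
  ultimately show ?thesis
    by (elim bounded_subset) (auto simp: image_UN[symmetric])
qed

text \<open>The fundamental theorem for integrands with jumps. The base point \<open>c\<close> is
  extended real because integrals from 0, +\<infinity> and -\<infinity> all have to be
  differentiated; it may lie to the left of, to the right of or inside the interval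
  considered.\<close>

lemma integral_right_continuous:
  fixes q :: "real \<Rightarrow> 'a::euclidean_space" and c :: ereal
  assumes rc: "\<And>t. (q \<longlongrightarrow> q t) (at_right t)"
    and int: "\<And>t. interval_lebesgue_integrable lborel c (ereal t) q"
  shows "((\<lambda>t. LBINT s=c..ereal t. q s) has_vector_derivative q t) (at_right t)" (is "(?I has_vector_derivative _) _")
    and "continuous_on {a..b} (\<lambda>t. LBINT s=c..ereal t. q s)"
proof -
  have set_int: "set_integrable lborel {a..b} q" for a b :: real
  proof (cases "a \<le> b")
    case ab: True
    \<comment> \<open>Interval integrability speaks of open intervals, hence the margin of 1 on
      either side.\<close>
    have "set_integrable lborel ({..<b+1} \<inter> {a-1<..}) q"
    proof (cases "c \<le> ereal (a - 1)")
      case True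
      moreover have "ereal (a - 1) \<le> ereal (b + 1)" using ab by simp
      ultimately have "set_integrable lborel (einterval c (ereal (b + 1))) q"
        using int[of "b + 1"] order_trans[of c "ereal (a - 1)" "ereal (b + 1)"]
        by (simp add: interval_lebesgue_integrable_def)
      then show ?thesis
        by (rule set_integrable_subset)
           (use True le_less_trans[of c "ereal (a - 1)"] in \<open>auto simp: einterval_iff\<close>)
    next
      case False
      then have F: "set_integrable lborel (einterval (ereal (a-1)) c) q"
        using int[of "a-1"] by (auto simp: interval_lebesgue_integrable_def)
      show ?thesis
      proof (cases "ereal (b + 1) \<le> c")
        case True
        then show ?thesis
          using less_le_trans[of _ "ereal (b + 1)" c]
          by (intro set_integrable_subset[OF F]) (auto simp: einterval_iff)
      next
        case nF: False
        then obtain r where r: "c = ereal r" using False by (cases c) auto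
        have "set_integrable lborel (einterval c (ereal (b+1))) q"
          using int[of "b+1"] nF by (auto simp: interval_lebesgue_integrable_def)
        \<comment> \<open>The two open intervals meet at \<open>c\<close> without containing it, so
          this point is added separately.\<close>
        moreover have "set_integrable lborel {r} q"
        proof -
          have "integrable lborel (\<lambda>x. indicat_real {r} x *\<^sub>R q r)"
            by (intro integrable_scaleR_left integrable_real_indicator) auto
          moreover have "(\<lambda>x. indicat_real {r} x *\<^sub>R q r) = (\<lambda>x. indicat_real {r} x *\<^sub>R q x)"
            by (auto simp: indicator_def)
          ultimately show ?thesis by (simp add: set_integrable_def)
        qed
        ultimately have "set_integrable lborel (einterval (ereal (a-1)) c \<union> (einterval c (ereal (b+1)) \<union> {r})) q"
          using F by (intro set_integrable_Un) auto
        then show ?thesis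
          by (rule set_integrable_subset) (auto simp: einterval_iff r)
      qed
    qed
    then show ?thesis
      by (rule set_integrable_subset) auto
  qed (simp add: set_integrable_def)
  have split: "?I u = ?I a + integral {a..u} q" if "a \<le> u" for a u
  proof -
    have "interval_lebesgue_integrable lborel (min c (min (ereal a) (ereal u))) (max c (max (ereal a) (ereal u))) q"
    proof (cases "c \<le> ereal a")
      case True
      then show ?thesis using that int[of u] by (simp add: min_def max_def not_le order_trans[OF True])
    next
      case False
      then have *: "min c (min (ereal a) (ereal u)) = ereal a"
        using that by (auto simp: min_def)
      show ?thesis
      proof (cases "c \<le> ereal u")
        case True
        then have "max c (max (ereal a) (ereal u)) = ereal u" using that by (auto simp: max_def)
        then show ?thesis unfolding * using set_int[of a u] that
          by (auto simp: interval_lebesgue_integrable_def elim!: set_integrable_subset)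
      next
        case nle: False
        then have "max c (max (ereal a) (ereal u)) = c" using that by (auto simp: max_def)
        then show ?thesis unfolding * using int[of a] interval_integrable_endpoints_reverse by metis
      qed
    qed
    then have "?I u = ?I a + (LBINT s=ereal a..ereal u. q s)"
      by (rule interval_integral_sum[symmetric])
    then show ?thesis using interval_integral_eq_integral[OF that set_int] by simp
  qed
  show "(?I has_vector_derivative q t) (at_right t)"
  proof -
    have "((\<lambda>u. integral {t..u} q) has_vector_derivative q t) (at t within ({t..t+1} - {}))"
      using set_borel_integral_eq_integral(1)[OF set_int] rc[of t]
      by (intro integral_has_vector_derivative_continuous_at)
         (auto simp: continuous_within at_within_Icc_at_right)
    then have "((\<lambda>u. ?I t + integral {t..u} q) has_vector_derivative q t) (at t within {t..t+1})"
      by (auto intro!: derivative_eq_intros)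
    then have "(?I has_vector_derivative q t) (at t within {t..t+1})"
      by (rule has_vector_derivative_transform[rotated 2]) (auto simp: split)
    then show ?thesis by (simp add: at_within_Icc_at_right)
  qed
  show "continuous_on {a..b} ?I"
  proof -
    have "continuous_on {a..b} (\<lambda>u. ?I a + integral {a..u} q)"
      by (intro continuous_intros indefinite_integral_continuous_1
          set_borel_integral_eq_integral(1)[OF set_int])
    then show ?thesis
      by (rule continuous_on_eq) (rule split[symmetric], simp)
  qed
qed

section \<open>The matrix exponential\<close>

lemma bounded_bilinear_matrix_vector_mult:
  "bounded_bilinear ((*v) :: real^'n^'m \<Rightarrow> real^'n \<Rightarrow> real^'m)"
proof -
  have "bilinear ((*v) :: real^'n^'m \<Rightarrow> real^'n \<Rightarrow> real^'m)"
    unfolding bilinear_def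
    by (auto intro!: linearI simp: matrix_vector_mult_add_rdistrib matrix_vector_right_distrib
        scaleR_matrix_vector_assoc matrix_vector_mult_scaleR)
  then show ?thesis by (simp add: bilinear_conv_bounded_bilinear)
qed

lemma bounded_bilinear_matrix_mult:
  "bounded_bilinear ((**) :: real^'n^'m \<Rightarrow> real^'k^'n \<Rightarrow> real^'k^'m)"
proof -
  have "bilinear ((**) :: real^'n^'m \<Rightarrow> real^'k^'n \<Rightarrow> real^'k^'m)"
    unfolding bilinear_def
    by (auto intro!: linearI simp: matrix_matrix_mult_def vec_eq_iff
        sum.distrib algebra_simps sum_distrib_left scaleR_sum_right)
  then show ?thesis by (simp add: bilinear_conv_bounded_bilinear)
qed

lemmas has_vector_derivative_matrix_vector_mult =
  bounded_bilinear.has_vector_derivative[OF bounded_bilinear_matrix_vector_mult]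

lemmas has_vector_derivative_matrix_mult =
  bounded_bilinear.has_vector_derivative[OF bounded_bilinear_matrix_mult]

lemmas continuous_on_matrix_vector_mult =
  bounded_bilinear.continuous_on[OF bounded_bilinear_matrix_vector_mult]

lemmas tendsto_matrix_vector_mult =
  bounded_bilinear.tendsto[OF bounded_bilinear_matrix_vector_mult]

lemmas bounded_linear_matrix_vector_mult =
  bounded_bilinear.bounded_linear_right[OF bounded_bilinear_matrix_vector_mult]

definition mat_power :: "real^'n^'n \<Rightarrow> nat \<Rightarrow> real^'n^'n" where
  "mat_power A k = ((**) A ^^ k) (mat 1)"

lemma mat_power_simps [simp]:
  "mat_power A 0 = mat 1" "mat_power A (Suc k) = A ** mat_power A k"
  by (simp_all add: mat_power_def)

lemma mat_power_commute: "A ** mat_power A k = mat_power A k ** A"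
  by (induction k) (simp_all add: matrix_mul_assoc)

lemma mat_power_scaleR: "mat_power (t *\<^sub>R A) k = t ^ k *\<^sub>R mat_power A k"
  by (induction k)
     (simp_all add: bounded_bilinear.scaleR_left[OF bounded_bilinear_matrix_mult]
       bounded_bilinear.scaleR_right[OF bounded_bilinear_matrix_mult])

text \<open>The base, the sum of all absolute entries, dominates every row sum, and this is what
  each induction step multiplies by. It gives every entry of the exponential series a majorant of
  the form exp(B |t|).\<close>

lemma mat_power_entry_bound:
  fixes A :: "real^'n^'n"
  shows "\<bar>mat_power A k $ i $ j\<bar> \<le> (\<Sum>i\<in>UNIV. \<Sum>j\<in>UNIV. \<bar>A $ i $ j\<bar>) ^ k"
proof (induction k arbitrary: i j)
  case 0
  then show ?case by (simp add: mat_def)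
next
  case (Suc k)
  let ?B = "\<Sum>i\<in>UNIV. \<Sum>j\<in>UNIV. \<bar>A $ i $ j\<bar>"
  have "\<bar>mat_power A (Suc k) $ i $ j\<bar> \<le> (\<Sum>l\<in>UNIV. \<bar>A $ i $ l\<bar> * \<bar>mat_power A k $ l $ j\<bar>)"
    by (simp add: matrix_matrix_mult_def sum_abs abs_mult[symmetric])
  also have "\<dots> \<le> (\<Sum>l\<in>UNIV. \<bar>A $ i $ l\<bar> * ?B ^ k)"
    by (intro sum_mono mult_left_mono Suc) simp
  also have "\<dots> = (\<Sum>l\<in>UNIV. \<bar>A $ i $ l\<bar>) * ?B ^ k"
    by (simp add: sum_distrib_right)
  also have "(\<Sum>l\<in>UNIV. \<bar>A $ i $ l\<bar>) \<le> ?B"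
    by (rule member_le_sum) (auto intro: sum_nonneg)
  finally show ?case by (simp add: mult_right_mono sum_nonneg)
qed

lemma summable_mat_power_entry:
  fixes A :: "real^'n^'n"
  shows "summable (\<lambda>k. mat_power A k $ i $ j / fact k * t ^ k)"
proof (rule summable_comparison_test')
  let ?B = "\<Sum>i\<in>UNIV. \<Sum>j\<in>UNIV. \<bar>A $ i $ j\<bar>"
  show "summable (\<lambda>k. (?B * \<bar>t\<bar>) ^ k /\<^sub>R fact k)"
    by (rule summable_exp_generic)
  show "norm (mat_power A k $ i $ j / fact k * t ^ k) \<le> (?B * \<bar>t\<bar>) ^ k /\<^sub>R fact k" for k
    using mult_right_mono[OF mat_power_entry_bound[of A k i j], of "\<bar>t\<bar> ^ k / fact k"]
    by (simp add: abs_mult power_abs power_mult_distrib divide_simps)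
qed

text \<open>Reduces the calculus of the matrix exponential to real power series in t, where termwise
  differentiation is available.\<close>

lemma mat_exp_entry:
  "mat_exp (t *\<^sub>R A) $ i $ j = (\<Sum>k. mat_power A k $ i $ j / fact k * t ^ k)"
proof -
  have "(\<lambda>k. (1 / fact k) *\<^sub>R mat_power (t *\<^sub>R A) k) sums
      (\<chi> i j. \<Sum>k. mat_power A k $ i $ j / fact k * t ^ k)"
    unfolding sums_def
  proof (intro vec_tendstoI)
    fix i j
    have "(\<lambda>n. \<Sum>k<n. mat_power A k $ i $ j / fact k * t ^ k) \<longlonglongrightarrow>
        (\<Sum>k. mat_power A k $ i $ j / fact k * t ^ k)"
      using summable_mat_power_entry by (rule summable_LIMSEQ)
    then show "(\<lambda>n. (\<Sum>k<n. (1 / fact k) *\<^sub>R mat_power (t *\<^sub>R A) k) $ i $ j) \<longlonglongrightarrow>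
        (\<chi> i j. \<Sum>k. mat_power A k $ i $ j / fact k * t ^ k) $ i $ j"
      by (simp add: mat_power_scaleR mult.commute)
  qed
  then have "mat_exp (t *\<^sub>R A) = (\<chi> i j. \<Sum>k. mat_power A k $ i $ j / fact k * t ^ k)"
    unfolding mat_exp_def mat_power_def[symmetric] by (rule sums_unique[symmetric])
  then show ?thesis by simp
qed

lemma mat_exp_0 [simp]: "mat_exp (0 :: real^'n^'n) = mat 1"
proof -
  have "mat_exp (0 *\<^sub>R 0) $ i $ j = mat_power (0 :: real^'n^'n) 0 $ i $ j" for i j :: 'n
    unfolding mat_exp_entry by (subst powser_zero) simp
  then show ?thesis by (simp add: vec_eq_iff)
qed

lemma mat_exp_entry_derivative:
  "((\<lambda>t. mat_exp (t *\<^sub>R A) $ i $ j) has_real_derivative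
     (\<Sum>k. mat_power A (Suc k) $ i $ j / fact k * t ^ k)) (at t)"
proof -
  have "diffs (\<lambda>k. mat_power A k $ i $ j / fact k) = (\<lambda>k. mat_power A (Suc k) $ i $ j / fact k)"
    by (simp add: diffs_def fun_eq_iff fact_Suc del: mat_power_simps of_nat_Suc)
  then show ?thesis
    unfolding mat_exp_entry
    using termdiffs_strong_converges_everywhere[OF summable_mat_power_entry, of A i j t] by simp
qed

lemma mat_exp_commute: "A ** mat_exp (t *\<^sub>R A) = mat_exp (t *\<^sub>R A) ** A"
proof -
  have "(\<Sum>l\<in>UNIV. A $ i $ l * mat_exp (t *\<^sub>R A) $ l $ j) =
      (\<Sum>l\<in>UNIV. mat_exp (t *\<^sub>R A) $ i $ l * A $ l $ j)" for i j
  proof -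
    have "(\<Sum>l\<in>UNIV. A $ i $ l * mat_exp (t *\<^sub>R A) $ l $ j) =
        (\<Sum>k. \<Sum>l\<in>UNIV. A $ i $ l * (mat_power A k $ l $ j / fact k * t ^ k))"
      by (simp add: mat_exp_entry suminf_mult[OF summable_mat_power_entry, symmetric]
          suminf_sum[OF summable_mult[OF summable_mat_power_entry], symmetric] del: times_divide_eq_left)
    also have "\<dots> = (\<Sum>k. (A ** mat_power A k) $ i $ j / fact k * t ^ k)"
      by (simp add: matrix_matrix_mult_def sum_distrib_left sum_divide_distrib mult_ac)
    also have "\<dots> = (\<Sum>k. (mat_power A k ** A) $ i $ j / fact k * t ^ k)"
      by (simp only: mat_power_commute)
    also have "\<dots> = (\<Sum>k. \<Sum>l\<in>UNIV. (mat_power A k $ i $ l / fact k * t ^ k) * A $ l $ j)"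
      by (simp add: matrix_matrix_mult_def sum_distrib_left sum_divide_distrib mult_ac)
    also have "\<dots> = (\<Sum>l\<in>UNIV. mat_exp (t *\<^sub>R A) $ i $ l * A $ l $ j)"
      by (simp add: mat_exp_entry suminf_mult2[OF summable_mat_power_entry]
          suminf_sum[OF summable_mult2[OF summable_mat_power_entry], symmetric] del: times_divide_eq_left)
    finally show ?thesis .
  qed
  then show ?thesis by (simp add: vec_eq_iff matrix_matrix_mult_def)
qed

lemma has_vector_derivative_mat_exp:
  "((\<lambda>t. mat_exp (t *\<^sub>R A)) has_vector_derivative A ** mat_exp (t *\<^sub>R A)) (at t within T)"
proof -
  have "(A ** mat_exp (t *\<^sub>R A)) $ i $ j = (\<Sum>k. mat_power A (Suc k) $ i $ j / fact k * t ^ k)" for i j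
  proof -
    have "(A ** mat_exp (t *\<^sub>R A)) $ i $ j =
        (\<Sum>k. \<Sum>l\<in>UNIV. A $ i $ l * (mat_power A k $ l $ j / fact k * t ^ k))"
      by (simp add: mat_exp_entry matrix_matrix_mult_def suminf_mult[OF summable_mat_power_entry, symmetric]
          suminf_sum[OF summable_mult[OF summable_mat_power_entry], symmetric] del: times_divide_eq_left)
    also have "\<dots> = (\<Sum>k. mat_power A (Suc k) $ i $ j / fact k * t ^ k)"
      by (simp add: matrix_matrix_mult_def sum_distrib_left sum_divide_distrib mult_ac)
    finally show ?thesis .
  qed
  then have *: "((\<lambda>t. mat_exp (t *\<^sub>R A) $ i $ j) has_vector_derivative (A ** mat_exp (t *\<^sub>R A)) $ i $ j) (at t within T)"
    for i j
    using mat_exp_entry_derivative[of A i j t]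
    by (simp add: has_real_derivative_iff_has_vector_derivative has_vector_derivative_at_within)
  have vec: "((\<lambda>t. f t) has_vector_derivative f') (at t within T)"
    if "\<And>i. ((\<lambda>t. f t $ i) has_vector_derivative f' $ i) (at t within T)"
    for f :: "real \<Rightarrow> ('b::real_normed_vector)^'n" and f'
    using that unfolding has_vector_derivative_def has_derivative_def
    by (auto intro!: vec_tendstoI bounded_linear_scaleR_left)
  show ?thesis by (intro vec *)
qed

text \<open>Since \<open>A\<close> commutes with its exponential, exp(- r A) exp((r + u) A) has
  derivative 0 in r and keeps its value exp(u A) at r = 0. The functional equation is the case r = -
  t, u = t + s.\<close>

lemma mat_exp_add: "mat_exp ((t + s) *\<^sub>R A) = mat_exp (t *\<^sub>R A) ** mat_exp (s *\<^sub>R A)"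
proof -
  have *: "mat_exp (- (r *\<^sub>R A)) ** mat_exp ((r + u) *\<^sub>R A) = mat_exp (u *\<^sub>R A)" for r u
  proof -
    let ?f = "\<lambda>r. mat_exp ((- r) *\<^sub>R A) ** mat_exp ((r + u) *\<^sub>R A)"
    have "(?f has_vector_derivative 0) (at r within UNIV)" for r
    proof -
      have 1: "((\<lambda>r. mat_exp ((- r) *\<^sub>R A)) has_vector_derivative
          - (mat_exp ((- r) *\<^sub>R A) ** A)) (at r)"
      proof -
        have "(uminus has_vector_derivative - 1) (at r)"
          by (auto intro!: derivative_eq_intros)
        from vector_diff_chain_at[OF this has_vector_derivative_mat_exp[of A "- r"]]
        show ?thesis using mat_exp_commute[of A "- r"] by (simp add: o_def)
      qed
      have 2: "((\<lambda>r. mat_exp ((r + u) *\<^sub>R A)) has_vector_derivative A ** mat_exp ((r + u) *\<^sub>R A)) (at r)"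
      proof -
        have "((\<lambda>r. r + u) has_vector_derivative 1) (at r)"
          by (auto intro!: derivative_eq_intros)
        from vector_diff_chain_at[OF this has_vector_derivative_mat_exp[of A "r + u"]]
        show ?thesis by (simp add: o_def)
      qed
      show ?thesis
        using has_vector_derivative_matrix_mult[OF 1 2]
        by (simp add: matrix_mul_assoc bounded_bilinear.minus_left[OF bounded_bilinear_matrix_mult])
    qed
    note deriv = this
    obtain c where c: "\<And>r. r \<in> UNIV \<Longrightarrow> ?f r = c"
      by (rule has_vector_derivative_zero_constant[OF convex_UNIV deriv]) blast
    have "?f r = ?f 0" using c[of r] c[of 0] by (simp only: UNIV_I)
    then show ?thesis by simp
  qed
  show ?thesis
    using *[of "- t" "t + s"] by simp
qed

lemma mat_exp_diff: "mat_exp ((t - s) *\<^sub>R A) = mat_exp (t *\<^sub>R A) ** mat_exp ((- s) *\<^sub>R A)"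
  using mat_exp_add[of t "- s" A] by simp

lemma mat_exp_inverse [simp]: "mat_exp (t *\<^sub>R A) ** mat_exp ((- t) *\<^sub>R A) = mat 1"
  using mat_exp_add[of t "- t" A] by simp

lemma continuous_on_mat_exp: "continuous_on T (\<lambda>t. mat_exp (t *\<^sub>R A))"
  by (rule continuous_on_vector_derivative) (rule has_vector_derivative_mat_exp)

section \<open>The variation of constants formula\<close>

lemma interval_lebesgue_bounded_linear:
  fixes f :: "real \<Rightarrow> 'a::{banach, second_countable_topology}"
    and T :: "'a \<Rightarrow> 'b::{banach, second_countable_topology}"
  assumes "bounded_linear T" and "interval_lebesgue_integrable M a b f"
  shows "interval_lebesgue_integrable M a b (\<lambda>s. T (f s))"
    and "interval_lebesgue_integral M a b (\<lambda>s. T (f s)) = T (interval_lebesgue_integral M a b f)"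
proof -
  interpret T: bounded_linear T by fact
  have *: "(\<lambda>x. indicator X x *\<^sub>R T (f x)) = (\<lambda>x. T (indicator X x *\<^sub>R f x))" for X
    by (simp add: T.scaleR)
  show "interval_lebesgue_integrable M a b (\<lambda>s. T (f s))"
    using assms(2) unfolding interval_lebesgue_integrable_def set_integrable_def *
    by (auto intro: integrable_bounded_linear[OF assms(1)] split: if_splits)
  show "interval_lebesgue_integral M a b (\<lambda>s. T (f s)) = T (interval_lebesgue_integral M a b f)"
    using assms(2)
    unfolding interval_lebesgue_integrable_def set_integrable_def
      interval_lebesgue_integral_def set_lebesgue_integral_def *
    by (auto simp: integral_bounded_linear[OF assms(1)] T.neg split: if_splits)
qed

text \<open>The variation of constants integral. With an extended real base point one notion serves
  the integrals from 0, +\<infinity> and -\<infinity>; if \<open>c\<close> exceeds t, the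
  orientation of the interval integral supplies the minus sign.\<close>

definition duhamel :: "real^'n^'n \<Rightarrow> ereal \<Rightarrow> (real \<Rightarrow> real^'n) \<Rightarrow> real \<Rightarrow> real^'n" where
  "duhamel A c k t = (LBINT s=c..ereal t. mat_exp ((t - s) *\<^sub>R A) *v k s)"

definition duhamel_integrable :: "real^'n^'n \<Rightarrow> ereal \<Rightarrow> (real \<Rightarrow> real^'n) \<Rightarrow> bool" where
  "duhamel_integrable A c k \<longleftrightarrow>
     (\<forall>t. interval_lebesgue_integrable lborel c (ereal t) (\<lambda>s. mat_exp ((t - s) *\<^sub>R A) *v k s))"

text \<open>The invertible factor exp(t A) can be pulled out without affecting integrability. The
  remaining integrand is free of t, which is what allows differentiation in the upper limit.\<close>

lemma duhamel_integrable_iff: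
  "duhamel_integrable A c k \<longleftrightarrow>
     (\<forall>t. interval_lebesgue_integrable lborel c (ereal t) (\<lambda>s. mat_exp ((- s) *\<^sub>R A) *v k s))"
proof -
  have "interval_lebesgue_integrable lborel c (ereal t) (\<lambda>s. mat_exp ((t - s) *\<^sub>R A) *v k s) \<longleftrightarrow>
      interval_lebesgue_integrable lborel c (ereal t) (\<lambda>s. mat_exp ((- s) *\<^sub>R A) *v k s)" for t
  proof
    assume "interval_lebesgue_integrable lborel c (ereal t) (\<lambda>s. mat_exp ((t - s) *\<^sub>R A) *v k s)"
    from interval_lebesgue_bounded_linear(1)[OF bounded_linear_matrix_vector_mult this, of "mat_exp ((- t) *\<^sub>R A)"]
    show "interval_lebesgue_integrable lborel c (ereal t) (\<lambda>s. mat_exp ((- s) *\<^sub>R A) *v k s)"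
      by (simp add: matrix_vector_mul_assoc mat_exp_add[symmetric] scaleR_left_distrib[symmetric]
          del: scaleR_minus_left)
  next
    assume "interval_lebesgue_integrable lborel c (ereal t) (\<lambda>s. mat_exp ((- s) *\<^sub>R A) *v k s)"
    from interval_lebesgue_bounded_linear(1)[OF bounded_linear_matrix_vector_mult this, of "mat_exp (t *\<^sub>R A)"]
    show "interval_lebesgue_integrable lborel c (ereal t) (\<lambda>s. mat_exp ((t - s) *\<^sub>R A) *v k s)"
      by (simp add: matrix_vector_mul_assoc mat_exp_diff)
  qed
  then show ?thesis by (simp add: duhamel_integrable_def)
qed

lemma duhamel_eq:
  assumes "duhamel_integrable A c k"
  shows "duhamel A c k t = mat_exp (t *\<^sub>R A) *v (LBINT s=c..ereal t. mat_exp ((- s) *\<^sub>R A) *v k s)"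
proof -
  have "interval_lebesgue_integrable lborel c (ereal t) (\<lambda>s. mat_exp ((- s) *\<^sub>R A) *v k s)"
    using assms by (simp add: duhamel_integrable_iff)
  from interval_lebesgue_bounded_linear(2)[OF bounded_linear_matrix_vector_mult this, of "mat_exp (t *\<^sub>R A)"]
  show ?thesis by (simp add: duhamel_def mat_exp_diff matrix_vector_mul_assoc)
qed

lemma right_continuous_mat_exp_mult:
  assumes "(k \<longlongrightarrow> k t) (at_right t)"
  shows "((\<lambda>s. mat_exp ((- s) *\<^sub>R A) *v k s) \<longlongrightarrow> mat_exp ((- t) *\<^sub>R A) *v k t) (at_right t)"
proof (rule tendsto_matrix_vector_mult[OF _ assms])
  have "continuous_on UNIV (\<lambda>s. mat_exp ((- s) *\<^sub>R A))"
    using continuous_on_compose2[OF continuous_on_mat_exp[of UNIV A], of UNIV uminus]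
    by (simp add: continuous_on_minus)
  then show "((\<lambda>s. mat_exp ((- s) *\<^sub>R A)) \<longlongrightarrow> mat_exp ((- t) *\<^sub>R A)) (at_right t)"
    by (simp add: continuous_on_def filterlim_at_split)
qed

lemma duhamel_right_derivative:
  assumes rc: "\<And>t. (k \<longlongrightarrow> k t) (at_right t)" and int: "duhamel_integrable A c k"
  shows "(duhamel A c k has_vector_derivative A *v duhamel A c k t + k t) (at_right t)"
proof -
  let ?I = "\<lambda>t. LBINT s=c..ereal t. mat_exp ((- s) *\<^sub>R A) *v k s"
  have "(?I has_vector_derivative mat_exp ((- t) *\<^sub>R A) *v k t) (at_right t)"
    using int by (intro integral_right_continuous right_continuous_mat_exp_mult rc)
      (simp add: duhamel_integrable_iff)
  from has_vector_derivative_matrix_vector_mult[OF has_vector_derivative_mat_exp this, of A]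
  show ?thesis
    unfolding duhamel_eq[OF int, abs_def]
    by (simp add: matrix_vector_mul_assoc add.commute del: scaleR_minus_left)
qed

lemma duhamel_continuous:
  assumes rc: "\<And>t. (k \<longlongrightarrow> k t) (at_right t)" and int: "duhamel_integrable A c k"
  shows "continuous_on {a..b} (duhamel A c k)"
  unfolding duhamel_eq[OF int, abs_def] using int
  by (intro continuous_on_matrix_vector_mult continuous_on_mat_exp integral_right_continuous
      right_continuous_mat_exp_mult rc) (simp add: duhamel_integrable_iff)

lemma duhamel_diff:
  assumes "duhamel_integrable A c k" "duhamel_integrable A c l"
  shows "duhamel A c k t - duhamel A c l t = duhamel A c (\<lambda>s. k s - l s) t"
  using assms
  by (simp add: duhamel_def duhamel_integrable_def matrix_vector_mult_diff_distrib)

lemma duhamel_integrable_0: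
  fixes k :: "real \<Rightarrow> real^'n"
  assumes rc: "\<And>t. (k \<longlongrightarrow> k t) (at_right t)"
    and bound: "\<And>s. norm (k s) \<le> N * exp (- \<mu> * s)"
  shows "duhamel_integrable A 0 k"
proof -
  let ?q = "\<lambda>s. mat_exp ((- s) *\<^sub>R A) *v k s"
  have meas: "?q \<in> borel_measurable borel"
    by (intro right_continuous_imp_borel_measurable right_continuous_mat_exp_mult rc)
  have "set_integrable lborel {a..b} ?q" for a b
  proof -
    have cont: "continuous_on {a..b} (\<lambda>s. mat_exp ((- s) *\<^sub>R A))"
      using continuous_on_compose2[OF continuous_on_mat_exp[of UNIV A], of "{a..b}" uminus]
      by (simp add: continuous_on_minus)
    obtain C where C: "\<And>M (x::real^'n). norm ((M::real^'n^'n) *v x) \<le> norm M * norm x * C"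
      using bounded_bilinear.bounded[OF bounded_bilinear_matrix_vector_mult] by blast
    have "set_integrable lborel {a..b} (\<lambda>s. norm (mat_exp ((- s) *\<^sub>R A)) * (N * exp (- \<mu> * s)) * \<bar>C\<bar>)"
      by (intro borel_integrable_atLeastAtMost' continuous_intros cont)
    then show ?thesis
    proof (rule set_integrable_bound)
      show "set_borel_measurable lborel {a..b} ?q"
        using meas by (auto simp: set_borel_measurable_def)
      have "norm (?q s) \<le> norm (norm (mat_exp ((- s) *\<^sub>R A)) * (N * exp (- \<mu> * s)) * \<bar>C\<bar>)" for s
      proof -
        have "norm (?q s) \<le> norm (mat_exp ((- s) *\<^sub>R A)) * norm (k s) * \<bar>C\<bar>"
          by (rule order_trans[OF C]) (intro mult_left_mono abs_ge_self mult_nonneg_nonneg norm_ge_zero)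
        also have "\<dots> \<le> norm (mat_exp ((- s) *\<^sub>R A)) * (N * exp (- \<mu> * s)) * \<bar>C\<bar>"
          by (intro mult_left_mono mult_right_mono bound) auto
        finally show ?thesis by simp
      qed
      then show "AE s in lborel. s \<in> {a..b} \<longrightarrow>
          norm (?q s) \<le> norm (norm (mat_exp ((- s) *\<^sub>R A)) * (N * exp (- \<mu> * s)) * \<bar>C\<bar>)"
        by blast
    qed
  qed
  then have "set_integrable lborel {a<..<b} ?q" for a b
    by (rule set_integrable_subset[of _ "{a..b}"]) auto
  then show ?thesis
    unfolding duhamel_integrable_iff interval_lebesgue_integrable_def zero_ereal_def by simp
qed

section \<open>Weighted bounds for variation of constants integrals over half-lines\<close>

lemma exp_integral_to_infinity:
  fixes r t :: real
  assumes "0 < r"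
  shows "set_integrable lborel {t<..} (\<lambda>s. exp (- r * s))"
    and "(LBINT s:{t<..}. exp (- r * s)) = exp (- r * t) / r"
proof -
  have lim: "((\<lambda>s. - (exp (- r * s) / r)) \<longlongrightarrow> 0) at_top"
    using \<open>0 < r\<close> by real_asymp
  have lim': "((\<lambda>s. - (exp (- r * s) / r)) \<longlongrightarrow> - (exp (- r * t) / r)) (at_right t)"
    using \<open>0 < r\<close> by (intro tendsto_intros) simp
  have D: "DERIV (\<lambda>s. - (exp (- r * s) / r)) s :> exp (- r * s)" for s
    using \<open>0 < r\<close> by (auto intro!: derivative_eq_intros)
  have A: "(((\<lambda>s. - (exp (- r * s) / r)) \<circ> real_of_ereal) \<longlongrightarrow> - (exp (- r * t) / r)) (at_right (ereal t))"
    and B: "(((\<lambda>s. - (exp (- r * s) / r)) \<circ> real_of_ereal) \<longlongrightarrow> 0) (at_left \<infinity>)"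
    unfolding ereal_tendsto_simps by (rule lim' lim)+
  note * = interval_integral_FTC_nonneg[OF _ D _ _ A B, simplified]
  show "set_integrable lborel {t<..} (\<lambda>s. exp (- r * s))"
    using *(1) by simp
  show "(LBINT s:{t<..}. exp (- r * s)) = exp (- r * t) / r"
    using *(2) by (simp add: interval_lebesgue_integral_def)
qed

lemma exp_integral_from_minus_infinity:
  fixes r t :: real
  assumes "0 < r"
  shows "set_integrable lborel {..<t} (\<lambda>s. exp (r * s))"
    and "(LBINT s:{..<t}. exp (r * s)) = exp (r * t) / r"
proof -
  have lim: "((\<lambda>s. exp (r * s) / r) \<longlongrightarrow> 0) at_bot"
    using \<open>0 < r\<close> by real_asymp
  have lim': "((\<lambda>s. exp (r * s) / r) \<longlongrightarrow> exp (r * t) / r) (at_left t)"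
    using \<open>0 < r\<close> by (intro tendsto_intros) simp
  have D: "DERIV (\<lambda>s. exp (r * s) / r) s :> exp (r * s)" for s
    using \<open>0 < r\<close> by (auto intro!: derivative_eq_intros)
  have A: "(((\<lambda>s. exp (r * s) / r) \<circ> real_of_ereal) \<longlongrightarrow> 0) (at_right (-\<infinity>))"
    and B: "(((\<lambda>s. exp (r * s) / r) \<circ> real_of_ereal) \<longlongrightarrow> exp (r * t) / r) (at_left (ereal t))"
    unfolding ereal_tendsto_simps by (rule lim' lim)+
  note * = interval_integral_FTC_nonneg[OF _ D _ _ A B, simplified]
  show "set_integrable lborel {..<t} (\<lambda>s. exp (r * s))"
    using *(1) by simp
  show "(LBINT s:{..<t}. exp (r * s)) = exp (r * t) / r"
    using *(2) by (simp add: interval_lebesgue_integral_def)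
qed

lemma set_integral_dominated:
  fixes q :: "real \<Rightarrow> 'b::{banach, second_countable_topology}" and g :: "real \<Rightarrow> real"
  assumes g: "set_integrable M X g" and q: "q \<in> borel_measurable M" and X: "X \<in> sets M"
    and le: "\<And>s. s \<in> X \<Longrightarrow> norm (q s) \<le> g s"
  shows "set_integrable M X q" and "norm (LINT s:X|M. q s) \<le> (LINT s:X|M. g s)"
proof -
  show int: "set_integrable M X q"
    using g by (rule set_integrable_bound)
      (use q X le in \<open>auto simp: set_borel_measurable_def intro!: AE_I2 order_trans[OF le]\<close>)
  show "norm (LINT s:X|M. q s) \<le> (LINT s:X|M. g s)"
    unfolding set_lebesgue_integral_def
    using int g le by (intro Bochner_Integration.integral_norm_bound_integral) (auto simp: set_integrable_def indicator_def)
qed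

lemma measurable_duhamel_integrand:
  assumes rc: "\<And>t. (k \<longlongrightarrow> k t) (at_right t)"
  shows "(\<lambda>s. mat_exp ((t - s) *\<^sub>R A) *v k s) \<in> borel_measurable lborel"
proof -
  have "(\<lambda>s. mat_exp ((- s) *\<^sub>R A) *v k s) \<in> borel_measurable borel"
    by (intro right_continuous_imp_borel_measurable right_continuous_mat_exp_mult rc)
  then have "(\<lambda>s. mat_exp (t *\<^sub>R A) *v (mat_exp ((- s) *\<^sub>R A) *v k s)) \<in> borel_measurable borel"
    by (rule measurable_compose)
       (intro borel_measurable_continuous_onI linear_continuous_on bounded_linear_matrix_vector_mult)
  then show ?thesis by (simp add: mat_exp_diff matrix_vector_mul_assoc)
qed

text \<open>For s > t the propagator acts backwards and contributes exp(a (t - s)). Against a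
  forcing of size exp(- \<mu> s) the integrand decays at rate a + \<mu>, and integration yields the
  factor 1 / (a + \<mu>), which becomes the slow share of the contraction constant.\<close>

lemma duhamel_infinity:
  assumes A: "\<And>t x. t \<le> 0 \<Longrightarrow> norm (mat_exp (t *\<^sub>R A) *v x) \<le> exp (a * t) * norm x"
    and "0 < a + \<mu>"
    and rc: "\<And>t. (k \<longlongrightarrow> k t) (at_right t)"
    and bound: "\<And>s. norm (k s) \<le> N * exp (- \<mu> * s)"
  shows "duhamel_integrable A \<infinity> k"
    and "norm (duhamel A \<infinity> k t) \<le> N / (a + \<mu>) * exp (- \<mu> * t)"
proof -
  have le: "norm (mat_exp ((t - s) *\<^sub>R A) *v k s) \<le> N * exp (a * t) * exp (- (a + \<mu>) * s)" if "s \<in> {t<..}" for s t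
  proof -
    have "norm (mat_exp ((t - s) *\<^sub>R A) *v k s) \<le> exp (a * (t - s)) * (N * exp (- \<mu> * s))"
      using that by (intro order_trans[OF A] mult_left_mono bound) auto
    also have "\<dots> = N * exp (a * t) * exp (- (a + \<mu>) * s)"
      by (simp add: exp_add[symmetric] algebra_simps)
    finally show ?thesis .
  qed
  have g: "set_integrable lborel {t<..} (\<lambda>s. N * exp (a * t) * exp (- (a + \<mu>) * s))" for t
    using exp_integral_to_infinity(1)[OF \<open>0 < a + \<mu>\<close>] by (rule set_integrable_mult_right)
  note * = set_integral_dominated[OF g measurable_duhamel_integrand[OF rc] _ le]
  show "duhamel_integrable A \<infinity> k"
    using *(1) by (auto simp: duhamel_integrable_def interval_lebesgue_integrable_def)
  have "norm (duhamel A \<infinity> k t) = norm (LBINT s:{t<..}. mat_exp ((t - s) *\<^sub>R A) *v k s)"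
    by (simp add: duhamel_def interval_lebesgue_integral_def)
  also have "\<dots> \<le> (LBINT s:{t<..}. N * exp (a * t) * exp (- (a + \<mu>) * s))"
    by (rule *(2)) auto
  also have "\<dots> = N * exp (a * t) * (exp (- (a + \<mu>) * t) / (a + \<mu>))"
    by (simp only: set_integral_mult_right exp_integral_to_infinity(2)[OF \<open>0 < a + \<mu>\<close>])
  also have "\<dots> = N / (a + \<mu>) * exp (- \<mu> * t)"
    by (simp add: exp_add[symmetric] algebra_simps)
  finally show "norm (duhamel A \<infinity> k t) \<le> N / (a + \<mu>) * exp (- \<mu> * t)" .
qed

text \<open>The mirror image towards the past: the propagator contributes exp(b (t - s)) for s < t,
  and b + \<mu> < 0 lets this win against the growth permitted to the forcing as s tends to
  -\<infinity>. The factor 1 / - (b + \<mu>) becomes the fast share.\<close>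

lemma duhamel_minus_infinity:
  assumes A: "\<And>t x. 0 \<le> t \<Longrightarrow> norm (mat_exp (t *\<^sub>R A) *v x) \<le> exp (b * t) * norm x"
    and "b + \<mu> < 0"
    and rc: "\<And>t. (k \<longlongrightarrow> k t) (at_right t)"
    and bound: "\<And>s. norm (k s) \<le> N * exp (- \<mu> * s)"
  shows "duhamel_integrable A (-\<infinity>) k"
    and "norm (duhamel A (-\<infinity>) k t) \<le> N / - (b + \<mu>) * exp (- \<mu> * t)"
proof -
  have r: "0 < - (b + \<mu>)" using \<open>b + \<mu> < 0\<close> by simp
  have le: "norm (mat_exp ((t - s) *\<^sub>R A) *v k s) \<le> N * exp (b * t) * exp (- (b + \<mu>) * s)" if "s \<in> {..<t}" for s t
  proof -
    have "norm (mat_exp ((t - s) *\<^sub>R A) *v k s) \<le> exp (b * (t - s)) * (N * exp (- \<mu> * s))"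
      using that by (intro order_trans[OF A] mult_left_mono bound) auto
    also have "\<dots> = N * exp (b * t) * exp (- (b + \<mu>) * s)"
      by (simp add: exp_add[symmetric] algebra_simps)
    finally show ?thesis .
  qed
  have g: "set_integrable lborel {..<t} (\<lambda>s. N * exp (b * t) * exp (- (b + \<mu>) * s))" for t
    using exp_integral_from_minus_infinity(1)[OF r] by (rule set_integrable_mult_right)
  note * = set_integral_dominated[OF g measurable_duhamel_integrand[OF rc] _ le]
  show "duhamel_integrable A (-\<infinity>) k"
    using *(1) by (auto simp: duhamel_integrable_def interval_lebesgue_integrable_def)
  have "norm (duhamel A (-\<infinity>) k t) = norm (LBINT s:{..<t}. mat_exp ((t - s) *\<^sub>R A) *v k s)"
    by (simp add: duhamel_def interval_lebesgue_integral_def)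
  also have "\<dots> \<le> (LBINT s:{..<t}. N * exp (b * t) * exp (- (b + \<mu>) * s))"
    by (rule *(2)) auto
  also have "\<dots> = N * exp (b * t) * (exp (- (b + \<mu>) * t) / - (b + \<mu>))"
    by (simp only: set_integral_mult_right exp_integral_from_minus_infinity(2)[OF r])
  also have "\<dots> = N / - (b + \<mu>) * (exp (b * t) * exp (- (b + \<mu>) * t))"
    by simp
  also have "exp (b * t) * exp (- (b + \<mu>) * t) = exp (- \<mu> * t)"
    by (simp add: exp_add[symmetric] algebra_simps)
  finally show "norm (duhamel A (-\<infinity>) k t) \<le> N / - (b + \<mu>) * exp (- \<mu> * t)" .
qed

section \<open>Weighted growth estimates\<close>

text \<open>The integrating factor: transporting \<open>w\<close> from time s to the fixed time t
  cancels the linear part, so that only the forcing remains to be integrated.\<close>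

lemma propagated_right_derivative:
  assumes "(w has_vector_derivative A *v w s + k) (at_right s)"
  shows "((\<lambda>s. mat_exp ((t - s) *\<^sub>R A) *v w s) has_vector_derivative mat_exp ((t - s) *\<^sub>R A) *v k) (at_right s)"
proof -
  have "((\<lambda>s. t - s) has_vector_derivative - 1) (at s)"
    by (auto intro!: derivative_eq_intros)
  from vector_diff_chain_at[OF this has_vector_derivative_mat_exp[of A "t - s"]]
  have "((\<lambda>s. mat_exp ((t - s) *\<^sub>R A)) has_vector_derivative - (mat_exp ((t - s) *\<^sub>R A) ** A)) (at_right s)"
    by (simp add: o_def mat_exp_commute has_vector_derivative_at_within)
  from has_vector_derivative_matrix_vector_mult[OF this assms]
  show ?thesis
    by (simp add: matrix_vector_right_distrib matrix_vector_mul_assoc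
        bounded_bilinear.minus_left[OF bounded_bilinear_matrix_vector_mult])
qed

lemma propagated_continuous_on:
  assumes "continuous_on X w"
  shows "continuous_on X (\<lambda>s. mat_exp ((t - s) *\<^sub>R A) *v w s)"
  by (intro continuous_on_matrix_vector_mult assms
      continuous_on_compose2[OF continuous_on_mat_exp[of UNIV A]] continuous_intros) auto

lemma exp_antiderivative:
  fixes c x r t :: real
  assumes "r \<noteq> 0"
  shows "((\<lambda>s. c / r * exp (x + r * s)) has_vector_derivative c * exp (x + r * t)) (at t within X)"
  unfolding has_real_derivative_iff_has_vector_derivative[symmetric]
  using assms by (auto intro!: derivative_eq_intros)

text \<open>Integrating factor and mean value inequality for a given solution on a compact interval.
  The boundary term sits at the right end, so it can be removed by a zero there or by sending that
  end to +\<infinity>. Here \<open>\<alpha>\<close> is a rate of the linear part, unrelated to the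
  stability index.\<close>

lemma backward_estimate:
  assumes A: "\<And>t x. t \<le> 0 \<Longrightarrow> norm (mat_exp (t *\<^sub>R A) *v x) \<le> exp (\<alpha> * t) * norm x"
    and rate: "0 < \<alpha> + \<mu>" and "a \<le> b" and cont: "continuous_on {a..b} w" and "0 \<le> N"
    and deriv: "\<And>t. a \<le> t \<Longrightarrow> t < b \<Longrightarrow> (w has_vector_derivative A *v w t + k t) (at_right t)"
    and bound: "\<And>t. a \<le> t \<Longrightarrow> t < b \<Longrightarrow> norm (k t) \<le> N * exp (- \<mu> * t)"
  shows "norm (w a) \<le> exp (\<alpha> * (a - b)) * norm (w b) + N / (\<alpha> + \<mu>) * exp (- \<mu> * a)"
proof -
  let ?p = "\<lambda>s. mat_exp ((a - s) *\<^sub>R A) *v w s"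
  let ?\<phi> = "\<lambda>s. N / - (\<alpha> + \<mu>) * exp (\<alpha> * a + (- (\<alpha> + \<mu>)) * s)"
  have "norm (?p b - ?p a) \<le> ?\<phi> b - ?\<phi> a"
  proof (rule right_derivative_mean_value[OF \<open>a \<le> b\<close>])
    show "continuous_on {a..b} ?p" by (rule propagated_continuous_on[OF cont])
    show "continuous_on {a..b} ?\<phi>" by (intro continuous_intros)
    fix t assume t: "a \<le> t" "t < b"
    show "(?p has_vector_derivative mat_exp ((a - t) *\<^sub>R A) *v k t) (at_right t)"
      by (rule propagated_right_derivative[OF deriv[OF t]])
    show "(?\<phi> has_vector_derivative N * exp (\<alpha> * a + (- (\<alpha> + \<mu>)) * t)) (at_right t)"
      using rate by (intro exp_antiderivative) simp
    have "norm (mat_exp ((a - t) *\<^sub>R A) *v k t) \<le> exp (\<alpha> * (a - t)) * (N * exp (- \<mu> * t))"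
      using t by (intro order_trans[OF A] mult_left_mono bound) auto
    also have "\<dots> = N * exp (\<alpha> * a + (- (\<alpha> + \<mu>)) * t)"
      by (simp add: exp_add[symmetric] algebra_simps)
    finally show "norm (mat_exp ((a - t) *\<^sub>R A) *v k t) \<le> N * exp (\<alpha> * a + (- (\<alpha> + \<mu>)) * t)" .
  qed
  \<comment> \<open>The value of \<open>?\<phi>\<close> at b is non-positive and is dropped, which
    keeps this part of the bound uniform in b.\<close>
  also have "\<dots> \<le> - ?\<phi> a"
    using \<open>0 \<le> N\<close> rate by (simp add: divide_nonneg_neg)
  also have "\<dots> = N / (\<alpha> + \<mu>) * exp (- \<mu> * a)"
  proof -
    have "\<alpha> * a + (- (\<alpha> + \<mu>)) * a = - \<mu> * a" by (simp add: algebra_simps)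
    then show ?thesis by (simp only: divide_minus_right mult_minus_left minus_minus)
  qed
  finally have "norm (w a) \<le> norm (?p b) + N / (\<alpha> + \<mu>) * exp (- \<mu> * a)"
    using norm_triangle_ineq2[of "w a" "?p b"] by (simp add: norm_minus_commute)
  moreover have "norm (?p b) \<le> exp (\<alpha> * (a - b)) * norm (w b)"
    using \<open>a \<le> b\<close> by (intro A) simp
  ultimately show ?thesis by simp
qed

text \<open>The counterpart with the boundary term at the left end, which is later sent to
  -\<infinity> or placed at time 0.\<close>

lemma forward_estimate:
  assumes A: "\<And>t x. 0 \<le> t \<Longrightarrow> norm (mat_exp (t *\<^sub>R A) *v x) \<le> exp (\<beta> * t) * norm x"
    and rate: "\<beta> + \<mu> < 0" and "a \<le> b" and cont: "continuous_on {a..b} w" and "0 \<le> N"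
    and deriv: "\<And>t. a \<le> t \<Longrightarrow> t < b \<Longrightarrow> (w has_vector_derivative A *v w t + k t) (at_right t)"
    and bound: "\<And>t. a \<le> t \<Longrightarrow> t < b \<Longrightarrow> norm (k t) \<le> N * exp (- \<mu> * t)"
  shows "norm (w b) \<le> exp (\<beta> * (b - a)) * norm (w a) + N / - (\<beta> + \<mu>) * exp (- \<mu> * b)"
proof -
  let ?p = "\<lambda>s. mat_exp ((b - s) *\<^sub>R A) *v w s"
  let ?\<phi> = "\<lambda>s. N / - (\<beta> + \<mu>) * exp (\<beta> * b + (- (\<beta> + \<mu>)) * s)"
  have "norm (?p b - ?p a) \<le> ?\<phi> b - ?\<phi> a"
  proof (rule right_derivative_mean_value[OF \<open>a \<le> b\<close>])
    show "continuous_on {a..b} ?p" by (rule propagated_continuous_on[OF cont])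
    show "continuous_on {a..b} ?\<phi>" by (intro continuous_intros)
    fix t assume t: "a \<le> t" "t < b"
    show "(?p has_vector_derivative mat_exp ((b - t) *\<^sub>R A) *v k t) (at_right t)"
      by (rule propagated_right_derivative[OF deriv[OF t]])
    show "(?\<phi> has_vector_derivative N * exp (\<beta> * b + (- (\<beta> + \<mu>)) * t)) (at_right t)"
      using rate by (intro exp_antiderivative) simp
    have "norm (mat_exp ((b - t) *\<^sub>R A) *v k t) \<le> exp (\<beta> * (b - t)) * (N * exp (- \<mu> * t))"
      using t by (intro order_trans[OF A] mult_left_mono bound) auto
    also have "\<dots> = N * exp (\<beta> * b + (- (\<beta> + \<mu>)) * t)"
      by (simp add: exp_add[symmetric] algebra_simps)
    finally show "norm (mat_exp ((b - t) *\<^sub>R A) *v k t) \<le> N * exp (\<beta> * b + (- (\<beta> + \<mu>)) * t)" .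
  qed
  also have "\<dots> \<le> ?\<phi> b"
    using \<open>0 \<le> N\<close> rate by (simp add: divide_nonneg_neg)
  also have "\<dots> = N / - (\<beta> + \<mu>) * exp (- \<mu> * b)"
    by (simp add: algebra_simps)
  finally have "norm (w b) \<le> norm (?p a) + N / - (\<beta> + \<mu>) * exp (- \<mu> * b)"
    using norm_triangle_ineq2[of "w b" "?p a"] by simp
  moreover have "norm (?p a) \<le> exp (\<beta> * (b - a)) * norm (w a)"
    using \<open>a \<le> b\<close> by (intro A) simp
  ultimately show ?thesis by simp
qed

text \<open>The squared norm is used because the norm need not be differentiable at zeros of
  \<open>w\<close>. The weight exp(- 2 L s) makes it nonincreasing and exp(2 L s) makes it
  nondecreasing; the first exploits a zero at the left end, the second one at the right end. This
  gives uniqueness in both time directions.\<close>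

lemma right_derivative_gronwall_zero:
  fixes w :: "real \<Rightarrow> 'a::real_inner"
  assumes cont: "continuous_on {a..b} w"
    and deriv: "\<And>t. a \<le> t \<Longrightarrow> t < b \<Longrightarrow> (w has_vector_derivative w' t) (at_right t)"
    and bound: "\<And>t. a \<le> t \<Longrightarrow> t < b \<Longrightarrow> norm (w' t) \<le> L * norm (w t)"
    and zero: "w a = 0 \<or> w b = 0" and t: "t \<in> {a..b}"
  shows "w t = 0"
proof -
  have ip: "\<bar>w s \<bullet> w' s\<bar> \<le> L * (w s \<bullet> w s)" if "a \<le> s" "s < b" for s
  proof -
    have "\<bar>w s \<bullet> w' s\<bar> \<le> norm (w s) * norm (w' s)" by (rule Cauchy_Schwarz_ineq2)
    also have "\<dots> \<le> norm (w s) * (L * norm (w s))" by (intro mult_left_mono bound that) simp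
    also have "\<dots> = L * (w s \<bullet> w s)" by (simp add: power2_norm_eq_inner[symmetric] power2_eq_square)
    finally show ?thesis .
  qed
  have d: "((\<lambda>s. (w s \<bullet> w s) * exp (r * s)) has_vector_derivative
      (2 * (w s \<bullet> w' s) + r * (w s \<bullet> w s)) * exp (r * s)) (at_right s)"
    if "a \<le> s" "s < b" for s r
  proof -
    have "((\<lambda>s. w s \<bullet> w s) has_vector_derivative w s \<bullet> w' s + w' s \<bullet> w s) (at_right s)"
      by (intro bounded_bilinear.has_vector_derivative[OF bounded_bilinear_inner] deriv that)
    moreover have "((\<lambda>s. exp (r * s)) has_vector_derivative r * exp (r * s)) (at_right s)"
      unfolding has_real_derivative_iff_has_vector_derivative[symmetric]
      by (auto intro!: derivative_eq_intros)
    ultimately show ?thesis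
      using bounded_bilinear.has_vector_derivative[OF bounded_bilinear_mult]
      by (fastforce simp: inner_commute algebra_simps)
  qed
  have "(w t \<bullet> w t) * exp (r * t) \<le> 0" if "r = - 2 * L \<and> w a = 0 \<or> r = 2 * L \<and> w b = 0" for r
    using that
  proof
    assume r: "r = - 2 * L \<and> w a = 0"
    have "- ((w a \<bullet> w a) * exp (r * a)) \<le> - ((w t \<bullet> w t) * exp (r * t))"
    proof (rule right_derivative_nonneg_imp_le[where f = "\<lambda>s. - ((w s \<bullet> w s) * exp (r * s))"])
      show "a \<le> t" using t by simp
      show "continuous_on {a..t} (\<lambda>s. - ((w s \<bullet> w s) * exp (r * s)))"
        using t by (intro continuous_intros continuous_on_subset[OF cont]) auto
      fix s assume "a \<le> s" "s < t"
      then have s: "a \<le> s" "s < b" using t by auto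
      show "((\<lambda>s. - ((w s \<bullet> w s) * exp (r * s))) has_vector_derivative
          - ((2 * (w s \<bullet> w' s) + r * (w s \<bullet> w s)) * exp (r * s))) (at_right s)"
        by (intro has_vector_derivative_minus d s)
      show "0 \<le> - ((2 * (w s \<bullet> w' s) + r * (w s \<bullet> w s)) * exp (r * s))"
        using ip[OF s] r by (simp add: mult_le_0_iff)
    qed
    then show ?thesis using r by simp
  next
    assume r: "r = 2 * L \<and> w b = 0"
    have "(w t \<bullet> w t) * exp (r * t) \<le> (w b \<bullet> w b) * exp (r * b)"
    proof (rule right_derivative_nonneg_imp_le[where f = "\<lambda>s. (w s \<bullet> w s) * exp (r * s)"])
      show "t \<le> b" using t by simp
      show "continuous_on {t..b} (\<lambda>s. (w s \<bullet> w s) * exp (r * s))"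
        using t by (intro continuous_intros continuous_on_subset[OF cont]) auto
      fix s assume "t \<le> s" "s < b"
      then have s: "a \<le> s" "s < b" using t by auto
      show "((\<lambda>s. (w s \<bullet> w s) * exp (r * s)) has_vector_derivative
          (2 * (w s \<bullet> w' s) + r * (w s \<bullet> w s)) * exp (r * s)) (at_right s)"
        by (intro d s)
      show "0 \<le> (2 * (w s \<bullet> w' s) + r * (w s \<bullet> w s)) * exp (r * s)"
        using ip[OF s] r by simp
    qed
    then show ?thesis using r by simp
  qed
  then have "w t \<bullet> w t \<le> 0"
    using zero by (metis exp_gt_zero mult_le_0_iff not_less)
  then show ?thesis by (metis antisym inner_eq_zero_iff inner_ge_zero)
qed

lemma norm_prod_bounds:
  fixes z :: "'a::real_normed_vector \<times> 'b::real_normed_vector"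
  shows "norm (fst z) \<le> norm z" "norm (snd z) \<le> norm z" "norm z \<le> norm (fst z) + norm (snd z)"
  using norm_fst_le[of "fst z" "snd z"] norm_snd_le[of "snd z" "fst z"] norm_Pair_le[of "fst z" "snd z"]
  by simp_all

text \<open>The sum norm is only equivalent to the product norm, so it is a power of \<open>T\<close> that contracts.\<close>

lemma sum_norm_contraction_fixpoint:
  fixes T :: "'a::{real_normed_vector, complete_space} \<times> 'b::{real_normed_vector, complete_space} \<Rightarrow> 'a \<times> 'b"
  assumes "0 \<le> \<rho>" "\<rho> < 1"
    and T: "\<And>p q. norm (fst (T p) - fst (T q)) + norm (snd (T p) - snd (T q))
              \<le> \<rho> * (norm (fst p - fst q) + norm (snd p - snd q))"
  obtains p where "T p = p"
proof -
  define d :: "'a \<times> 'b \<Rightarrow> 'a \<times> 'b \<Rightarrow> real"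
    where "d p q = norm (fst p - fst q) + norm (snd p - snd q)" for p q
  have pow: "d ((T ^^ n) p) ((T ^^ n) q) \<le> \<rho> ^ n * d p q" for n p q
  proof (induction n)
    case (Suc n)
    have "d ((T ^^ Suc n) p) ((T ^^ Suc n) q) \<le> \<rho> * d ((T ^^ n) p) ((T ^^ n) q)"
      using T by (simp add: d_def)
    also have "\<dots> \<le> \<rho> * (\<rho> ^ n * d p q)"
      using Suc \<open>0 \<le> \<rho>\<close> by (rule mult_left_mono)
    finally show ?case by (simp add: mult.assoc)
  qed simp
  have le: "dist p q \<le> d p q" "d p q \<le> 2 * dist p q" for p q
  proof -
    show "dist p q \<le> d p q"
      using norm_prod_bounds(3)[of "p - q"] by (simp add: d_def dist_norm)
    show "d p q \<le> 2 * dist p q"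
      using norm_prod_bounds(1,2)[of "p - q"] by (simp add: d_def dist_norm)
  qed
  \<comment> \<open>\<open>d\<close> is at most twice the product distance, so \<open>T ^^ n\<close>
    contracts once the n-th power of \<rho> is below 1/2. Its fixed point p is one of
    \<open>T\<close>, because \<open>T p\<close> is again fixed by \<open>T ^^ n\<close>.\<close>
  obtain n where n: "\<rho> ^ n < 1 / 2"
    using real_arch_pow_inv[of "1/2" \<rho>] \<open>\<rho> < 1\<close> by auto
  have "\<exists>!p. (T ^^ n) p = p"
  proof (rule banach_fix_type)
    show "0 \<le> \<rho> ^ n * 2" "\<rho> ^ n * 2 < 1" using \<open>0 \<le> \<rho>\<close> n by auto
    show "\<forall>p q. dist ((T ^^ n) p) ((T ^^ n) q) \<le> \<rho> ^ n * 2 * dist p q"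
    proof (intro allI)
      fix p q
      have "dist ((T ^^ n) p) ((T ^^ n) q) \<le> \<rho> ^ n * d p q"
        by (rule order_trans[OF le(1) pow])
      also have "\<dots> \<le> \<rho> ^ n * (2 * dist p q)"
        using \<open>0 \<le> \<rho>\<close> by (intro mult_left_mono le) simp
      finally show "dist ((T ^^ n) p) ((T ^^ n) q) \<le> \<rho> ^ n * 2 * dist p q" by (simp add: mult.assoc)
    qed
  qed
  then obtain p where p: "(T ^^ n) p = p" and unique: "\<And>q. (T ^^ n) q = q \<Longrightarrow> q = p" by blast
  have "(T ^^ n) (T p) = T p"
    using p by (metis comp_apply funpow_swap1)
  then show thesis using unique that by blast
qed

text \<open>Inserting the best bound N of \<open>r\<close> into \<open>step\<close> gives N \<le> d
  + \<rho> N. The a priori bound \<open>N0\<close> makes the supremum finite and leaves no trace in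
  the result; the maximum with 0 meets the sign condition of \<open>step\<close>.\<close>

lemma weighted_sup_absorb:
  fixes r :: "real \<Rightarrow> real"
  assumes "0 \<le> \<rho>" "\<rho> < 1" "0 \<le> d" and bdd: "\<And>t. t \<in> J \<Longrightarrow> r t \<le> N0"
    and step: "\<And>N. 0 \<le> N \<Longrightarrow> (\<And>t. t \<in> J \<Longrightarrow> r t \<le> N) \<Longrightarrow> (\<And>t. t \<in> J \<Longrightarrow> r t \<le> d + \<rho> * N)"
    and "t \<in> J"
  shows "r t \<le> d / (1 - \<rho>)"
proof -
  define N where "N = max 0 (SUP t\<in>J. r t)"
  have "bdd_above (r ` J)" using bdd by (auto simp: bdd_above_def)
  then have N: "r t \<le> N" if "t \<in> J" for t
    using cSUP_upper[OF that] by (fastforce simp: N_def)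
  have "0 \<le> N" by (simp add: N_def)
  have "r t \<le> d + \<rho> * N" if "t \<in> J" for t
    by (rule step[OF \<open>0 \<le> N\<close> N that])
  then have "(SUP t\<in>J. r t) \<le> d + \<rho> * N"
    using \<open>t \<in> J\<close> by (intro cSUP_least) auto
  moreover have "0 \<le> d + \<rho> * N" using assms \<open>0 \<le> N\<close> by simp
  ultimately have "N \<le> d + \<rho> * N" by (simp add: N_def)
  then have "N * (1 - \<rho>) \<le> d" by (simp add: algebra_simps)
  then have "N \<le> d / (1 - \<rho>)" using \<open>\<rho> < 1\<close> by (simp add: pos_le_divide_eq)
  then show ?thesis using N[OF \<open>t \<in> J\<close>] by simp
qed

section \<open>Bounded solutions under an exponential dichotomy\<close>

text \<open>Measured in the sum of the component norms, as in the Lipschitz hypothesis on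
  \<open>g1\<close> and \<open>g2\<close>. Both constants then enter \<rho> unchanged, whereas the
  product norm would cost a factor and spoil the gap condition.\<close>

definition sum_lipschitz ::
    "real \<Rightarrow> (real \<Rightarrow> 'a::real_normed_vector \<times> 'b::real_normed_vector \<Rightarrow> 'c::real_normed_vector) \<Rightarrow> bool" where
  "sum_lipschitz K f \<longleftrightarrow>
     (\<forall>t p q. norm (f t p - f t q) \<le> K * (norm (fst p - fst q) + norm (snd p - snd q)))"

text \<open>The regularity in time that survives the jumps of the noise, tested along
  right-continuous paths because this is how a field enters the integrals.\<close>

definition right_continuous_along ::
    "(real \<Rightarrow> 'a::topological_space \<Rightarrow> 'b::topological_space) \<Rightarrow> bool" where
  "right_continuous_along f \<longleftrightarrow>
     (\<forall>z t. (z \<longlongrightarrow> z t) (at_right t) \<longrightarrow> ((\<lambda>s. f s (z s)) \<longlongrightarrow> f t (z t)) (at_right t))"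

lemma sum_lipschitzD:
  "sum_lipschitz K f \<Longrightarrow> norm (f t p - f t q) \<le> K * (norm (fst p - fst q) + norm (snd p - snd q))"
  unfolding sum_lipschitz_def by blast

lemma right_continuous_alongD:
  "right_continuous_along f \<Longrightarrow> (z \<longlongrightarrow> z t) (at_right t) \<Longrightarrow> ((\<lambda>s. f s (z s)) \<longlongrightarrow> f t (z t)) (at_right t)"
  by (simp add: right_continuous_along_def)

text \<open>The strict inequality assigns time 0 to the right-hand branch, so right limits never see
  the jump caused by the cut.\<close>

lemma right_continuous_along_if:
  fixes f g :: "real \<Rightarrow> 'a::topological_space \<Rightarrow> 'b::topological_space"
  assumes "right_continuous_along f" "right_continuous_along g"
  shows "right_continuous_along (\<lambda>t. if t < 0 then f t else g t)"
  unfolding right_continuous_along_def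
proof (intro allI impI)
  fix z :: "real \<Rightarrow> 'a" and t :: real
  assume z: "(z \<longlongrightarrow> z t) (at_right t)"
  show "((\<lambda>s. (if s < 0 then f s else g s) (z s)) \<longlongrightarrow> (if t < 0 then f t else g t) (z t)) (at_right t)"
  proof (cases "t < 0")
    case True
    have "\<forall>\<^sub>F s in at_right t. f s (z s) = (if s < 0 then f s else g s) (z s)"
      using eventually_at_right_less[of t] eventually_at_right_field[of "\<lambda>s. s < 0" t] True
      by (auto elim: eventually_mono)
    from Lim_transform_eventually[OF right_continuous_alongD[OF assms(1) z] this]
    show ?thesis using True by simp
  next
    case False
    have "\<forall>\<^sub>F s in at_right t. g s (z s) = (if s < 0 then f s else g s) (z s)"
      using eventually_at_right_less[of t] by eventually_elim (use False in auto)
    from Lim_transform_eventually[OF right_continuous_alongD[OF assms(2) z] this]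
    show ?thesis using False by simp
  qed
qed

lemma right_continuous_along_translate:
  fixes f :: "real \<Rightarrow> 'a::real_normed_vector \<Rightarrow> 'b::real_normed_vector"
  assumes "right_continuous_along f"
  shows "right_continuous_along (\<lambda>t z. c + f t (p + z))"
  unfolding right_continuous_along_def
proof (intro allI impI)
  fix z :: "real \<Rightarrow> 'a" and t
  assume "(z \<longlongrightarrow> z t) (at_right t)"
  then have "((\<lambda>s. p + z s) \<longlongrightarrow> p + z t) (at_right t)" by (intro tendsto_intros)
  from right_continuous_alongD[OF assms, of "\<lambda>s. p + z s", OF this]
  show "((\<lambda>s. c + f s (p + z s)) \<longlongrightarrow> c + f t (p + z t)) (at_right t)"
    by (intro tendsto_intros)
qed

definition split_field ::
    "real^'n^'n \<Rightarrow> real^'m^'m \<Rightarrow> (real \<Rightarrow> (real^'n) \<times> (real^'m) \<Rightarrow> real^'n) \<Rightarrow>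
     (real \<Rightarrow> (real^'n) \<times> (real^'m) \<Rightarrow> real^'m) \<Rightarrow> real \<Rightarrow> (real^'n) \<times> (real^'m) \<Rightarrow> (real^'n) \<times> (real^'m)" where
  "split_field A B f1 f2 t z = (A *v fst z + f1 t z, B *v snd z + f2 t z)"

lemma split_field_lipschitz:
  assumes "sum_lipschitz K1 f1" "sum_lipschitz K2 f2" and K: "0 \<le> K1" "0 \<le> K2"
  obtains L where "\<And>t p q. norm (split_field A B f1 f2 t p - split_field A B f1 f2 t q) \<le> L * norm (p - q)"
proof -
  obtain CA where CA: "\<And>x. norm (A *v x) \<le> norm x * CA" "0 < CA"
    using bounded_linear.pos_bounded[OF bounded_linear_matrix_vector_mult, of A] by blast
  obtain CB where CB: "\<And>x. norm (B *v x) \<le> norm x * CB" "0 < CB"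
    using bounded_linear.pos_bounded[OF bounded_linear_matrix_vector_mult, of B] by blast
  have "norm (split_field A B f1 f2 t p - split_field A B f1 f2 t q) \<le> (CA + CB + 2 * (K1 + K2)) * norm (p - q)" for t p q
  proof -
    let ?n = "norm (p - q)"
    have n: "norm (fst p - fst q) \<le> ?n" "norm (snd p - snd q) \<le> ?n"
      using norm_prod_bounds(1,2)[of "p - q"] by simp_all
    have f: "norm (f1 t p - f1 t q) \<le> K1 * (?n + ?n)" "norm (f2 t p - f2 t q) \<le> K2 * (?n + ?n)"
      using n K by (auto intro!: order_trans[OF sum_lipschitzD[OF assms(1)]]
          order_trans[OF sum_lipschitzD[OF assms(2)]] mult_left_mono add_mono)
    have AB: "norm (A *v (fst p - fst q)) \<le> ?n * CA" "norm (B *v (snd p - snd q)) \<le> ?n * CB"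
      using n CA(2) CB(2) by (auto intro!: order_trans[OF CA(1)] order_trans[OF CB(1)] mult_right_mono)
    have "norm (split_field A B f1 f2 t p - split_field A B f1 f2 t q) \<le>
        norm (A *v (fst p - fst q) + (f1 t p - f1 t q)) + norm (B *v (snd p - snd q) + (f2 t p - f2 t q))"
      by (rule order_trans[OF _ norm_Pair_le])
         (simp add: split_field_def matrix_vector_mult_diff_distrib algebra_simps)
    also have "\<dots> \<le> (?n * CA + K1 * (?n + ?n)) + (?n * CB + K2 * (?n + ?n))"
      by (intro add_mono order_trans[OF norm_triangle_ineq] AB f)
    also have "\<dots> = (CA + CB + 2 * (K1 + K2)) * ?n" by (simp add: algebra_simps)
    finally show ?thesis .
  qed
  then show thesis by (rule that)
qed

lemma split_field_solution_unique:
  assumes "sum_lipschitz K1 f1" "sum_lipschitz K2 f2" "0 \<le> K1" "0 \<le> K2"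
    and cont: "continuous_on {a..b} z" "continuous_on {a..b} z'"
    and z: "\<And>t. a \<le> t \<Longrightarrow> t < b \<Longrightarrow> (z has_vector_derivative split_field A B f1 f2 t (z t)) (at_right t)"
    and z': "\<And>t. a \<le> t \<Longrightarrow> t < b \<Longrightarrow> (z' has_vector_derivative split_field A B f1 f2 t (z' t)) (at_right t)"
    and eq: "z a = z' a \<or> z b = z' b" and t: "t \<in> {a..b}"
  shows "z t = z' t"
proof -
  obtain L where L: "\<And>t p q. norm (split_field A B f1 f2 t p - split_field A B f1 f2 t q) \<le> L * norm (p - q)"
    using split_field_lipschitz[OF assms(1-4)] by blast
  have "z t - z' t = 0"
    by (rule right_derivative_gronwall_zero[of a b "\<lambda>t. z t - z' t", OF _ has_vector_derivative_diff[OF z z'] L _ t])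
       (use cont eq in \<open>auto intro: continuous_intros\<close>)
  then show ?thesis by simp
qed

lemma continuous_on_UNIV_if_Icc:
  fixes f :: "real \<Rightarrow> 'a::topological_space"
  assumes "\<And>a b. continuous_on {a..b} f"
  shows "continuous_on UNIV f"
proof -
  have "isCont f t" for t
    using assms[of "t - 1" "t + 1"] by (rule continuous_on_interior) simp
  then show ?thesis by (simp add: continuous_at_imp_continuous_on)
qed

text \<open>The number - \<mu> lies strictly between the rates b of the fast and a of the slow part,
  so after multiplication by exp(\<mu> t) the linear system is hyperbolic. \<open>gap\<close> is the
  contraction condition for the Lyapunov-Perron operator in the sum of the weighted supremum
  norms.\<close>

locale dichotomy =
  fixes A :: "real^'n^'n" and B :: "real^'m^'m" and a b \<mu> K1 K2 :: real
  assumes slow: "t \<le> 0 \<Longrightarrow> norm (mat_exp (t *\<^sub>R A) *v x) \<le> exp (a * t) * norm x"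
    and fast: "0 \<le> t \<Longrightarrow> norm (mat_exp (t *\<^sub>R B) *v y) \<le> exp (b * t) * norm y"
    and slow_rate: "0 < a + \<mu>" and fast_rate: "b + \<mu> < 0"
    and K1_nonneg: "0 \<le> K1" and K2_nonneg: "0 \<le> K2" and mu_nonneg: "0 \<le> \<mu>"
    and gap: "K1 / (a + \<mu>) + K2 / - (b + \<mu>) < 1"
begin

definition \<rho> :: real where "\<rho> = K1 / (a + \<mu>) + K2 / - (b + \<mu>)"

lemma rho: "0 \<le> \<rho>" "\<rho> < 1"
proof -
  have "0 \<le> K2 / - (b + \<mu>)" using fast_rate K2_nonneg by (intro divide_nonneg_nonneg) auto
  moreover have "0 \<le> K1 / (a + \<mu>)" using slow_rate K1_nonneg by simp
  ultimately show "0 \<le> \<rho>" by (simp add: \<rho>_def)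
  show "\<rho> < 1" using gap by (simp only: \<rho>_def)
qed

text \<open>The Lyapunov-Perron operator. No initial data appear: nonzero homogeneous slow solutions
  leave the weighted space towards +\<infinity>, fast ones towards -\<infinity>, and this dictates
  the base points of the two integrals. The bounds on the fields at state 0 let the operator map the
  space into itself.\<close>

lemma bounded_solution_exists:
  assumes H: "sum_lipschitz K1 H1" "sum_lipschitz K2 H2"
    and rc: "right_continuous_along H1" "right_continuous_along H2"
    and M: "\<And>t. norm (H1 t 0) \<le> M * exp (- \<mu> * t)" "\<And>t. norm (H2 t 0) \<le> M * exp (- \<mu> * t)"
  obtains z C where "continuous_on UNIV z"
    "\<And>t. (z has_vector_derivative split_field A B H1 H2 t (z t)) (at_right t)"
    "\<And>t. norm (fst (z t)) \<le> C * exp (- \<mu> * t)" "\<And>t. norm (snd (z t)) \<le> C * exp (- \<mu> * t)"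
proof -
  \<comment> \<open>The factor exp(- \<mu> s) carries pairs of bounded continuous functions, a
    complete space, onto the weighted space; \<open>X\<close> and \<open>Y\<close> below undo
    it.\<close>
  define \<psi> :: "(real \<Rightarrow>\<^sub>C (real^'n)) \<times> (real \<Rightarrow>\<^sub>C (real^'m)) \<Rightarrow> real \<Rightarrow> (real^'n) \<times> (real^'m)"
    where "\<psi> p s = (exp (- \<mu> * s) *\<^sub>R apply_bcontfun (fst p) s, exp (- \<mu> * s) *\<^sub>R apply_bcontfun (snd p) s)" for p s
  define nn where "nn p = norm (fst p) + norm (snd p)" for p :: "(real \<Rightarrow>\<^sub>C (real^'n)) \<times> (real \<Rightarrow>\<^sub>C (real^'m))"
  have psi_cont: "continuous_on UNIV (\<psi> p)" for p
    unfolding \<psi>_def by (intro continuous_intros continuous_on_apply_bcontfun)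
  have psi_rc: "(\<psi> p \<longlongrightarrow> \<psi> p t) (at_right t)" for p t
    using psi_cont[of p] by (simp add: continuous_on_def filterlim_at_split)
  have k_rc: "((\<lambda>s. H1 s (\<psi> p s)) \<longlongrightarrow> H1 t (\<psi> p t)) (at_right t)"
      "((\<lambda>s. H2 s (\<psi> p s)) \<longlongrightarrow> H2 t (\<psi> p t)) (at_right t)" for p t
    using right_continuous_alongD[of _ "\<psi> p"] rc psi_rc by blast+
  have psi_diff: "norm (fst (\<psi> p s) - fst (\<psi> q s)) + norm (snd (\<psi> p s) - snd (\<psi> q s))
      \<le> nn (p - q) * exp (- \<mu> * s)" for p q s
  proof -
    have "norm (fst (\<psi> p s) - fst (\<psi> q s)) = exp (- \<mu> * s) * norm (apply_bcontfun (fst p - fst q) s)"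
      "norm (snd (\<psi> p s) - snd (\<psi> q s)) = exp (- \<mu> * s) * norm (apply_bcontfun (snd p - snd q) s)"
      by (simp_all add: \<psi>_def scaleR_diff_right[symmetric] minus_bcontfun.rep_eq)
    then show ?thesis
      using norm_bounded[of "fst p - fst q" s] norm_bounded[of "snd p - snd q" s]
      by (simp add: nn_def distrib_left[symmetric] mult.commute add_mono)
  qed
  have k_diff: "norm (H1 s (\<psi> p s) - H1 s (\<psi> q s)) \<le> (K1 * nn (p - q)) * exp (- \<mu> * s)"
      "norm (H2 s (\<psi> p s) - H2 s (\<psi> q s)) \<le> (K2 * nn (p - q)) * exp (- \<mu> * s)" for p q s
    using order_trans[OF sum_lipschitzD[OF H(1)] mult_left_mono[OF psi_diff K1_nonneg]]
      order_trans[OF sum_lipschitzD[OF H(2)] mult_left_mono[OF psi_diff K2_nonneg]]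
    by (simp_all only: mult.assoc)
  have psi_0: "\<psi> 0 s = 0" for s by (simp add: \<psi>_def zero_prod_def zero_bcontfun.rep_eq)
  have k_bound: "norm (H1 s (\<psi> p s)) \<le> (M + K1 * nn p) * exp (- \<mu> * s)"
      "norm (H2 s (\<psi> p s)) \<le> (M + K2 * nn p) * exp (- \<mu> * s)" for p s
    using k_diff[of s p 0] M[of s] norm_triangle_sub[of "H1 s (\<psi> p s)" "H1 s 0"]
      norm_triangle_sub[of "H2 s (\<psi> p s)" "H2 s 0"]
    by (simp_all add: psi_0 distrib_right)
  let ?D1 = "\<lambda>p. duhamel A \<infinity> (\<lambda>s. H1 s (\<psi> p s))"
  let ?D2 = "\<lambda>p. duhamel B (-\<infinity>) (\<lambda>s. H2 s (\<psi> p s))"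
  have D1: "duhamel_integrable A \<infinity> (\<lambda>s. H1 s (\<psi> p s))"
    "norm (?D1 p t) \<le> (M + K1 * nn p) / (a + \<mu>) * exp (- \<mu> * t)" for p t
    by (rule duhamel_infinity[where k = "\<lambda>s. H1 s (\<psi> p s)", OF slow slow_rate k_rc(1) k_bound(1)]; simp)+
  have D2: "duhamel_integrable B (-\<infinity>) (\<lambda>s. H2 s (\<psi> p s))"
    "norm (?D2 p t) \<le> (M + K2 * nn p) / - (b + \<mu>) * exp (- \<mu> * t)" for p t
    by (rule duhamel_minus_infinity[where k = "\<lambda>s. H2 s (\<psi> p s)", OF fast fast_rate k_rc(2) k_bound(2)]; simp)+
  define X where "X p t = exp (\<mu> * t) *\<^sub>R ?D1 p t" for p t
  define Y where "Y p t = exp (\<mu> * t) *\<^sub>R ?D2 p t" for p t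
  have ee: "exp (\<mu> * t) * (c * exp (- \<mu> * t)) = c" for t c :: real
    by (simp add: exp_minus)
  have D1_cont: "continuous_on UNIV (?D1 p)" for p
    by (rule continuous_on_UNIV_if_Icc) (rule duhamel_continuous[OF k_rc(1) D1(1)])
  have D2_cont: "continuous_on UNIV (?D2 p)" for p
    by (rule continuous_on_UNIV_if_Icc) (rule duhamel_continuous[OF k_rc(2) D2(1)])
  have XB: "X p \<in> bcontfun" for p
  proof (rule bcontfun_normI)
    show "continuous_on UNIV (X p)" unfolding X_def by (intro continuous_intros D1_cont)
    show "norm (X p t) \<le> (M + K1 * nn p) / (a + \<mu>)" for t
      using mult_left_mono[OF D1(2)[of p t], of "exp (\<mu> * t)"] by (simp only: X_def norm_scaleR abs_exp_cancel ee exp_ge_zero)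
  qed
  have YB: "Y p \<in> bcontfun" for p
  proof (rule bcontfun_normI)
    show "continuous_on UNIV (Y p)" unfolding Y_def by (intro continuous_intros D2_cont)
    show "norm (Y p t) \<le> (M + K2 * nn p) / - (b + \<mu>)" for t
      using mult_left_mono[OF D2(2)[of p t], of "exp (\<mu> * t)"] by (simp only: Y_def norm_scaleR abs_exp_cancel ee exp_ge_zero)
  qed
  have X_diff: "norm (X p t - X q t) \<le> K1 * nn (p - q) / (a + \<mu>)" for p q t
  proof -
    have "norm (?D1 p t - ?D1 q t) \<le> K1 * nn (p - q) / (a + \<mu>) * exp (- \<mu> * t)"
      unfolding duhamel_diff[OF D1(1) D1(1)]
      by (rule duhamel_infinity(2)[OF slow slow_rate]) (assumption, intro tendsto_diff k_rc, rule k_diff)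
    from mult_left_mono[OF this, of "exp (\<mu> * t)"] show ?thesis
      by (simp only: X_def scaleR_diff_right[symmetric] norm_scaleR abs_exp_cancel ee exp_ge_zero)
  qed
  have Y_diff: "norm (Y p t - Y q t) \<le> K2 * nn (p - q) / - (b + \<mu>)" for p q t
  proof -
    have "norm (?D2 p t - ?D2 q t) \<le> K2 * nn (p - q) / - (b + \<mu>) * exp (- \<mu> * t)"
      unfolding duhamel_diff[OF D2(1) D2(1)]
      by (rule duhamel_minus_infinity(2)[OF fast fast_rate]) (assumption, intro tendsto_diff k_rc, rule k_diff)
    from mult_left_mono[OF this, of "exp (\<mu> * t)"] show ?thesis
      by (simp only: Y_def scaleR_diff_right[symmetric] norm_scaleR abs_exp_cancel ee exp_ge_zero)
  qed
  define T where "T p = (Bcontfun (X p), Bcontfun (Y p))" for p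
  have T_apply: "apply_bcontfun (fst (T p)) t = X p t" "apply_bcontfun (snd (T p)) t = Y p t" for p t
    by (simp_all add: T_def Bcontfun_inverse XB YB)
  have "norm (fst (T p) - fst (T q)) + norm (snd (T p) - snd (T q)) \<le> \<rho> * nn (p - q)" for p q
  proof -
    have "norm (fst (T p) - fst (T q)) \<le> K1 * nn (p - q) / (a + \<mu>)"
      by (rule norm_bound) (simp add: minus_bcontfun.rep_eq T_apply X_diff)
    moreover have "norm (snd (T p) - snd (T q)) \<le> K2 * nn (p - q) / - (b + \<mu>)"
      by (rule norm_bound) (simp only: minus_bcontfun.rep_eq T_apply Y_diff)
    moreover have "K1 * nn (p - q) / (a + \<mu>) + K2 * nn (p - q) / - (b + \<mu>) = \<rho> * nn (p - q)"
      by (simp only: \<rho>_def distrib_right times_divide_eq_left)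
    ultimately show ?thesis by linarith
  qed
  then have contr: "norm (fst (T p) - fst (T q)) + norm (snd (T p) - snd (T q))
      \<le> \<rho> * (norm (fst p - fst q) + norm (snd p - snd q))" for p q
    by (simp only: nn_def fst_diff snd_diff)
  obtain p where p: "T p = p"
    by (rule sum_norm_contraction_fixpoint[OF rho contr]) blast
  have eqs: "fst (\<psi> p t) = ?D1 p t" "snd (\<psi> p t) = ?D2 p t" for t
    using T_apply[of p t] by (simp_all add: p \<psi>_def X_def Y_def exp_add[symmetric])
  have pair: "\<psi> p = (\<lambda>t. (?D1 p t, ?D2 p t))"
    by (rule ext) (metis eqs prod.collapse)
  show thesis
  proof (rule that[of "\<psi> p" "nn p"])
    show "continuous_on UNIV (\<psi> p)" by (rule psi_cont)
    have "((\<lambda>t. (?D1 p t, ?D2 p t)) has_vector_derivative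
        (A *v ?D1 p t + H1 t (\<psi> p t), B *v ?D2 p t + H2 t (\<psi> p t))) (at_right t)" for t
      by (intro has_vector_derivative_Pair duhamel_right_derivative[OF k_rc(1) D1(1)]
          duhamel_right_derivative[OF k_rc(2) D2(1)])
    then show "(\<psi> p has_vector_derivative split_field A B H1 H2 t (\<psi> p t)) (at_right t)" for t
      by (simp add: split_field_def eqs pair[symmetric])
    show "norm (fst (\<psi> p t)) \<le> nn p * exp (- \<mu> * t)" "norm (snd (\<psi> p t)) \<le> nn p * exp (- \<mu> * t)" for t
    proof -
      have "norm (fst (\<psi> p t)) + norm (snd (\<psi> p t)) \<le> nn p * exp (- \<mu> * t)"
        using psi_diff[of p t 0] by (simp add: psi_0)
      then show "norm (fst (\<psi> p t)) \<le> nn p * exp (- \<mu> * t)" "norm (snd (\<psi> p t)) \<le> nn p * exp (- \<mu> * t)"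
        using norm_ge_zero[of "fst (\<psi> p t)"] norm_ge_zero[of "snd (\<psi> p t)"] by linarith+
    qed
  qed
qed

text \<open>Glues two problems at time 0. For t < 0 the path \<open>p + z\<close> is to solve the
  system given by \<open>f1\<close> and \<open>f2\<close>, which for a constant \<open>p\<close>
  puts \<open>A *v fst p\<close> and \<open>B *v snd p\<close> into the forcing; for t \<ge> 0 the
  perturbation obeys a field of its own. That field is the deviation from an orbit in the tracking
  argument and 0 in the construction of the graph.\<close>

lemma split_bounded_solution_exists:
  assumes f: "sum_lipschitz K1 f1" "sum_lipschitz K2 f2"
      "right_continuous_along f1" "right_continuous_along f2"
    and M: "\<And>t. t \<le> 0 \<Longrightarrow> norm (f1 t 0) \<le> M * exp (- \<mu> * t)" "\<And>t. t \<le> 0 \<Longrightarrow> norm (f2 t 0) \<le> M * exp (- \<mu> * t)"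
    and G: "sum_lipschitz K1 G1" "sum_lipschitz K2 G2"
      "right_continuous_along G1" "right_continuous_along G2" "\<And>t. G1 t 0 = 0" "\<And>t. G2 t 0 = 0"
  obtains z C where "continuous_on UNIV z"
    "\<And>t. 0 \<le> t \<Longrightarrow> (z has_vector_derivative split_field A B G1 G2 t (z t)) (at_right t)"
    "\<And>t. t < 0 \<Longrightarrow> ((\<lambda>t. p + z t) has_vector_derivative split_field A B f1 f2 t (p + z t)) (at_right t)"
    "\<And>t. norm (fst (z t)) \<le> C * exp (- \<mu> * t)" "\<And>t. norm (snd (z t)) \<le> C * exp (- \<mu> * t)"
proof -
  define H1 where "H1 t = (if t < 0 then \<lambda>z. A *v fst p + f1 t (p + z) else G1 t)" for t
  define H2 where "H2 t = (if t < 0 then \<lambda>z. B *v snd p + f2 t (p + z) else G2 t)" for t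
  have lip: "sum_lipschitz K1 H1" "sum_lipschitz K2 H2"
    unfolding sum_lipschitz_def H1_def H2_def
    using sum_lipschitzD[OF f(1), of _ "p + _" "p + _"] sum_lipschitzD[OF f(2), of _ "p + _" "p + _"]
      sum_lipschitzD[OF G(1)] sum_lipschitzD[OF G(2)] by auto
  have rc: "right_continuous_along H1" "right_continuous_along H2"
    unfolding H1_def[abs_def] H2_def[abs_def]
    by (intro right_continuous_along_if right_continuous_along_translate f G)+
  define M' where "M' = norm (A *v fst p) + norm (B *v snd p) + (K1 + K2) * (norm (fst p) + norm (snd p)) + \<bar>M\<bar>"
  have M': "0 \<le> M'" using K1_nonneg K2_nonneg by (simp add: M'_def)
  have bound: "norm (H1 t 0) \<le> M' * exp (- \<mu> * t)" "norm (H2 t 0) \<le> M' * exp (- \<mu> * t)" for t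
  proof -
    let ?e = "exp (- \<mu> * t)"
    let ?n = "norm (fst p) + norm (snd p)"
    have "norm (H1 t 0) \<le> M' * ?e \<and> norm (H2 t 0) \<le> M' * ?e"
    proof (cases "t < 0")
      case True
      \<comment> \<open>For t < 0 the admissible size is at least 1 and absorbs the constants coming
        from \<open>p\<close>. For t \<ge> 0 it decays, and there the fields \<open>G1\<close> and
        \<open>G2\<close> vanish at state 0.\<close>
      have e: "1 \<le> ?e" using True mu_nonneg by (simp add: mult_nonneg_nonpos)
      have M_abs: "norm (f1 t 0) \<le> \<bar>M\<bar> * ?e" "norm (f2 t 0) \<le> \<bar>M\<bar> * ?e"
        using M[of t] True mult_right_mono[OF abs_ge_self[of M], of ?e]
        by (auto intro: order_trans)
      have le: "u \<le> u * ?e" if "0 \<le> u" for u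
        using mult_left_mono[OF e that] by simp
      have "norm (H1 t 0) \<le> norm (A *v fst p) + (norm (f1 t p - f1 t 0) + norm (f1 t 0))"
        using True norm_triangle_ineq[of "A *v fst p" "f1 t p"] norm_triangle_sub[of "f1 t p" "f1 t 0"]
        by (simp add: H1_def)
      also have "\<dots> \<le> norm (A *v fst p) + (K1 * ?n + \<bar>M\<bar> * ?e)"
        using sum_lipschitzD[OF f(1), of t p 0] M_abs(1) by simp
      also have "\<dots> \<le> (norm (A *v fst p) + K1 * ?n + \<bar>M\<bar>) * ?e"
        using le[of "norm (A *v fst p)"] le[of "K1 * ?n"] K1_nonneg by (simp add: distrib_right)
      also have "\<dots> \<le> M' * ?e"
        using K2_nonneg by (intro mult_right_mono) (simp_all add: M'_def distrib_right)
      finally have 1: "norm (H1 t 0) \<le> M' * ?e" .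
      have "norm (H2 t 0) \<le> norm (B *v snd p) + (norm (f2 t p - f2 t 0) + norm (f2 t 0))"
        using True norm_triangle_ineq[of "B *v snd p" "f2 t p"] norm_triangle_sub[of "f2 t p" "f2 t 0"]
        by (simp add: H2_def)
      also have "\<dots> \<le> norm (B *v snd p) + (K2 * ?n + \<bar>M\<bar> * ?e)"
        using sum_lipschitzD[OF f(2), of t p 0] M_abs(2) by simp
      also have "\<dots> \<le> (norm (B *v snd p) + K2 * ?n + \<bar>M\<bar>) * ?e"
        using le[of "norm (B *v snd p)"] le[of "K2 * ?n"] K2_nonneg by (simp add: distrib_right)
      also have "\<dots> \<le> M' * ?e"
        using K1_nonneg by (intro mult_right_mono) (simp_all add: M'_def distrib_right)
      finally show ?thesis using 1 by simp
    next
      case False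
      then show ?thesis using M' by (simp add: H1_def H2_def G)
    qed
    then show "norm (H1 t 0) \<le> M' * ?e" "norm (H2 t 0) \<le> M' * ?e" by auto
  qed
  obtain z C where z: "continuous_on UNIV z"
    "\<And>t. (z has_vector_derivative split_field A B H1 H2 t (z t)) (at_right t)"
    "\<And>t. norm (fst (z t)) \<le> C * exp (- \<mu> * t)" "\<And>t. norm (snd (z t)) \<le> C * exp (- \<mu> * t)"
    by (rule bounded_solution_exists[OF lip rc bound]) blast
  show thesis
  proof (rule that[of z C])
    show "(z has_vector_derivative split_field A B G1 G2 t (z t)) (at_right t)" if "0 \<le> t" for t
      using z(2)[of t] that by (simp add: split_field_def H1_def H2_def)
    show "((\<lambda>t. p + z t) has_vector_derivative split_field A B f1 f2 t (p + z t)) (at_right t)" if "t < 0" for t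
    proof -
      have "((\<lambda>t. p + z t) has_vector_derivative 0 + split_field A B H1 H2 t (z t)) (at_right t)"
        by (intro has_vector_derivative_add has_vector_derivative_const z)
      then show ?thesis
        using that by (simp add: split_field_def H1_def H2_def matrix_vector_right_distrib algebra_simps)
    qed
  qed (fact z)+
qed

section \<open>Solutions on half-lines: vanishing boundary terms, uniqueness and decay\<close>

lemma vanishing_at_plus_infinity:
  assumes "\<And>t. s \<le> t \<Longrightarrow> r \<le> exp (a * (s - t)) * (C * exp (- \<mu> * t)) + c"
  shows "r \<le> c"
proof -
  \<comment> \<open>Transport back from t to s combined with the weighted bound at t is a single
    exponential of rate - (a + \<mu>) in t, which vanishes as t tends to +\<infinity>.\<close>
  have "((\<lambda>t. C * exp (a * s) * exp (- (a + \<mu>) * t) + c) \<longlongrightarrow> C * exp (a * s) * 0 + c) at_top"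
  proof (intro tendsto_intros)
    show "((\<lambda>t. exp (- (a + \<mu>) * t)) \<longlongrightarrow> 0) at_top"
      using slow_rate by real_asymp
  qed
  moreover have "\<forall>\<^sub>F t in at_top. r \<le> C * exp (a * s) * exp (- (a + \<mu>) * t) + c"
    using eventually_ge_at_top[of s]
  proof eventually_elim
    case (elim t)
    have eq: "exp (a * (s - t)) * (C * exp (- \<mu> * t)) = C * exp (a * s) * exp (- (a + \<mu>) * t)"
      by (simp add: exp_add[symmetric] algebra_simps)
    show ?case using assms[OF elim] unfolding eq .
  qed
  ultimately have "r \<le> C * exp (a * s) * 0 + c"
    by (rule tendsto_lowerbound) simp
  then show ?thesis by simp
qed

lemma vanishing_at_minus_infinity:
  assumes "\<And>t. t \<le> s \<Longrightarrow> r \<le> exp (b * (s - t)) * (C * exp (- \<mu> * t)) + c"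
  shows "r \<le> c"
proof -
  have "((\<lambda>t. C * exp (b * s) * exp (- (b + \<mu>) * t) + c) \<longlongrightarrow> C * exp (b * s) * 0 + c) at_bot"
  proof (intro tendsto_intros)
    show "((\<lambda>t. exp (- (b + \<mu>) * t)) \<longlongrightarrow> 0) at_bot"
      using fast_rate by real_asymp
  qed
  moreover have "\<forall>\<^sub>F t in at_bot. r \<le> C * exp (b * s) * exp (- (b + \<mu>) * t) + c"
    using eventually_le_at_bot[of s]
  proof eventually_elim
    case (elim t)
    have eq: "exp (b * (s - t)) * (C * exp (- \<mu> * t)) = C * exp (b * s) * exp (- (b + \<mu>) * t)"
      by (simp add: exp_add[symmetric] algebra_simps)
    show ?case using assms[OF elim] unfolding eq .
  qed
  ultimately have "r \<le> C * exp (b * s) * 0 + c"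
    by (rule tendsto_lowerbound) simp
  then show ?thesis by simp
qed

text \<open>The boundary terms of the difference vanish for different reasons: the slow one because
  the slow components agree at time 0, the fast one by sending its end to -\<infinity> inside the
  weighted space. Absorption then runs with d = 0.\<close>

lemma backward_bounded_unique:
  assumes f: "sum_lipschitz K1 f1" "sum_lipschitz K2 f2"
    and cont: "continuous_on {..0} z" "continuous_on {..0} z'"
    and z: "\<And>t. t < 0 \<Longrightarrow> (z has_vector_derivative split_field A B f1 f2 t (z t)) (at_right t)"
    and z': "\<And>t. t < 0 \<Longrightarrow> (z' has_vector_derivative split_field A B f1 f2 t (z' t)) (at_right t)"
    and bdd: "\<And>t. t \<le> 0 \<Longrightarrow> norm (fst (z t)) \<le> C * exp (- \<mu> * t)" "\<And>t. t \<le> 0 \<Longrightarrow> norm (snd (z t)) \<le> C * exp (- \<mu> * t)"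
    and bdd': "\<And>t. t \<le> 0 \<Longrightarrow> norm (fst (z' t)) \<le> C' * exp (- \<mu> * t)" "\<And>t. t \<le> 0 \<Longrightarrow> norm (snd (z' t)) \<le> C' * exp (- \<mu> * t)"
    and eq: "fst (z 0) = fst (z' 0)" and "t \<le> 0"
  shows "z t = z' t"
proof -
  define u where "u t = fst (z t) - fst (z' t)" for t
  define v where "v t = snd (z t) - snd (z' t)" for t
  define r where "r t = exp (\<mu> * t) * (norm (u t) + norm (v t))" for t
  define k1 where "k1 t = f1 t (z t) - f1 t (z' t)" for t
  define k2 where "k2 t = f2 t (z t) - f2 t (z' t)" for t
  have uv: "norm (u t) + norm (v t) = r t * exp (- \<mu> * t)" for t
    by (simp add: r_def exp_minus)
  have cont_u: "continuous_on {..0} u" and cont_v: "continuous_on {..0} v"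
    unfolding u_def v_def by (intro continuous_intros cont)+
  have du: "(u has_vector_derivative A *v u t + k1 t) (at_right t)" if "t < 0" for t
    using has_vector_derivative_diff[OF bounded_linear.has_vector_derivative[OF bounded_linear_fst z[OF that]]
        bounded_linear.has_vector_derivative[OF bounded_linear_fst z'[OF that]]]
    by (simp add: u_def[abs_def] k1_def split_field_def matrix_vector_mult_diff_distrib algebra_simps)
  have dv: "(v has_vector_derivative B *v v t + k2 t) (at_right t)" if "t < 0" for t
    using has_vector_derivative_diff[OF bounded_linear.has_vector_derivative[OF bounded_linear_snd z[OF that]]
        bounded_linear.has_vector_derivative[OF bounded_linear_snd z'[OF that]]]
    by (simp add: v_def[abs_def] k2_def split_field_def matrix_vector_mult_diff_distrib algebra_simps)
  have r_bdd: "r t \<le> 2 * (C + C')" if "t \<in> {..0}" for t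
  proof -
    have "norm (u t) + norm (v t) \<le> (2 * (C + C')) * exp (- \<mu> * t)"
      using bdd[of t] bdd'[of t] that norm_triangle_ineq4[of "fst (z t)" "fst (z' t)"]
        norm_triangle_ineq4[of "snd (z t)" "snd (z' t)"] by (simp add: u_def v_def algebra_simps)
    then show ?thesis by (simp add: uv)
  qed
  have step: "r t \<le> 0 + \<rho> * N" if "0 \<le> N" and rN: "\<And>t. t \<in> {..0} \<Longrightarrow> r t \<le> N" and "t \<in> {..0}" for N t
  proof -
    have k1: "norm (k1 s) \<le> (K1 * N) * exp (- \<mu> * s)" and k2: "norm (k2 s) \<le> (K2 * N) * exp (- \<mu> * s)"
      if "s \<le> 0" for s
    proof -
      have "norm (u s) + norm (v s) \<le> N * exp (- \<mu> * s)"
        using rN[of s] that by (simp add: uv)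
      then show "norm (k1 s) \<le> (K1 * N) * exp (- \<mu> * s)" "norm (k2 s) \<le> (K2 * N) * exp (- \<mu> * s)"
        using order_trans[OF sum_lipschitzD[OF f(1)] mult_left_mono[OF _ K1_nonneg]]
          order_trans[OF sum_lipschitzD[OF f(2)] mult_left_mono[OF _ K2_nonneg]]
        unfolding k1_def k2_def u_def v_def mult.assoc by blast+
    qed
    have "norm (u t) \<le> exp (a * (t - 0)) * norm (u 0) + K1 * N / (a + \<mu>) * exp (- \<mu> * t)"
      using \<open>t \<in> {..0}\<close> \<open>0 \<le> N\<close> K1_nonneg
      by (intro backward_estimate[where k = k1, OF slow slow_rate] continuous_on_subset[OF cont_u] du k1) auto
    then have u: "norm (u t) \<le> K1 * N / (a + \<mu>) * exp (- \<mu> * t)"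
      using eq by (simp add: u_def)
    have v: "norm (v t) \<le> K2 * N / - (b + \<mu>) * exp (- \<mu> * t)"
    proof (rule vanishing_at_minus_infinity)
      fix s assume "s \<le> t"
      have "norm (v t) \<le> exp (b * (t - s)) * norm (v s) + K2 * N / - (b + \<mu>) * exp (- \<mu> * t)"
        using \<open>s \<le> t\<close> \<open>t \<in> {..0}\<close> \<open>0 \<le> N\<close> K2_nonneg
        by (intro forward_estimate[where k = k2, OF fast fast_rate] continuous_on_subset[OF cont_v] dv k2) auto
      moreover have "norm (v s) \<le> N * exp (- \<mu> * s)"
      proof -
        have "norm (u s) + norm (v s) \<le> N * exp (- \<mu> * s)"
          using rN[of s] \<open>s \<le> t\<close> \<open>t \<in> {..0}\<close> by (simp add: uv)
        then show ?thesis using norm_ge_zero[of "u s"] by linarith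
      qed
      ultimately show "norm (v t) \<le> exp (b * (t - s)) * (N * exp (- \<mu> * s)) + K2 * N / - (b + \<mu>) * exp (- \<mu> * t)"
        by (elim order_trans) (intro add_right_mono mult_left_mono exp_ge_zero)
    qed
    have "r t * exp (- \<mu> * t) \<le> (\<rho> * N) * exp (- \<mu> * t)"
    proof -
      have "(\<rho> * N) * exp (- \<mu> * t) = K1 * N / (a + \<mu>) * exp (- \<mu> * t) + K2 * N / - (b + \<mu>) * exp (- \<mu> * t)"
        by (simp only: \<rho>_def distrib_right times_divide_eq_left)
      then show ?thesis using u v uv[of t] by linarith
    qed
    then show ?thesis by simp
  qed
  have "r t \<le> 0 / (1 - \<rho>)"
    by (rule weighted_sup_absorb[OF rho _ r_bdd step, of "{..0}"]) (use \<open>t \<le> 0\<close> in auto)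
  then have "norm (u t) + norm (v t) \<le> 0"
    unfolding uv by (simp add: mult_le_0_iff)
  then have "u t = 0" "v t = 0"
    using norm_ge_zero[of "u t"] norm_ge_zero[of "v t"] by (smt (verit) norm_le_zero_iff)+
  then show ?thesis by (simp add: u_def v_def prod_eq_iff)
qed

text \<open>The slow boundary term is sent to +\<infinity>. The data left over are the fast
  component at time 0, which becomes d in the absorption; the a priori constant \<open>C\<close>
  drops out.\<close>

lemma forward_bounded_decay:
  assumes G: "sum_lipschitz K1 G1" "sum_lipschitz K2 G2" "\<And>t. G1 t 0 = 0" "\<And>t. G2 t 0 = 0"
    and cont: "continuous_on {0..} z"
    and z: "\<And>t. 0 \<le> t \<Longrightarrow> (z has_vector_derivative split_field A B G1 G2 t (z t)) (at_right t)"
    and bdd: "\<And>t. 0 \<le> t \<Longrightarrow> norm (fst (z t)) \<le> C * exp (- \<mu> * t)" "\<And>t. 0 \<le> t \<Longrightarrow> norm (snd (z t)) \<le> C * exp (- \<mu> * t)"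
    and "0 \<le> t"
  shows "norm (fst (z t)) + norm (snd (z t)) \<le> norm (snd (z 0)) / (1 - \<rho>) * exp (- \<mu> * t)"
proof -
  define u where "u t = fst (z t)" for t
  define v where "v t = snd (z t)" for t
  define r where "r t = exp (\<mu> * t) * (norm (u t) + norm (v t))" for t
  define k1 where "k1 t = G1 t (z t)" for t
  define k2 where "k2 t = G2 t (z t)" for t
  have uv: "norm (u t) + norm (v t) = r t * exp (- \<mu> * t)" for t
    by (simp add: r_def exp_minus)
  have cont_u: "continuous_on {0..} u" and cont_v: "continuous_on {0..} v"
    unfolding u_def v_def by (intro continuous_intros cont)+
  have du: "(u has_vector_derivative A *v u t + k1 t) (at_right t)" if "0 \<le> t" for t
    using bounded_linear.has_vector_derivative[OF bounded_linear_fst z[OF that]]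
    by (simp add: u_def[abs_def] k1_def split_field_def)
  have dv: "(v has_vector_derivative B *v v t + k2 t) (at_right t)" if "0 \<le> t" for t
    using bounded_linear.has_vector_derivative[OF bounded_linear_snd z[OF that]]
    by (simp add: v_def[abs_def] k2_def split_field_def)
  have r_bdd: "r t \<le> 2 * C" if "t \<in> {0..}" for t
  proof -
    have "norm (u t) + norm (v t) \<le> (2 * C) * exp (- \<mu> * t)"
      using bdd[of t] that by (simp add: u_def v_def)
    then show ?thesis by (simp add: uv)
  qed
  have step: "r t \<le> norm (v 0) + \<rho> * N" if "0 \<le> N" and rN: "\<And>t. t \<in> {0..} \<Longrightarrow> r t \<le> N" and "t \<in> {0..}" for N t
  proof -
    have le: "norm (u s) + norm (v s) \<le> N * exp (- \<mu> * s)" if "0 \<le> s" for s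
      using rN[of s] that by (simp add: uv)
    have k1: "norm (k1 s) \<le> (K1 * N) * exp (- \<mu> * s)" and k2: "norm (k2 s) \<le> (K2 * N) * exp (- \<mu> * s)"
      if "0 \<le> s" for s
      using order_trans[OF sum_lipschitzD[OF G(1), of s "z s" 0] mult_left_mono[OF _ K1_nonneg]]
        order_trans[OF sum_lipschitzD[OF G(2), of s "z s" 0] mult_left_mono[OF _ K2_nonneg]] le[OF that]
      by (simp_all add: k1_def k2_def u_def v_def mult.assoc G)
    have u: "norm (u t) \<le> K1 * N / (a + \<mu>) * exp (- \<mu> * t)"
    proof (rule vanishing_at_plus_infinity)
      fix s assume "t \<le> s"
      have "norm (u t) \<le> exp (a * (t - s)) * norm (u s) + K1 * N / (a + \<mu>) * exp (- \<mu> * t)"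
        using \<open>t \<le> s\<close> \<open>t \<in> {0..}\<close> \<open>0 \<le> N\<close> K1_nonneg
        by (intro backward_estimate[where k = k1, OF slow slow_rate] continuous_on_subset[OF cont_u] du k1) auto
      moreover have "norm (u s) \<le> N * exp (- \<mu> * s)"
      proof -
        have "norm (u s) + norm (v s) \<le> N * exp (- \<mu> * s)"
          using le[of s] \<open>t \<le> s\<close> \<open>t \<in> {0..}\<close> by simp
        then show ?thesis using norm_ge_zero[of "v s"] by linarith
      qed
      ultimately show "norm (u t) \<le> exp (a * (t - s)) * (N * exp (- \<mu> * s)) + K1 * N / (a + \<mu>) * exp (- \<mu> * t)"
        by (elim order_trans) (intro add_right_mono mult_left_mono exp_ge_zero)
    qed
    have "norm (v t) \<le> exp (b * (t - 0)) * norm (v 0) + K2 * N / - (b + \<mu>) * exp (- \<mu> * t)"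
      using \<open>t \<in> {0..}\<close> \<open>0 \<le> N\<close> K2_nonneg
      by (intro forward_estimate[where k = k2, OF fast fast_rate] continuous_on_subset[OF cont_v] dv k2) auto
    \<comment> \<open>The fast semigroup decays at rate b < - \<mu>, hence at least as fast as the
      target bound.\<close>
    moreover have "exp (b * (t - 0)) * norm (v 0) \<le> norm (v 0) * exp (- \<mu> * t)"
    proof -
      have "b * t \<le> - \<mu> * t" using fast_rate \<open>t \<in> {0..}\<close> by (intro mult_right_mono) auto
      then show ?thesis by (simp add: mult.commute[of "norm (v 0)"] mult_right_mono)
    qed
    moreover have "(norm (v 0) + \<rho> * N) * exp (- \<mu> * t) = norm (v 0) * exp (- \<mu> * t) +
        (K1 * N / (a + \<mu>) * exp (- \<mu> * t) + K2 * N / - (b + \<mu>) * exp (- \<mu> * t))"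
      by (simp only: \<rho>_def distrib_right times_divide_eq_left)
    ultimately have "r t * exp (- \<mu> * t) \<le> (norm (v 0) + \<rho> * N) * exp (- \<mu> * t)"
      using u uv[of t] by linarith
    then show ?thesis by simp
  qed
  have "r t \<le> norm (v 0) / (1 - \<rho>)"
    by (rule weighted_sup_absorb[OF rho _ r_bdd step, of "{0..}"]) (use \<open>0 \<le> t\<close> in auto)
  then have "norm (u t) + norm (v t) \<le> norm (v 0) / (1 - \<rho>) * exp (- \<mu> * t)"
    unfolding uv by (intro mult_right_mono) auto
  then show ?thesis by (simp add: u_def v_def)
qed

end

section \<open>The slow-fast system\<close>

lemma has_vector_derivative_at_right_shift:
  assumes "(f has_vector_derivative f') (at_right (t + s))"
  shows "((\<lambda>t. f (t + s)) has_vector_derivative f') (at_right t)"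
proof -
  have "((\<lambda>t. t + s) has_vector_derivative 1) (at_right t)"
    by (auto intro!: derivative_eq_intros)
  moreover have "(\<lambda>t. t + s) ` {t<..} = {t + s<..}"
  proof (intro equalityI subsetI)
    fix x assume "x \<in> {t + s<..}"
    then have "x = (x - s) + s" "x - s \<in> {t<..}" by auto
    then show "x \<in> (\<lambda>t. t + s) ` {t<..}" by (rule image_eqI)
  qed auto
  ultimately show ?thesis
    using vector_diff_chain_within[of "\<lambda>t. t + s" 1 t "{t<..}" f f'] assms by (simp add: o_def)
qed

lemma interval_lebesgue_integral_scaleR:
  "interval_lebesgue_integral M a b (\<lambda>s. c *\<^sub>R f s) = c *\<^sub>R interval_lebesgue_integral M a b f"
  by (simp add: interval_lebesgue_integral_def)

text \<open>On a compact interval a cadlag path is bounded; outside, sublinear growth gives norm (w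
  t) \<le> |t|, and |t| \<le> exp(\<mu> |t|) / \<mu>. This places the noise on the past into the
  weighted space.\<close>

lemma sublinear_cadlag_exponential_bound:
  fixes w :: "real \<Rightarrow> 'a::real_normed_vector"
  assumes "cadlag w" and lim: "((\<lambda>t. norm (w t) / \<bar>t\<bar>) \<longlongrightarrow> 0) at_infinity" and "0 < \<mu>"
  obtains M where "\<And>t. t \<le> 0 \<Longrightarrow> norm (w t) \<le> M * exp (- \<mu> * t)"
proof -
  have "\<forall>\<^sub>F t in at_infinity. norm (w t) / \<bar>t\<bar> < 1"
    using lim by (rule order_tendstoD) simp
  then obtain R where R: "\<And>t. R \<le> norm t \<Longrightarrow> norm (w t) / \<bar>t\<bar> < 1"
    unfolding eventually_at_infinity by blast
  define R' where "R' = max R 1"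
  obtain N where N: "\<And>t. t \<in> {-R'..0} \<Longrightarrow> norm (w t) \<le> N"
    using cadlag_bounded_on_Icc[OF \<open>cadlag w\<close>, of "-R'" 0] unfolding bounded_iff by blast
  have "norm (w t) \<le> (\<bar>N\<bar> + 1 / \<mu>) * exp (- \<mu> * t)" if "t \<le> 0" for t
  proof -
    have e: "1 \<le> exp (- \<mu> * t)" "- \<mu> * t \<le> exp (- \<mu> * t)"
      using that \<open>0 < \<mu>\<close> exp_ge_add_one_self[of "- \<mu> * t"] by (auto simp: mult_nonneg_nonpos)
    have "norm (w t) \<le> \<bar>N\<bar> * exp (- \<mu> * t) \<or> norm (w t) \<le> 1 / \<mu> * exp (- \<mu> * t)"
    proof (cases "- R' \<le> t")
      case True
      then have "norm (w t) \<le> \<bar>N\<bar> * 1" using N[of t] that by auto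
      also have "\<dots> \<le> \<bar>N\<bar> * exp (- \<mu> * t)" by (intro mult_left_mono e) simp
      finally show ?thesis ..
    next
      case False
      then have "R \<le> norm t" "0 < \<bar>t\<bar>" by (auto simp: R'_def)
      then have "norm (w t) \<le> - t"
        using R[of t] that by (simp add: divide_simps split: if_splits)
      also have "\<dots> = 1 / \<mu> * (- \<mu> * t)" using \<open>0 < \<mu>\<close> by simp
      also have "\<dots> \<le> 1 / \<mu> * exp (- \<mu> * t)"
        using \<open>0 < \<mu>\<close> by (intro mult_left_mono e) simp
      finally show ?thesis ..
    qed
    moreover have "0 \<le> \<bar>N\<bar> * exp (- \<mu> * t)" "0 \<le> 1 / \<mu> * exp (- \<mu> * t)" using \<open>0 < \<mu>\<close> by auto
    ultimately show ?thesis unfolding distrib_right by linarith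
  qed
  then show thesis by (rule that)
qed

text \<open>The dichotomy estimates use one constant for both components, whereas
  \<open>C_minus\<close> has two separate weighted suprema.\<close>

lemma C_minus_iff:
  "z \<in> C_minus (- \<mu>) \<longleftrightarrow> z \<in> extensional {..0} \<and> continuous_on {..0} z \<and>
     (\<exists>C. \<forall>t\<le>0. norm (fst (z t)) \<le> C * exp (- \<mu> * t) \<and> norm (snd (z t)) \<le> C * exp (- \<mu> * t))"
proof -
  have "exp (\<mu> * t) * r \<le> C \<longleftrightarrow> r \<le> C * exp (- \<mu> * t)" for t r C :: real
    by (simp add: exp_minus divide_simps mult.commute)
  then have "(bdd_above ((\<lambda>t. norm (exp (- (- \<mu>) * t) *\<^sub>R fst (z t))) ` {..0}) \<and>
      bdd_above ((\<lambda>t. norm (exp (- (- \<mu>) * t) *\<^sub>R snd (z t))) ` {..0})) \<longleftrightarrow>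
      (\<exists>C. \<forall>t\<le>0. norm (fst (z t)) \<le> C * exp (- \<mu> * t)) \<and> (\<exists>C. \<forall>t\<le>0. norm (snd (z t)) \<le> C * exp (- \<mu> * t))"
    by (auto simp: bdd_above_def)
  also have "\<dots> \<longleftrightarrow> (\<exists>C. \<forall>t\<le>0. norm (fst (z t)) \<le> C * exp (- \<mu> * t) \<and> norm (snd (z t)) \<le> C * exp (- \<mu> * t))"
  proof
    assume "(\<exists>C. \<forall>t\<le>0. norm (fst (z t)) \<le> C * exp (- \<mu> * t)) \<and> (\<exists>C. \<forall>t\<le>0. norm (snd (z t)) \<le> C * exp (- \<mu> * t))"
    then obtain C D where "\<forall>t\<le>0. norm (fst (z t)) \<le> C * exp (- \<mu> * t)" "\<forall>t\<le>0. norm (snd (z t)) \<le> D * exp (- \<mu> * t)"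
      by blast
    moreover have "C * exp (- \<mu> * t) \<le> max C D * exp (- \<mu> * t)" "D * exp (- \<mu> * t) \<le> max C D * exp (- \<mu> * t)" for t
      by (auto intro!: mult_right_mono)
    ultimately show "\<exists>C. \<forall>t\<le>0. norm (fst (z t)) \<le> C * exp (- \<mu> * t) \<and> norm (snd (z t)) \<le> C * exp (- \<mu> * t)"
      by (meson order_trans)
  qed blast
  finally show ?thesis by (auto simp: C_minus_def)
qed

text \<open>From here on the argument is pathwise with \<epsilon> and \<Omega> fixed. The second
  condition in \<open>eps\<close> is the contraction condition to which the theorem reduces the
  smallness of \<epsilon>.\<close>

locale slow_fast =
  fixes S :: "real^'n1^'n1" and F :: "real^'n2^'n2"
    and g1 :: "(real^'n1) \<times> (real^'n2) \<Rightarrow> real^'n1"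
    and g2 :: "(real^'n1) \<times> (real^'n2) \<Rightarrow> real^'n2"
    and \<sigma> \<alpha> \<gamma>s \<gamma>f K \<gamma> \<epsilon> :: real and \<Omega> :: "(real \<Rightarrow> real^'n2) set"
  assumes zero_g: "g1 (0, 0) = 0" "g2 (0, 0) = 0"
    and gamma_s: "\<gamma>s > 0"
    and A1_slow: "t \<le> 0 \<Longrightarrow> norm (mat_exp (t *\<^sub>R S) *v x) \<le> exp (\<gamma>s * t) * norm x"
    and A1_fast: "t \<ge> 0 \<Longrightarrow> norm (mat_exp (t *\<^sub>R F) *v y) \<le> exp (\<gamma>f * t) * norm y"
    and K_pos: "K > 0"
    and A2_slow: "norm (g1 (x1, y1) - g1 (x2, y2)) \<le> K * (norm (x1 - x2) + norm (y1 - y2))"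
    and A2_fast: "norm (g2 (x1, y1) - g2 (x2, y2)) \<le> K * (norm (x1 - x2) + norm (y1 - y2))"
    and gamma: "\<gamma> > 0" "\<gamma> + \<gamma>f < 0"
    and eps: "\<epsilon> > 0" "K / (\<gamma>s + \<gamma> / \<epsilon>) + K / - (\<gamma> + \<gamma>f) < 1"
    and shift: "\<omega> \<in> \<Omega> \<Longrightarrow> path_shift t \<omega> \<in> \<Omega>"
    and eta_ok: "\<omega> \<in> \<Omega> \<Longrightarrow> eta_path_ok F \<alpha> \<epsilon> \<omega>"
    and solvable: "\<omega> \<in> \<Omega> \<Longrightarrow> \<exists>z. slow_fast_solution S F g1 g2 \<sigma> \<alpha> \<epsilon> \<omega> z0 z"
begin

abbreviation "\<mu> \<equiv> \<gamma> / \<epsilon>"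
abbreviation "B \<equiv> (1 / \<epsilon>) *\<^sub>R F"

definition f1 where "f1 \<omega> t z = g1 (fst z, snd z + \<sigma> *\<^sub>R eta F \<alpha> \<epsilon> (path_shift t \<omega>))"
definition f2 where "f2 \<omega> t z = (1 / \<epsilon>) *\<^sub>R g2 (fst z, snd z + \<sigma> *\<^sub>R eta F \<alpha> \<epsilon> (path_shift t \<omega>))"

abbreviation "\<phi> \<omega> z0 t \<equiv> phi_hat S F g1 g2 \<sigma> \<alpha> \<epsilon> t \<omega> z0"
abbreviation "\<M> \<equiv> slow_manifold S F g1 g2 \<sigma> \<alpha> \<gamma> \<epsilon>"

lemma mu_pos: "0 < \<mu>"
  using gamma eps by simp

text \<open>Rate, weight exponent and Lipschitz constant of the fast equation all scale with 1 /
  \<epsilon>, so \<epsilon> cancels from the fast share of \<open>gap\<close>; the slow share alone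
  retains it.\<close>

sublocale dichotomy S B \<gamma>s "\<gamma>f / \<epsilon>" \<mu> K "K / \<epsilon>"
proof
  show "norm (mat_exp (t *\<^sub>R B) *v y) \<le> exp (\<gamma>f / \<epsilon> * t) * norm y" if "0 \<le> t" for t y
    using A1_fast[of "t / \<epsilon>" y] that eps by simp
  show "0 < \<gamma>s + \<mu>" using gamma_s mu_pos by simp
  show "\<gamma>f / \<epsilon> + \<mu> < 0" using gamma eps by (simp add: add_divide_distrib[symmetric] divide_neg_pos)
  have "K / \<epsilon> / - (\<gamma>f / \<epsilon> + \<mu>) = K / - (\<gamma> + \<gamma>f)"
  proof -
    have "- (\<gamma>f / \<epsilon> + \<mu>) = - (\<gamma> + \<gamma>f) / \<epsilon>"
      by (simp add: add_divide_distrib diff_divide_distrib)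
    then show ?thesis using eps by (simp only:) simp
  qed
  then show "K / (\<gamma>s + \<mu>) + K / \<epsilon> / - (\<gamma>f / \<epsilon> + \<mu>) < 1" using eps(2) by (simp only:)
qed (use K_pos eps mu_pos A1_slow in auto)

lemma one_le_weight:
  assumes "t \<le> 0"
  shows "1 \<le> exp (- \<mu> * t)"
  using mult_nonneg_nonneg[of \<mu> "- t"] mu_pos assms by simp

lemma slow_fast_field_eq:
  "slow_fast_field S F g1 g2 \<sigma> \<alpha> \<epsilon> \<omega> t z = split_field S B (f1 \<omega>) (f2 \<omega>) t z"
  by (simp add: slow_fast_field_def split_field_def f1_def f2_def split_beta scaleR_matrix_vector_assoc)

lemma f_lipschitz: "sum_lipschitz K (f1 \<omega>)" "sum_lipschitz (K / \<epsilon>) (f2 \<omega>)"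
proof -
  show "sum_lipschitz K (f1 \<omega>)"
    unfolding sum_lipschitz_def f1_def using A2_slow by (metis add_diff_cancel_right)
  have "norm (f2 \<omega> t p - f2 \<omega> t q) \<le> K / \<epsilon> * (norm (fst p - fst q) + norm (snd p - snd q))" for t p q
    using A2_fast[of "fst p" "snd p + \<sigma> *\<^sub>R eta F \<alpha> \<epsilon> (path_shift t \<omega>)" "fst q" "snd q + \<sigma> *\<^sub>R eta F \<alpha> \<epsilon> (path_shift t \<omega>)"] eps
    by (simp add: f2_def scaleR_diff_right[symmetric] divide_right_mono)
  then show "sum_lipschitz (K / \<epsilon>) (f2 \<omega>)" by (simp add: sum_lipschitz_def)
qed

lemma g_tendsto:
  assumes "(p \<longlongrightarrow> l) X"
  shows "((\<lambda>s. g1 (p s)) \<longlongrightarrow> g1 l) X" "((\<lambda>s. g2 (p s)) \<longlongrightarrow> g2 l) X"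
proof -
  have "((\<lambda>s. K * (norm (fst (p s) - fst l) + norm (snd (p s) - snd l))) \<longlongrightarrow>
      K * (norm (fst l - fst l) + norm (snd l - snd l))) X"
    by (intro tendsto_intros assms)
  then have lim: "((\<lambda>s. K * (norm (fst (p s) - fst l) + norm (snd (p s) - snd l))) \<longlongrightarrow> 0) X" by simp
  show "((\<lambda>s. g1 (p s)) \<longlongrightarrow> g1 l) X"
    by (rule LIM_zero_cancel, rule Lim_null_comparison[OF always_eventually lim])
       (metis A2_slow prod.collapse)
  show "((\<lambda>s. g2 (p s)) \<longlongrightarrow> g2 l) X"
    by (rule LIM_zero_cancel, rule Lim_null_comparison[OF always_eventually lim])
       (metis A2_fast prod.collapse)
qed

lemma f_right_continuous:
  assumes "\<omega> \<in> \<Omega>"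
  shows "right_continuous_along (f1 \<omega>)" "right_continuous_along (f2 \<omega>)"
proof -
  have eta: "((\<lambda>t. eta F \<alpha> \<epsilon> (path_shift t \<omega>)) \<longlongrightarrow> eta F \<alpha> \<epsilon> (path_shift t \<omega>)) (at_right t)" for t
    using eta_ok[OF assms] by (simp add: eta_path_ok_def cadlag_def)
  show "right_continuous_along (f1 \<omega>)" "right_continuous_along (f2 \<omega>)"
    unfolding right_continuous_along_def f1_def f2_def
    by (auto intro!: tendsto_intros g_tendsto eta)
qed

text \<open>As \<open>g1\<close> and \<open>g2\<close> vanish at the origin, their Lipschitz bounds
  control the fields at state 0 by the noise alone, whose sublinear growth is dominated by the
  weight because \<mu> > 0.\<close>

lemma f_growth:
  assumes "\<omega> \<in> \<Omega>"
  obtains M where "0 \<le> M" "\<And>t. t \<le> 0 \<Longrightarrow> norm (f1 \<omega> t 0) \<le> M * exp (- \<mu> * t)"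
    "\<And>t. t \<le> 0 \<Longrightarrow> norm (f2 \<omega> t 0) \<le> M * exp (- \<mu> * t)"
proof -
  let ?\<eta> = "\<lambda>t. eta F \<alpha> \<epsilon> (path_shift t \<omega>)"
  obtain M where M: "\<And>t. t \<le> 0 \<Longrightarrow> norm (?\<eta> t) \<le> M * exp (- \<mu> * t)"
    using sublinear_cadlag_exponential_bound[of ?\<eta> \<mu>] eta_ok[OF assms] mu_pos
    by (auto simp: eta_path_ok_def)
  have M0: "0 \<le> M" using order_trans[OF norm_ge_zero M[of 0]] by simp
  have b1: "norm (f1 \<omega> t 0) \<le> (K * \<bar>\<sigma>\<bar> * M) * exp (- \<mu> * t)" if "t \<le> 0" for t
  proof -
    have "norm (f1 \<omega> t 0) \<le> K * (\<bar>\<sigma>\<bar> * norm (?\<eta> t))"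
      using A2_slow[of 0 "\<sigma> *\<^sub>R ?\<eta> t" 0 0] by (simp add: f1_def zero_g)
    also have "\<dots> \<le> K * (\<bar>\<sigma>\<bar> * (M * exp (- \<mu> * t)))"
      using K_pos by (intro mult_left_mono M that) auto
    finally show ?thesis by (simp add: mult.assoc)
  qed
  have b2: "norm (f2 \<omega> t 0) \<le> (K * \<bar>\<sigma>\<bar> * M / \<epsilon>) * exp (- \<mu> * t)" if "t \<le> 0" for t
  proof -
    have "norm (f2 \<omega> t 0) \<le> (K * (\<bar>\<sigma>\<bar> * norm (?\<eta> t))) / \<epsilon>"
      using A2_fast[of 0 "\<sigma> *\<^sub>R ?\<eta> t" 0 0] eps by (simp add: f2_def zero_g divide_right_mono)
    also have "\<dots> \<le> (K * (\<bar>\<sigma>\<bar> * (M * exp (- \<mu> * t)))) / \<epsilon>"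
      using K_pos eps by (intro divide_right_mono mult_left_mono M that) auto
    finally show ?thesis by (simp add: mult.assoc)
  qed
  let ?M = "K * \<bar>\<sigma>\<bar> * M + K * \<bar>\<sigma>\<bar> * M / \<epsilon>"
  have nn: "0 \<le> K * \<bar>\<sigma>\<bar> * M" "0 \<le> K * \<bar>\<sigma>\<bar> * M / \<epsilon>"
    using K_pos M0 eps by auto
  show thesis
  proof (rule that)
    show "0 \<le> ?M" using nn by linarith
    fix t :: real assume "t \<le> 0"
    show "norm (f1 \<omega> t 0) \<le> ?M * exp (- \<mu> * t)"
      using nn by (intro order_trans[OF b1[OF \<open>t \<le> 0\<close>]] mult_right_mono exp_ge_zero) linarith
    show "norm (f2 \<omega> t 0) \<le> ?M * exp (- \<mu> * t)"
      using nn by (intro order_trans[OF b2[OF \<open>t \<le> 0\<close>]] mult_right_mono exp_ge_zero) linarith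
  qed
qed

abbreviation "field \<omega> \<equiv> split_field S B (f1 \<omega>) (f2 \<omega>)"

lemma field_right_continuous:
  assumes "\<omega> \<in> \<Omega>" "(z \<longlongrightarrow> z t) (at_right t)"
  shows "((\<lambda>s. field \<omega> s (z s)) \<longlongrightarrow> field \<omega> t (z t)) (at_right t)"
  unfolding split_field_def
  by (intro tendsto_intros tendsto_matrix_vector_mult assms
      right_continuous_alongD[OF f_right_continuous(1)] right_continuous_alongD[OF f_right_continuous(2)])

section \<open>The flow: uniqueness, identification of half-line solutions and the cocycle
  property\<close>

lemma solution_right_derivative:
  assumes "\<omega> \<in> \<Omega>" and sol: "slow_fast_solution S F g1 g2 \<sigma> \<alpha> \<epsilon> \<omega> z0 z"
  shows "continuous_on UNIV z" "z 0 = z0" "(z has_vector_derivative field \<omega> t (z t)) (at_right t)"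
proof -
  have z: "continuous_on UNIV z"
    "\<And>t. interval_lebesgue_integrable lborel 0 (ereal t) (\<lambda>s. field \<omega> s (z s))"
    "\<And>t. z t = z0 + (LBINT s=0..ereal t. field \<omega> s (z s))"
    using sol unfolding slow_fast_solution_def slow_fast_field_eq by blast+
  show "continuous_on UNIV z" by fact
  show "z 0 = z0" using z(3)[of 0] by (simp add: zero_ereal_def[symmetric])
  have rc: "(z \<longlongrightarrow> z t) (at_right t)" for t
    using z(1) by (simp add: continuous_on_def filterlim_at_split)
  \<comment> \<open>The passage from the integrated form of the equation to right derivatives,
    through which solutions are handled from here on.\<close>
  have "((\<lambda>t. LBINT s=0..ereal t. field \<omega> s (z s)) has_vector_derivative field \<omega> t (z t)) (at_right t)"
    by (rule integral_right_continuous(1)[OF field_right_continuous[OF assms(1) rc] z(2)])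
  then have "((\<lambda>t. z0 + (LBINT s=0..ereal t. field \<omega> s (z s))) has_vector_derivative 0 + field \<omega> t (z t)) (at_right t)"
    by (intro has_vector_derivative_add has_vector_derivative_const)
  moreover have "z = (\<lambda>t. z0 + (LBINT s=0..ereal t. field \<omega> s (z s)))"
    using z(3) by blast
  ultimately show "(z has_vector_derivative field \<omega> t (z t)) (at_right t)" by simp
qed

lemma field_unique:
  assumes "continuous_on {a..b} z" "continuous_on {a..b} z'"
    and "\<And>t. a \<le> t \<Longrightarrow> t < b \<Longrightarrow> (z has_vector_derivative field \<omega> t (z t)) (at_right t)"
    and "\<And>t. a \<le> t \<Longrightarrow> t < b \<Longrightarrow> (z' has_vector_derivative field \<omega> t (z' t)) (at_right t)"
    and "z a = z' a \<or> z b = z' b" and "t \<in> {a..b}"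
  shows "z t = z' t"
  by (rule split_field_solution_unique[OF f_lipschitz _ _ assms]) (use K_pos eps in auto)

text \<open>Existence comes with the noise set, uniqueness from the Gronwall argument on both sides
  of time 0. Together they give the definite description in \<open>phi_hat\<close> its
  meaning.\<close>

lemma phi_solution:
  assumes "\<omega> \<in> \<Omega>"
  shows "slow_fast_solution S F g1 g2 \<sigma> \<alpha> \<epsilon> \<omega> z0 (\<phi> \<omega> z0)"
proof -
  have "\<exists>!z. slow_fast_solution S F g1 g2 \<sigma> \<alpha> \<epsilon> \<omega> z0 z"
  proof (rule ex_ex1I[OF solvable[OF assms]])
    fix z z'
    assume "slow_fast_solution S F g1 g2 \<sigma> \<alpha> \<epsilon> \<omega> z0 z" "slow_fast_solution S F g1 g2 \<sigma> \<alpha> \<epsilon> \<omega> z0 z'"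
    note z = solution_right_derivative[OF assms this(1)] and z' = solution_right_derivative[OF assms this(2)]
    show "z = z'"
    proof
      fix t
      have "z s = z' s" if "s \<in> {0..\<bar>t\<bar>}" for s
        by (rule field_unique[OF _ _ z(3) z'(3) _ that])
           (use z(1,2) z'(1,2) in \<open>auto intro: continuous_on_subset\<close>)
      moreover have "z s = z' s" if "s \<in> {-\<bar>t\<bar>..0}" for s
        by (rule field_unique[OF _ _ z(3) z'(3) _ that])
           (use z(1,2) z'(1,2) in \<open>auto intro: continuous_on_subset\<close>)
      ultimately show "z t = z' t" by (cases "0 \<le> t") auto
    qed
  qed
  from theI'[OF this] show ?thesis by (simp add: phi_hat_def)
qed

lemma
  assumes "\<omega> \<in> \<Omega>"
  shows phi_continuous: "continuous_on UNIV (\<phi> \<omega> z0)" and phi_0: "\<phi> \<omega> z0 0 = z0"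
    and phi_right_derivative: "(\<phi> \<omega> z0 has_vector_derivative field \<omega> t (\<phi> \<omega> z0 t)) (at_right t)"
  by (rule solution_right_derivative[OF assms phi_solution[OF assms]])+

lemma phi_eq_backward:
  assumes "\<omega> \<in> \<Omega>" and cont: "continuous_on {..0} z"
    and z: "\<And>t. t < 0 \<Longrightarrow> (z has_vector_derivative field \<omega> t (z t)) (at_right t)" and "t \<le> 0"
  shows "\<phi> \<omega> (z 0) t = z t"
  by (rule field_unique[OF _ _ phi_right_derivative[OF assms(1)] z, of t 0])
     (use \<open>t \<le> 0\<close> in \<open>auto intro: continuous_on_subset[OF cont]
        continuous_on_subset[OF phi_continuous[OF assms(1)]] simp: phi_0[OF assms(1)]\<close>)

lemma phi_eq_forward:
  assumes "\<omega> \<in> \<Omega>" and cont: "continuous_on {0..} z"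
    and z: "\<And>t. 0 \<le> t \<Longrightarrow> (z has_vector_derivative field \<omega> t (z t)) (at_right t)" and "0 \<le> t"
  shows "\<phi> \<omega> (z 0) t = z t"
  by (rule field_unique[OF _ _ phi_right_derivative[OF assms(1)] z, of 0 t])
     (use \<open>0 \<le> t\<close> in \<open>auto intro: continuous_on_subset[OF cont]
        continuous_on_subset[OF phi_continuous[OF assms(1)]] simp: phi_0[OF assms(1)]\<close>)

lemma field_shift: "field (path_shift s \<omega>) t = field \<omega> (t + s)"
proof -
  have "path_shift t (path_shift s \<omega>) = path_shift (t + s) \<omega>"
    by (simp add: path_shift_def algebra_simps)
  then show ?thesis by (intro ext) (simp only: split_field_def f1_def f2_def)
qed

text \<open>The shifted orbit solves the shifted equation, so uniqueness identifies it with the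
  flow. The claim is made for t \<le> 0, since membership in the manifold concerns the past.\<close>

lemma phi_cocycle:
  assumes "\<omega> \<in> \<Omega>" and "t \<le> 0"
  shows "\<phi> (path_shift s \<omega>) (\<phi> \<omega> z0 s) t = \<phi> \<omega> z0 (t + s)"
proof -
  have "\<phi> (path_shift s \<omega>) (\<phi> \<omega> z0 (0 + s)) t = \<phi> \<omega> z0 (t + s)"
  proof (rule phi_eq_backward[OF shift[OF assms(1)] _ _ assms(2)])
    show "continuous_on {..0} (\<lambda>t. \<phi> \<omega> z0 (t + s))"
      by (rule continuous_on_compose2[OF phi_continuous[OF assms(1)]])
         (auto intro: continuous_intros)
    show "((\<lambda>t. \<phi> \<omega> z0 (t + s)) has_vector_derivative field (path_shift s \<omega>) t (\<phi> \<omega> z0 (t + s))) (at_right t)" for t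
      unfolding field_shift
      by (rule has_vector_derivative_at_right_shift) (rule phi_right_derivative[OF assms(1)])
  qed
  then show ?thesis by simp
qed

section \<open>The manifold: membership through exponential bounds, and invariance\<close>

lemma slow_manifold_iff:
  assumes "\<omega> \<in> \<Omega>"
  shows "z0 \<in> \<M> \<omega> \<longleftrightarrow> restrict (\<phi> \<omega> z0) {..0} \<in> C_minus (- \<mu>)"
    and "z0 \<in> \<M> \<omega> \<longleftrightarrow> (\<exists>C. \<forall>t\<le>0. norm (fst (\<phi> \<omega> z0 t)) \<le> C * exp (- \<mu> * t) \<and> norm (snd (\<phi> \<omega> z0 t)) \<le> C * exp (- \<mu> * t))"
proof -
  show *: "z0 \<in> \<M> \<omega> \<longleftrightarrow> restrict (\<phi> \<omega> z0) {..0} \<in> C_minus (- \<mu>)"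
    by (simp add: slow_manifold_def)
  have "continuous_on {..0} (restrict (\<phi> \<omega> z0) {..0})"
    by (rule continuous_on_eq[OF continuous_on_subset[OF phi_continuous[OF assms]]]) auto
  then show "z0 \<in> \<M> \<omega> \<longleftrightarrow> (\<exists>C. \<forall>t\<le>0. norm (fst (\<phi> \<omega> z0 t)) \<le> C * exp (- \<mu> * t) \<and> norm (snd (\<phi> \<omega> z0 t)) \<le> C * exp (- \<mu> * t))"
    unfolding * C_minus_iff by simp
qed

lemma slow_manifoldI:
  assumes "\<omega> \<in> \<Omega>" "continuous_on {..0} z"
    and "\<And>t. t < 0 \<Longrightarrow> (z has_vector_derivative field \<omega> t (z t)) (at_right t)"
    and "\<And>t. t \<le> 0 \<Longrightarrow> norm (fst (z t)) \<le> C * exp (- \<mu> * t)" "\<And>t. t \<le> 0 \<Longrightarrow> norm (snd (z t)) \<le> C * exp (- \<mu> * t)"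
  shows "z 0 \<in> \<M> \<omega>"
proof -
  have "\<phi> \<omega> (z 0) t = z t" if "t \<le> 0" for t
    by (rule phi_eq_backward[OF assms(1-3) that])
  then show ?thesis
    unfolding slow_manifold_iff(2)[OF assms(1)] using assms(4,5) by auto
qed

text \<open>Turns a solution of the glued problem into a point of the manifold: \<open>p + z\<close>
  is the past of an orbit, and the constant \<open>p\<close> respects the growth bound because exp(-
  \<mu> t) \<ge> 1 for t \<le> 0.\<close>

lemma slow_manifold_translateI:
  assumes "\<omega> \<in> \<Omega>" "continuous_on UNIV z"
    and d: "\<And>t. t < 0 \<Longrightarrow> ((\<lambda>t. p + z t) has_vector_derivative field \<omega> t (p + z t)) (at_right t)"
    and C: "\<And>t. norm (fst (z t)) \<le> C * exp (- \<mu> * t)" "\<And>t. norm (snd (z t)) \<le> C * exp (- \<mu> * t)"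
  shows "p + z 0 \<in> \<M> \<omega>"
proof (rule slow_manifoldI[OF assms(1) _ d])
  show "continuous_on {..0} (\<lambda>t. p + z t)"
    by (intro continuous_intros continuous_on_subset[OF assms(2)]) auto
  fix t :: real assume "t \<le> 0"
  then have "1 \<le> exp (- \<mu> * t)" by (rule one_le_weight)
  then have "norm p \<le> norm p * exp (- \<mu> * t)"
    using mult_left_mono[of 1 "exp (- \<mu> * t)" "norm p"] by simp
  then show "norm (fst (p + z t)) \<le> (norm p + C) * exp (- \<mu> * t)" "norm (snd (p + z t)) \<le> (norm p + C) * exp (- \<mu> * t)"
    using C[of t] norm_triangle_ineq[of "fst p" "fst (z t)"] norm_triangle_ineq[of "snd p" "snd (z t)"]
      norm_prod_bounds(1,2)[of p] unfolding distrib_right fst_add snd_add by linarith+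
qed

text \<open>Seen from time s, the past of the orbit consists of its old past, where exp(- \<mu> (t +
  s)) \<le> exp(- \<mu> t), and of the compact piece over [0, s], bounded by continuity.\<close>

lemma slow_manifold_invariant:
  assumes "\<omega> \<in> \<Omega>" "0 \<le> s" "z0 \<in> \<M> \<omega>"
  shows "\<phi> \<omega> z0 s \<in> \<M> (path_shift s \<omega>)"
proof -
  obtain C where C: "\<And>t. t \<le> 0 \<Longrightarrow> norm (fst (\<phi> \<omega> z0 t)) \<le> C * exp (- \<mu> * t)"
      "\<And>t. t \<le> 0 \<Longrightarrow> norm (snd (\<phi> \<omega> z0 t)) \<le> C * exp (- \<mu> * t)"
    using assms(3) unfolding slow_manifold_iff(2)[OF assms(1)] by blast
  have "compact (\<phi> \<omega> z0 ` {0..s})"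
    by (intro compact_continuous_image continuous_on_subset[OF phi_continuous[OF assms(1)]]) auto
  then have "bounded (\<phi> \<omega> z0 ` {0..s})" by (rule compact_imp_bounded)
  then obtain D where "\<forall>x\<in>\<phi> \<omega> z0 ` {0..s}. norm x \<le> D"
    unfolding bounded_iff by (elim exE)
  then have D: "norm (\<phi> \<omega> z0 t) \<le> D" if "t \<in> {0..s}" for t
    using that by (elim ballE[of _ _ "\<phi> \<omega> z0 t"]) auto
  have D0: "0 \<le> D" using order_trans[OF norm_ge_zero D[of 0]] assms(2) by simp
  have "norm (fst (\<phi> \<omega> z0 (t + s))) \<le> (\<bar>C\<bar> + D) * exp (- \<mu> * t) \<and>
      norm (snd (\<phi> \<omega> z0 (t + s))) \<le> (\<bar>C\<bar> + D) * exp (- \<mu> * t)" if "t \<le> 0" for t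
  proof (cases "t + s \<le> 0")
    case True
    have "- \<mu> * (t + s) \<le> - \<mu> * t"
      by (rule mult_left_mono_neg) (use assms(2) mu_pos in auto)
    then have "C * exp (- \<mu> * (t + s)) \<le> (\<bar>C\<bar> + D) * exp (- \<mu> * t)"
      using D0 by (intro mult_mono) auto
    then show ?thesis using C[OF True] by linarith
  next
    case False
    have "D \<le> (\<bar>C\<bar> + D) * exp (- \<mu> * t)"
    proof -
      have "1 \<le> exp (- \<mu> * t)" using that by (rule one_le_weight)
      then have "(\<bar>C\<bar> + D) * 1 \<le> (\<bar>C\<bar> + D) * exp (- \<mu> * t)" using D0 by (intro mult_left_mono) auto
      then show ?thesis by simp
    qed
    moreover have "norm (\<phi> \<omega> z0 (t + s)) \<le> D" using False that by (intro D) auto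
    ultimately show ?thesis
      using norm_prod_bounds(1,2)[of "\<phi> \<omega> z0 (t + s)"] by linarith
  qed
  then show ?thesis
    unfolding slow_manifold_iff(2)[OF shift[OF assms(1)]]
    using phi_cocycle[OF assms(1)] by (intro exI[of _ "\<bar>C\<bar> + D"]) simp
qed

text \<open>Cutting the nonlinearity off at time \<open>0\<close> leaves the integrals in \<^const>\<open>backward_orbit\<close>
  unchanged for \<open>t \<le> 0\<close> and makes them available on the whole time axis.\<close>

definition forcing1 where "forcing1 \<omega> z s = (if s < 0 then f1 \<omega> s (z s) else 0)"
definition forcing2 where "forcing2 \<omega> z s = (if s < 0 then f2 \<omega> s (z s) else 0)"

text \<open>The variation of constants map whose fixed points on (-\<infinity>, 0], within
  \<open>C_minus\<close>, are the backward orbits.\<close>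

definition mild where
  "mild \<omega> x0 z t = (mat_exp (t *\<^sub>R S) *v x0 + duhamel S 0 (forcing1 \<omega> z) t, duhamel B (-\<infinity>) (forcing2 \<omega> z) t)"

lemma backward_integral_eq:
  assumes "t \<le> 0"
  shows "(LBINT s=0..ereal t. mat_exp ((t - s) *\<^sub>R S) *v
      g1 (fst (z s), snd (z s) + \<sigma> *\<^sub>R eta F \<alpha> \<epsilon> (path_shift s \<omega>))) = duhamel S 0 (forcing1 \<omega> z) t"
    and "(1/\<epsilon>) *\<^sub>R (LBINT s=-\<infinity>..ereal t. mat_exp (((t - s) / \<epsilon>) *\<^sub>R F) *v
      g2 (fst (z s), snd (z s) + \<sigma> *\<^sub>R eta F \<alpha> \<epsilon> (path_shift s \<omega>))) = duhamel B (-\<infinity>) (forcing2 \<omega> z) t"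
proof -
  show "(LBINT s=0..ereal t. mat_exp ((t - s) *\<^sub>R S) *v
      g1 (fst (z s), snd (z s) + \<sigma> *\<^sub>R eta F \<alpha> \<epsilon> (path_shift s \<omega>))) = duhamel S 0 (forcing1 \<omega> z) t"
    unfolding duhamel_def
    by (rule interval_integral_cong)
       (use assms in \<open>auto simp: forcing1_def f1_def einterval_iff zero_ereal_def max_def split: if_splits\<close>)
  show "(1/\<epsilon>) *\<^sub>R (LBINT s=-\<infinity>..ereal t. mat_exp (((t - s) / \<epsilon>) *\<^sub>R F) *v
      g2 (fst (z s), snd (z s) + \<sigma> *\<^sub>R eta F \<alpha> \<epsilon> (path_shift s \<omega>))) = duhamel B (-\<infinity>) (forcing2 \<omega> z) t"
    unfolding duhamel_def interval_lebesgue_integral_scaleR[symmetric]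
    by (rule interval_integral_cong)
       (use assms in \<open>auto simp: forcing2_def f2_def einterval_iff matrix_vector_mult_scaleR\<close>)
qed

lemma backward_orbit_iff:
  "backward_orbit S F g1 g2 \<sigma> \<alpha> \<gamma> \<epsilon> \<omega> x0 z \<longleftrightarrow> z \<in> C_minus (- \<mu>) \<and> (\<forall>t\<le>0. z t = mild \<omega> x0 z t)"
  unfolding backward_orbit_def by (simp add: backward_integral_eq mild_def prod_eq_iff)

lemma forcing_cong:
  assumes "\<And>t. t \<le> 0 \<Longrightarrow> z t = z' t"
  shows "forcing1 \<omega> z = forcing1 \<omega> z'" "forcing2 \<omega> z = forcing2 \<omega> z'"
  using assms by (simp_all add: forcing1_def forcing2_def fun_eq_iff)

section \<open>Paths with exponentially bounded past and the backward integral equations\<close>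

context
  fixes \<omega> :: "real \<Rightarrow> real^'n2" and z :: "real \<Rightarrow> (real^'n1) \<times> (real^'n2)" and C :: real
  assumes \<omega>: "\<omega> \<in> \<Omega>" and z_cont: "continuous_on {..0} z"
    and z_bound: "\<And>t. t \<le> 0 \<Longrightarrow> norm (fst (z t)) \<le> C * exp (- \<mu> * t)" "\<And>t. t \<le> 0 \<Longrightarrow> norm (snd (z t)) \<le> C * exp (- \<mu> * t)"
begin

lemma forcing_right_continuous:
  "(forcing1 \<omega> z \<longlongrightarrow> forcing1 \<omega> z t) (at_right t)" "(forcing2 \<omega> z \<longlongrightarrow> forcing2 \<omega> z t) (at_right t)"
proof -
  have "(forcing1 \<omega> z \<longlongrightarrow> forcing1 \<omega> z t) (at_right t) \<and> (forcing2 \<omega> z \<longlongrightarrow> forcing2 \<omega> z t) (at_right t)"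
  proof (cases "t < 0")
    case True
    then have "isCont z t" using continuous_on_interior[OF z_cont, of t] by simp
    then have zt: "(z \<longlongrightarrow> z t) (at_right t)"
      by (simp add: isCont_def filterlim_at_split)
    have ev: "\<forall>\<^sub>F s in at_right t. s < 0"
      using True eventually_at_right_field by blast
    have 1: "\<forall>\<^sub>F s in at_right t. f1 \<omega> s (z s) = forcing1 \<omega> z s"
      and 2: "\<forall>\<^sub>F s in at_right t. f2 \<omega> s (z s) = forcing2 \<omega> z s"
      using ev by (auto simp: forcing1_def forcing2_def elim: eventually_mono)
    show ?thesis
      using Lim_transform_eventually[OF right_continuous_alongD[OF f_right_continuous(1)[OF \<omega>] zt] 1]
        Lim_transform_eventually[OF right_continuous_alongD[OF f_right_continuous(2)[OF \<omega>] zt] 2] True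
      by (simp add: forcing1_def[of _ _ t] forcing2_def[of _ _ t])
  next
    case False
    have 1: "\<forall>\<^sub>F s in at_right t. 0 = forcing1 \<omega> z s" and 2: "\<forall>\<^sub>F s in at_right t. 0 = forcing2 \<omega> z s"
      using eventually_at_right_less[of t] False by (auto simp: forcing1_def forcing2_def elim: eventually_mono)
    show ?thesis
      using Lim_transform_eventually[OF tendsto_const 1] Lim_transform_eventually[OF tendsto_const 2] False
      by (simp add: forcing1_def[of _ _ t] forcing2_def[of _ _ t])
  qed
  then show "(forcing1 \<omega> z \<longlongrightarrow> forcing1 \<omega> z t) (at_right t)" "(forcing2 \<omega> z \<longlongrightarrow> forcing2 \<omega> z t) (at_right t)"
    by blast+
qed

lemma forcing_bound:
  obtains N where "\<And>s. norm (forcing1 \<omega> z s) \<le> N * exp (- \<mu> * s)" "\<And>s. norm (forcing2 \<omega> z s) \<le> N * exp (- \<mu> * s)"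
proof -
  obtain M where M: "0 \<le> M" "\<And>t. t \<le> 0 \<Longrightarrow> norm (f1 \<omega> t 0) \<le> M * exp (- \<mu> * t)"
    "\<And>t. t \<le> 0 \<Longrightarrow> norm (f2 \<omega> t 0) \<le> M * exp (- \<mu> * t)"
    using f_growth[OF \<omega>] by blast
  have C0: "0 \<le> C" using order_trans[OF norm_ge_zero z_bound(1)[of 0]] by simp
  define N where "N = 2 * K * C + 2 * (K / \<epsilon>) * C + M"
  have nn: "0 \<le> 2 * K * C" "0 \<le> 2 * (K / \<epsilon>) * C" using K_pos eps C0 by auto
  have "norm (forcing1 \<omega> z s) \<le> N * exp (- \<mu> * s) \<and> norm (forcing2 \<omega> z s) \<le> N * exp (- \<mu> * s)" for s
  proof (cases "s < 0")
    case True
    let ?e = "exp (- \<mu> * s)"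
    have sum: "norm (fst (z s) - fst 0) + norm (snd (z s) - snd 0) \<le> 2 * C * ?e"
      using z_bound[of s] True by simp
    have "norm (f1 \<omega> s (z s)) \<le> norm (f1 \<omega> s (z s) - f1 \<omega> s 0) + norm (f1 \<omega> s 0)"
      by (metis diff_add_cancel norm_triangle_ineq)
    also have "\<dots> \<le> K * (2 * C * ?e) + M * ?e"
      using K_pos True by (intro add_mono M order_trans[OF sum_lipschitzD[OF f_lipschitz(1)]] mult_left_mono sum) auto
    also have "\<dots> = (2 * K * C + M) * ?e" by (simp add: algebra_simps)
    also have "\<dots> \<le> N * ?e" using nn by (intro mult_right_mono) (auto simp: N_def)
    finally have 1: "norm (f1 \<omega> s (z s)) \<le> N * ?e" .
    have "norm (f2 \<omega> s (z s)) \<le> norm (f2 \<omega> s (z s) - f2 \<omega> s 0) + norm (f2 \<omega> s 0)"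
      by (metis diff_add_cancel norm_triangle_ineq)
    also have "\<dots> \<le> K / \<epsilon> * (2 * C * ?e) + M * ?e"
      using K_pos eps True by (intro add_mono M order_trans[OF sum_lipschitzD[OF f_lipschitz(2)]] mult_left_mono sum) auto
    also have "\<dots> = (2 * (K / \<epsilon>) * C + M) * ?e" by (simp add: algebra_simps)
    also have "\<dots> \<le> N * ?e" using nn by (intro mult_right_mono) (auto simp: N_def)
    finally show ?thesis using 1 True by (simp add: forcing1_def forcing2_def)
  next
    case False
    have "0 \<le> N" using nn M(1) by (simp add: N_def)
    then show ?thesis using False by (simp add: forcing1_def forcing2_def)
  qed
  then show thesis using that by blast
qed

lemma forcing_integrable:
  "duhamel_integrable S 0 (forcing1 \<omega> z)" "duhamel_integrable B (-\<infinity>) (forcing2 \<omega> z)"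
proof -
  obtain N where N: "\<And>s. norm (forcing1 \<omega> z s) \<le> N * exp (- \<mu> * s)" "\<And>s. norm (forcing2 \<omega> z s) \<le> N * exp (- \<mu> * s)"
    using forcing_bound by blast
  show "duhamel_integrable S 0 (forcing1 \<omega> z)"
    by (rule duhamel_integrable_0[OF forcing_right_continuous(1) N(1)])
  show "duhamel_integrable B (-\<infinity>) (forcing2 \<omega> z)"
    by (rule duhamel_minus_infinity(1)[OF fast fast_rate forcing_right_continuous(2) N(2)])
qed

lemma mild_continuous: "continuous_on UNIV (mild \<omega> x0 z)"
  unfolding mild_def[abs_def]
  by (rule continuous_on_UNIV_if_Icc)
     (intro continuous_intros continuous_on_matrix_vector_mult continuous_on_mat_exp
       duhamel_continuous forcing_right_continuous forcing_integrable)

lemma mild_fst_0: "fst (mild \<omega> x0 z 0) = x0"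
  by (simp add: mild_def duhamel_def zero_ereal_def[symmetric])

lemma mild_right_derivative:
  "((\<lambda>t. fst (mild \<omega> x0 z t)) has_vector_derivative S *v fst (mild \<omega> x0 z t) + forcing1 \<omega> z t) (at_right t)"
  "((\<lambda>t. snd (mild \<omega> x0 z t)) has_vector_derivative B *v snd (mild \<omega> x0 z t) + forcing2 \<omega> z t) (at_right t)"
proof -
  have "((\<lambda>t. mat_exp (t *\<^sub>R S) *v x0) has_vector_derivative S *v (mat_exp (t *\<^sub>R S) *v x0)) (at_right t)"
    using has_vector_derivative_matrix_vector_mult[OF has_vector_derivative_mat_exp[of S t "{t<..}"] has_vector_derivative_const[of x0]]
    by (simp add: matrix_vector_mul_assoc)
  from has_vector_derivative_add[OF this duhamel_right_derivative[OF forcing_right_continuous(1) forcing_integrable(1)]]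
  show "((\<lambda>t. fst (mild \<omega> x0 z t)) has_vector_derivative S *v fst (mild \<omega> x0 z t) + forcing1 \<omega> z t) (at_right t)"
    by (simp add: mild_def matrix_vector_right_distrib add.assoc)
  show "((\<lambda>t. snd (mild \<omega> x0 z t)) has_vector_derivative B *v snd (mild \<omega> x0 z t) + forcing2 \<omega> z t) (at_right t)"
    using duhamel_right_derivative[OF forcing_right_continuous(2) forcing_integrable(2)]
    by (simp add: mild_def)
qed

text \<open>A solution and its image under \<open>mild\<close> have the same forcing, so their
  difference solves the homogeneous linear equation. Its slow part vanishes because it does so at
  time 0, its fast part because both paths lie in the weighted space on the past.\<close>

lemma solution_eq_mild:
  assumes z: "\<And>t. t < 0 \<Longrightarrow> (z has_vector_derivative field \<omega> t (z t)) (at_right t)" and "t \<le> 0"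
  shows "z t = mild \<omega> (fst (z 0)) z t"
proof -
  let ?m = "mild \<omega> (fst (z 0)) z"
  define u where "u t = fst (z t) - fst (?m t)" for t
  define v where "v t = snd (z t) - snd (?m t)" for t
  have cont: "continuous_on X u" "continuous_on X v" if "X \<subseteq> {..0}" for X
    unfolding u_def v_def using that
    by (auto intro!: continuous_intros continuous_on_subset[OF z_cont] continuous_on_subset[OF mild_continuous])
  have du: "(u has_vector_derivative S *v u t + 0) (at_right t)" if "t < 0" for t
    using has_vector_derivative_diff[OF bounded_linear.has_vector_derivative[OF bounded_linear_fst z[OF that]]
        mild_right_derivative(1)[of "fst (z 0)" t]] that
    by (simp add: u_def[abs_def] split_field_def forcing1_def matrix_vector_mult_diff_distrib)
  have dv: "(v has_vector_derivative B *v v t + 0) (at_right t)" if "t < 0" for t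
    using has_vector_derivative_diff[OF bounded_linear.has_vector_derivative[OF bounded_linear_snd z[OF that]]
        mild_right_derivative(2)[of "fst (z 0)" t]] that
    by (simp add: v_def[abs_def] split_field_def forcing2_def matrix_vector_mult_diff_distrib)
  have "norm (u t) \<le> exp (\<gamma>s * (t - 0)) * norm (u 0) + 0 / (\<gamma>s + \<mu>) * exp (- \<mu> * t)"
    using \<open>t \<le> 0\<close> by (intro backward_estimate[where k = "\<lambda>_. 0", OF slow slow_rate] cont du) auto
  then have u: "u t = 0" by (simp add: u_def mild_fst_0)
  obtain N where N: "\<And>s. norm (forcing2 \<omega> z s) \<le> N * exp (- \<mu> * s)"
    using forcing_bound by blast
  \<comment> \<open>The given bound on \<open>z\<close> plus the half-line bound for the fast
    integral of a forcing of size N.\<close>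
  define D where "D = C + N / - (\<gamma>f / \<epsilon> + \<mu>)"
  have v_bound: "norm (v s) \<le> D * exp (- \<mu> * s)" if "s \<le> 0" for s
  proof -
    have "norm (snd (?m s)) \<le> N / - (\<gamma>f / \<epsilon> + \<mu>) * exp (- \<mu> * s)"
      unfolding mild_def snd_conv
      by (rule duhamel_minus_infinity(2)[OF fast fast_rate forcing_right_continuous(2) N])
    then show ?thesis
      using z_bound(2)[OF that] norm_triangle_ineq4[of "snd (z s)" "snd (?m s)"]
      unfolding v_def D_def distrib_right by linarith
  qed
  have "norm (v t) \<le> 0"
  proof (rule vanishing_at_minus_infinity)
    fix s assume "s \<le> t"
    have "norm (v t) \<le> exp (\<gamma>f / \<epsilon> * (t - s)) * norm (v s) + 0 / - (\<gamma>f / \<epsilon> + \<mu>) * exp (- \<mu> * t)"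
      using \<open>t \<le> 0\<close> \<open>s \<le> t\<close>
      by (intro forward_estimate[where k = "\<lambda>_. 0", OF fast fast_rate] cont dv) auto
    also have "\<dots> \<le> exp (\<gamma>f / \<epsilon> * (t - s)) * (D * exp (- \<mu> * s)) + 0"
      using v_bound[of s] \<open>t \<le> 0\<close> \<open>s \<le> t\<close> by (intro add_mono mult_left_mono) auto
    finally show "norm (v t) \<le> exp (\<gamma>f / \<epsilon> * (t - s)) * (D * exp (- \<mu> * s)) + 0" .
  qed
  then have "v t = 0" by simp
  with u show ?thesis by (simp add: u_def v_def prod_eq_iff)
qed

end

section \<open>The manifold as the graph of \<open>h_hat\<close>\<close>

lemma slow_manifold_backward_orbit:
  assumes "\<omega> \<in> \<Omega>" "z0 \<in> \<M> \<omega>"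
  shows "backward_orbit S F g1 g2 \<sigma> \<alpha> \<gamma> \<epsilon> \<omega> (fst z0) (restrict (\<phi> \<omega> z0) {..0})"
proof -
  obtain C where C: "\<And>t. t \<le> 0 \<Longrightarrow> norm (fst (\<phi> \<omega> z0 t)) \<le> C * exp (- \<mu> * t)"
      "\<And>t. t \<le> 0 \<Longrightarrow> norm (snd (\<phi> \<omega> z0 t)) \<le> C * exp (- \<mu> * t)"
    using assms(2) unfolding slow_manifold_iff(2)[OF assms(1)] by blast
  have "\<phi> \<omega> z0 t = mild \<omega> (fst z0) (\<phi> \<omega> z0) t" if "t \<le> 0" for t
    using solution_eq_mild[OF assms(1) continuous_on_subset[OF phi_continuous[OF assms(1)]] C
        phi_right_derivative[OF assms(1)] that]
    by (simp add: phi_0[OF assms(1)])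
  moreover have "mild \<omega> (fst z0) (restrict (\<phi> \<omega> z0) {..0}) = mild \<omega> (fst z0) (\<phi> \<omega> z0)"
    by (simp add: mild_def fun_eq_iff forcing_cong[of "restrict (\<phi> \<omega> z0) {..0}" "\<phi> \<omega> z0"])
  ultimately show ?thesis
    using assms(2) by (simp add: backward_orbit_iff slow_manifold_iff(1)[OF assms(1)])
qed

text \<open>A backward orbit is first replaced by its image under \<open>mild\<close>, with which it
  agrees for t \<le> 0 and whose right derivatives are known. Substituting the agreement into the
  forcing makes the image a solution of the full equation, so \<open>backward_bounded_unique\<close>
  applies; extensionality settles positive times.\<close>

lemma backward_orbit_unique:
  assumes "\<omega> \<in> \<Omega>" and bo: "backward_orbit S F g1 g2 \<sigma> \<alpha> \<gamma> \<epsilon> \<omega> x0 z" "backward_orbit S F g1 g2 \<sigma> \<alpha> \<gamma> \<epsilon> \<omega> x0 z'"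
  shows "z = z'"
proof -
  have mild: "\<exists>C. continuous_on {..0} (mild \<omega> x0 z) \<and> fst (mild \<omega> x0 z 0) = x0 \<and>
      (\<forall>t<0. (mild \<omega> x0 z has_vector_derivative field \<omega> t (mild \<omega> x0 z t)) (at_right t)) \<and>
      (\<forall>t\<le>0. norm (fst (mild \<omega> x0 z t)) \<le> C * exp (- \<mu> * t) \<and> norm (snd (mild \<omega> x0 z t)) \<le> C * exp (- \<mu> * t))"
    if orbit: "backward_orbit S F g1 g2 \<sigma> \<alpha> \<gamma> \<epsilon> \<omega> x0 z" for z
  proof -
    have z: "continuous_on {..0} z" and eq: "\<And>t. t \<le> 0 \<Longrightarrow> z t = mild \<omega> x0 z t"
      using orbit unfolding backward_orbit_iff C_minus_iff by blast+
    obtain C where "\<forall>t\<le>0. norm (fst (z t)) \<le> C * exp (- \<mu> * t) \<and> norm (snd (z t)) \<le> C * exp (- \<mu> * t)"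
      using orbit unfolding backward_orbit_iff C_minus_iff by blast
    then have C: "\<And>t. t \<le> 0 \<Longrightarrow> norm (fst (z t)) \<le> C * exp (- \<mu> * t)"
      "\<And>t. t \<le> 0 \<Longrightarrow> norm (snd (z t)) \<le> C * exp (- \<mu> * t)"
      by blast+
    note facts = assms(1) z C
    have "(mild \<omega> x0 z has_vector_derivative field \<omega> t (mild \<omega> x0 z t)) (at_right t)" if "t < 0" for t
      using has_vector_derivative_Pair[OF mild_right_derivative(1)[OF facts, of x0 t] mild_right_derivative(2)[OF facts, of x0 t]]
        that eq[of t] by (simp add: split_field_def forcing1_def forcing2_def)
    moreover have "continuous_on {..0} (mild \<omega> x0 z)"
      by (rule continuous_on_subset[OF mild_continuous[OF facts] subset_UNIV])
    moreover have "fst (mild \<omega> x0 z 0) = x0" by (rule mild_fst_0[OF facts])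
    moreover have "norm (fst (mild \<omega> x0 z t)) \<le> C * exp (- \<mu> * t) \<and> norm (snd (mild \<omega> x0 z t)) \<le> C * exp (- \<mu> * t)"
      if "t \<le> 0" for t
      using C[OF that] unfolding eq[OF that] by blast
    ultimately show ?thesis by blast
  qed
  obtain C where C: "continuous_on {..0} (mild \<omega> x0 z)" "fst (mild \<omega> x0 z 0) = x0"
      "\<And>t. t < 0 \<Longrightarrow> (mild \<omega> x0 z has_vector_derivative field \<omega> t (mild \<omega> x0 z t)) (at_right t)"
      "\<And>t. t \<le> 0 \<Longrightarrow> norm (fst (mild \<omega> x0 z t)) \<le> C * exp (- \<mu> * t)"
      "\<And>t. t \<le> 0 \<Longrightarrow> norm (snd (mild \<omega> x0 z t)) \<le> C * exp (- \<mu> * t)"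
    using mild[OF bo(1)] by blast
  obtain C' where C': "continuous_on {..0} (mild \<omega> x0 z')" "fst (mild \<omega> x0 z' 0) = x0"
      "\<And>t. t < 0 \<Longrightarrow> (mild \<omega> x0 z' has_vector_derivative field \<omega> t (mild \<omega> x0 z' t)) (at_right t)"
      "\<And>t. t \<le> 0 \<Longrightarrow> norm (fst (mild \<omega> x0 z' t)) \<le> C' * exp (- \<mu> * t)"
      "\<And>t. t \<le> 0 \<Longrightarrow> norm (snd (mild \<omega> x0 z' t)) \<le> C' * exp (- \<mu> * t)"
    using mild[OF bo(2)] by blast
  have "mild \<omega> x0 z t = mild \<omega> x0 z' t" if "t \<le> 0" for t
    by (rule backward_bounded_unique[OF f_lipschitz C(1) C'(1) C(3) C'(3) C(4,5) C'(4,5) _ that])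
       (simp_all add: C(2) C'(2))
  then have eq: "z t = z' t" if "t \<in> {..0}" for t
    using bo that unfolding backward_orbit_iff by (metis atMost_iff)
  have ext: "z \<in> extensional {..0}" "z' \<in> extensional {..0}"
    using bo unfolding backward_orbit_iff C_minus_iff by blast+
  show ?thesis
    by (rule extensionalityI[OF ext eq])
qed

text \<open>The integral that defines \<open>h_hat\<close> is the fast integral equation at t = 0,
  and by uniqueness the backward orbit chosen there is the past of the orbit through
  \<open>z0\<close>.\<close>

lemma h_hat_eq:
  assumes "\<omega> \<in> \<Omega>" "z0 \<in> \<M> \<omega>"
  shows "h_hat S F g1 g2 \<sigma> \<alpha> \<gamma> \<epsilon> \<omega> (fst z0) = snd z0"
proof -
  let ?z = "restrict (\<phi> \<omega> z0) {..0}"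
  note bo = slow_manifold_backward_orbit[OF assms]
  then have "(THE z. backward_orbit S F g1 g2 \<sigma> \<alpha> \<gamma> \<epsilon> \<omega> (fst z0) z) = ?z"
    using backward_orbit_unique[OF assms(1)] by blast
  then have "h_hat S F g1 g2 \<sigma> \<alpha> \<gamma> \<epsilon> \<omega> (fst z0) = duhamel B (-\<infinity>) (forcing2 \<omega> ?z) 0"
    using backward_integral_eq(2)[of 0 ?z \<omega>] by (simp add: h_hat_def Let_def zero_ereal_def)
  also have "\<dots> = snd (?z 0)"
    using bo by (simp add: backward_orbit_iff mild_def)
  also have "\<dots> = snd z0" by (simp add: phi_0[OF assms(1)])
  finally show ?thesis .
qed

text \<open>With no nonlinearity on the right, the slow perturbation is for t \<ge> 0 a purely
  linear solution with the weighted bound. Such a solution is 0, so freezing at (x0, 0) produces a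
  point whose slow component is exactly \<open>x0\<close>.\<close>

lemma slow_manifold_over:
  assumes "\<omega> \<in> \<Omega>"
  obtains z0 where "z0 \<in> \<M> \<omega>" "fst z0 = x0"
proof -
  obtain M where M: "0 \<le> M" "\<And>t. t \<le> 0 \<Longrightarrow> norm (f1 \<omega> t 0) \<le> M * exp (- \<mu> * t)"
    "\<And>t. t \<le> 0 \<Longrightarrow> norm (f2 \<omega> t 0) \<le> M * exp (- \<mu> * t)"
    using f_growth[OF assms] by blast
  have zero: "sum_lipschitz K (\<lambda>_ _. 0)" "sum_lipschitz (K / \<epsilon>) (\<lambda>_ _. 0)"
    "right_continuous_along (\<lambda>_ _. 0 :: real^'n1)" "right_continuous_along (\<lambda>_ _. 0 :: real^'n2)"
    using K_pos eps by (simp_all add: sum_lipschitz_def right_continuous_along_def)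
  obtain z C where z: "continuous_on UNIV z"
    "\<And>t. 0 \<le> t \<Longrightarrow> (z has_vector_derivative split_field S B (\<lambda>_ _. 0) (\<lambda>_ _. 0) t (z t)) (at_right t)"
    "\<And>t. t < 0 \<Longrightarrow> ((\<lambda>t. (x0, 0) + z t) has_vector_derivative field \<omega> t ((x0, 0) + z t)) (at_right t)"
    "\<And>t. norm (fst (z t)) \<le> C * exp (- \<mu> * t)" "\<And>t. norm (snd (z t)) \<le> C * exp (- \<mu> * t)"
    by (rule split_bounded_solution_exists[OF f_lipschitz f_right_continuous[OF assms] M(2,3) zero(1,2,3) zero(4), of "(x0, 0)"]) auto
  have "norm (fst (z 0)) \<le> 0"
  proof (rule vanishing_at_plus_infinity)
    fix s :: real assume "0 \<le> s"
    have d: "((\<lambda>t. fst (z t)) has_vector_derivative S *v fst (z t) + 0) (at_right t)" if "0 \<le> t" for t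
      using bounded_linear.has_vector_derivative[OF bounded_linear_fst z(2)[OF that]] by (simp add: split_field_def)
    have "norm (fst (z 0)) \<le> exp (\<gamma>s * (0 - s)) * norm (fst (z s)) + 0 / (\<gamma>s + \<mu>) * exp (- \<mu> * 0)"
      using \<open>0 \<le> s\<close>
      by (intro backward_estimate[where k = "\<lambda>_. 0" and w = "\<lambda>t. fst (z t)", OF slow slow_rate] d
          continuous_intros continuous_on_subset[OF z(1)]) auto
    also have "\<dots> \<le> exp (\<gamma>s * (0 - s)) * (C * exp (- \<mu> * s)) + 0"
      using z(4)[of s] by (intro add_mono mult_left_mono) auto
    finally show "norm (fst (z 0)) \<le> exp (\<gamma>s * (0 - s)) * (C * exp (- \<mu> * s)) + 0" .
  qed
  then have "fst ((x0, 0) + z 0) = x0" by simp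
  moreover have "(\<lambda>t. (x0, 0) + z t) 0 \<in> \<M> \<omega>"
    by (rule slow_manifold_translateI[OF assms z(1) z(3-5)])
  ultimately show thesis using that by blast
qed

lemma slow_manifold_eq_graph:
  assumes "\<omega> \<in> \<Omega>"
  shows "\<M> \<omega> = {(x0, h_hat S F g1 g2 \<sigma> \<alpha> \<gamma> \<epsilon> \<omega> x0) | x0. True}"
proof (intro equalityI subsetI)
  fix z0 assume "z0 \<in> \<M> \<omega>"
  then have "z0 = (fst z0, h_hat S F g1 g2 \<sigma> \<alpha> \<gamma> \<epsilon> \<omega> (fst z0))"
    using h_hat_eq[OF assms] by simp
  then show "z0 \<in> {(x0, h_hat S F g1 g2 \<sigma> \<alpha> \<gamma> \<epsilon> \<omega> x0) | x0. True}" by blast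
next
  fix z0 assume "z0 \<in> {(x0, h_hat S F g1 g2 \<sigma> \<alpha> \<gamma> \<epsilon> \<omega> x0) | x0. True}"
  then obtain x0 where z0: "z0 = (x0, h_hat S F g1 g2 \<sigma> \<alpha> \<gamma> \<epsilon> \<omega> x0)" by blast
  obtain p where p: "p \<in> \<M> \<omega>" "fst p = x0"
    by (rule slow_manifold_over[OF assms]) blast
  then have "p = z0" using h_hat_eq[OF assms p(1)] by (simp add: z0 prod_eq_iff)
  with p show "z0 \<in> \<M> \<omega>" by simp
qed

section \<open>The tracking point and the rate of approach\<close>

lemma exponential_tracking:
  assumes "\<omega> \<in> \<Omega>"
  shows "\<exists>z0'\<in>\<M> \<omega>. \<forall>t\<ge>0. norm (\<phi> \<omega> z0' t - \<phi> \<omega> z0 t) \<le> 1 / (1 - \<rho>) * exp (- \<mu> * t) * norm (z0' - z0)"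
proof -
  obtain M where M: "0 \<le> M" "\<And>t. t \<le> 0 \<Longrightarrow> norm (f1 \<omega> t 0) \<le> M * exp (- \<mu> * t)"
    "\<And>t. t \<le> 0 \<Longrightarrow> norm (f2 \<omega> t 0) \<le> M * exp (- \<mu> * t)"
    using f_growth[OF assms] by blast
  \<comment> \<open>The fields governing the deviation from the tracked orbit: adding a solution for
    these fields to that orbit gives another orbit. They vanish at state 0, as the gluing
    requires.\<close>
  define G1 where "G1 t p = f1 \<omega> t (\<phi> \<omega> z0 t + p) - f1 \<omega> t (\<phi> \<omega> z0 t)" for t p
  define G2 where "G2 t p = f2 \<omega> t (\<phi> \<omega> z0 t + p) - f2 \<omega> t (\<phi> \<omega> z0 t)" for t p
  have lip: "sum_lipschitz K G1" "sum_lipschitz (K / \<epsilon>) G2"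
    unfolding sum_lipschitz_def G1_def G2_def
  proof safe
    fix t p q
    show "norm (f1 \<omega> t (\<phi> \<omega> z0 t + p) - f1 \<omega> t (\<phi> \<omega> z0 t) - (f1 \<omega> t (\<phi> \<omega> z0 t + q) - f1 \<omega> t (\<phi> \<omega> z0 t)))
        \<le> K * (norm (fst p - fst q) + norm (snd p - snd q))"
      using sum_lipschitzD[OF f_lipschitz(1), of \<omega> t "\<phi> \<omega> z0 t + p" "\<phi> \<omega> z0 t + q"] by simp
    show "norm (f2 \<omega> t (\<phi> \<omega> z0 t + p) - f2 \<omega> t (\<phi> \<omega> z0 t) - (f2 \<omega> t (\<phi> \<omega> z0 t + q) - f2 \<omega> t (\<phi> \<omega> z0 t)))
        \<le> K / \<epsilon> * (norm (fst p - fst q) + norm (snd p - snd q))"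
      using sum_lipschitzD[OF f_lipschitz(2), of \<omega> t "\<phi> \<omega> z0 t + p" "\<phi> \<omega> z0 t + q"] by simp
  qed
  have phi_rc: "(\<phi> \<omega> z0 \<longlongrightarrow> \<phi> \<omega> z0 t) (at_right t)" for t
    using phi_continuous[OF assms] by (simp add: continuous_on_def filterlim_at_split)
  have rc: "right_continuous_along G1" "right_continuous_along G2"
    unfolding right_continuous_along_def G1_def G2_def
    by (auto intro!: tendsto_diff phi_rc
        right_continuous_alongD[OF f_right_continuous(1)[OF assms], of "\<lambda>s. \<phi> \<omega> z0 s + _ s"]
        right_continuous_alongD[OF f_right_continuous(1)[OF assms], of "\<phi> \<omega> z0"]
        right_continuous_alongD[OF f_right_continuous(2)[OF assms], of "\<lambda>s. \<phi> \<omega> z0 s + _ s"]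
        right_continuous_alongD[OF f_right_continuous(2)[OF assms], of "\<phi> \<omega> z0"]
        tendsto_add)
  have G0: "G1 t 0 = 0" "G2 t 0 = 0" for t by (simp_all add: G1_def G2_def)
  obtain z C where z: "continuous_on UNIV z"
    "\<And>t. 0 \<le> t \<Longrightarrow> (z has_vector_derivative split_field S B G1 G2 t (z t)) (at_right t)"
    "\<And>t. t < 0 \<Longrightarrow> ((\<lambda>t. z0 + z t) has_vector_derivative field \<omega> t (z0 + z t)) (at_right t)"
    "\<And>t. norm (fst (z t)) \<le> C * exp (- \<mu> * t)" "\<And>t. norm (snd (z t)) \<le> C * exp (- \<mu> * t)"
    by (rule split_bounded_solution_exists[OF f_lipschitz f_right_continuous[OF assms] M(2,3) lip rc G0, of z0]) auto
  have mem: "z0 + z 0 \<in> \<M> \<omega>"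
    by (rule slow_manifold_translateI[OF assms z(1) z(3-5)])
  \<comment> \<open>For t < 0 the new orbit is \<open>z0 + z\<close>, for t \<ge> 0 it is the
    tracked orbit plus \<open>z\<close>. The two descriptions meet at time 0, where the tracked
    orbit has the value \<open>z0\<close>.\<close>
  have eq: "\<phi> \<omega> (z0 + z 0) t = \<phi> \<omega> z0 t + z t" if "0 \<le> t" for t
  proof -
    have "\<phi> \<omega> (\<phi> \<omega> z0 0 + z 0) t = \<phi> \<omega> z0 t + z t"
    proof (rule phi_eq_forward[OF assms _ _ that])
      show "continuous_on {0..} (\<lambda>t. \<phi> \<omega> z0 t + z t)"
        by (intro continuous_intros continuous_on_subset[OF phi_continuous[OF assms]] continuous_on_subset[OF z(1)]) auto
      fix s :: real assume "0 \<le> s"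
      have "((\<lambda>t. \<phi> \<omega> z0 t + z t) has_vector_derivative
          field \<omega> s (\<phi> \<omega> z0 s) + split_field S B G1 G2 s (z s)) (at_right s)"
        by (intro has_vector_derivative_add phi_right_derivative[OF assms] z(2) \<open>0 \<le> s\<close>)
      moreover have "field \<omega> s (\<phi> \<omega> z0 s) + split_field S B G1 G2 s (z s) = field \<omega> s (\<phi> \<omega> z0 s + z s)"
        by (simp add: split_field_def G1_def G2_def matrix_vector_right_distrib algebra_simps)
      ultimately show "((\<lambda>t. \<phi> \<omega> z0 t + z t) has_vector_derivative field \<omega> s (\<phi> \<omega> z0 s + z s)) (at_right s)"
        by simp
    qed
    then show ?thesis by (simp add: phi_0[OF assms])
  qed
  have "norm (\<phi> \<omega> (z0 + z 0) t - \<phi> \<omega> z0 t) \<le> 1 / (1 - \<rho>) * exp (- \<mu> * t) * norm (z0 + z 0 - z0)" if "0 \<le> t" for t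
  proof -
    have "norm (\<phi> \<omega> (z0 + z 0) t - \<phi> \<omega> z0 t) = norm (z t)" by (simp add: eq[OF that])
    also have "\<dots> \<le> norm (fst (z t)) + norm (snd (z t))" by (rule norm_prod_bounds)
    also have "\<dots> \<le> norm (snd (z 0)) / (1 - \<rho>) * exp (- \<mu> * t)"
      by (rule forward_bounded_decay[OF lip G0 continuous_on_subset[OF z(1)] z(2,4,5) that]) auto
    \<comment> \<open>Here the distance of the initial points enters: \<open>z 0\<close> is their
      difference, and its fast component is at most as large.\<close>
    also have "\<dots> \<le> norm (z 0) / (1 - \<rho>) * exp (- \<mu> * t)"
      using rho(2) norm_prod_bounds(2)[of "z 0"] by (intro mult_right_mono divide_right_mono) auto
    finally show ?thesis by (simp add: mult_ac)
  qed
  with mem show ?thesis by blast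
qed

end

theorem theorem2:
  fixes S :: "real^'n1^'n1" and F :: "real^'n2^'n2"
    and g1 :: "(real^'n1) \<times> (real^'n2) \<Rightarrow> real^'n1"
    and g2 :: "(real^'n1) \<times> (real^'n2) \<Rightarrow> real^'n2"
    and \<sigma> \<alpha> \<gamma>s \<gamma>f K \<gamma> :: real
    and P :: "(real \<Rightarrow> real^'n2) measure"
  assumes sigma: "\<sigma> > 0"
    and alpha: "1 < \<alpha>" "\<alpha> < 2"
    and eig_S: "\<And>z. complex_eigenvalue S z \<Longrightarrow> 0 \<le> Re z"
    and eig_F: "\<And>z. complex_eigenvalue F z \<Longrightarrow> Re z < 0"
    and lipschitz_g: "\<exists>L. L-lipschitz_on UNIV g1" "\<exists>L. L-lipschitz_on UNIV g2"
    and zero_g: "g1 (0, 0) = 0" "g2 (0, 0) = 0"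
    and rates: "\<gamma>s > 0" "\<gamma>f < 0"
    and A1_slow: "\<And>t x. t \<le> 0 \<Longrightarrow> norm (mat_exp (t *\<^sub>R S) *v x) \<le> exp (\<gamma>s * t) * norm x"
    and A1_fast: "\<And>t y. t \<ge> 0 \<Longrightarrow> norm (mat_exp (t *\<^sub>R F) *v y) \<le> exp (\<gamma>f * t) * norm y"
    and K_pos: "K > 0"
    and A2_slow: "\<And>x1 y1 x2 y2. norm (g1 (x1, y1) - g1 (x2, y2)) \<le> K * (norm (x1 - x2) + norm (y1 - y2))"
    and A2_fast: "\<And>x1 y1 x2 y2. norm (g2 (x1, y1) - g2 (x2, y2)) \<le> K * (norm (x1 - x2) + norm (y1 - y2))"
    and A3: "K < - \<gamma>f"
    and gamma: "\<gamma> > 0" "K < - (\<gamma> + \<gamma>f)"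
    and noise: "stable_levy \<alpha> P"
    and shift_preserves: "\<And>t. path_shift t \<in> P \<rightarrow>\<^sub>M P" "\<And>t. distr P P (path_shift t) = P"
  shows "\<exists>\<epsilon>0>0. \<forall>\<epsilon>. 0 < \<epsilon> \<and> \<epsilon> < \<epsilon>0 \<longrightarrow>
    (\<forall>\<Omega>. admissible_noise_set S F g1 g2 \<sigma> \<alpha> \<epsilon> P \<Omega> \<longrightarrow>
      (\<forall>\<omega>\<in>\<Omega>. slow_manifold S F g1 g2 \<sigma> \<alpha> \<gamma> \<epsilon> \<omega> =
                {(x0, h_hat S F g1 g2 \<sigma> \<alpha> \<gamma> \<epsilon> \<omega> x0) | x0. True}) \<and>
      (\<forall>\<omega>\<in>\<Omega>. \<forall>s\<ge>0. phi_hat S F g1 g2 \<sigma> \<alpha> \<epsilon> s \<omega> ` slow_manifold S F g1 g2 \<sigma> \<alpha> \<gamma> \<epsilon> \<omega>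
                \<subseteq> slow_manifold S F g1 g2 \<sigma> \<alpha> \<gamma> \<epsilon> (path_shift s \<omega>)) \<and>
      (\<exists>C>0. \<exists>c>0. \<forall>\<omega>\<in>\<Omega>. \<forall>z0. \<exists>z0'\<in>slow_manifold S F g1 g2 \<sigma> \<alpha> \<gamma> \<epsilon> \<omega>.
         \<forall>t\<ge>0. norm (phi_hat S F g1 g2 \<sigma> \<alpha> \<epsilon> t \<omega> z0' - phi_hat S F g1 g2 \<sigma> \<alpha> \<epsilon> t \<omega> z0)
                  \<le> C * exp (- c * t) * norm (z0' - z0)))"
proof -
  define \<kappa> where "\<kappa> = K / - (\<gamma> + \<gamma>f)"
  have "0 < - (\<gamma> + \<gamma>f)" using gamma K_pos by linarith
  then have "\<kappa> < 1" using gamma unfolding \<kappa>_def by (simp only: divide_less_eq_1_pos)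
  \<comment> \<open>The solution of K \<epsilon> / \<gamma> + \<kappa> = 1, where \<kappa> is the
    fast share of the contraction constant and K \<epsilon> / \<gamma> bounds the slow share, since
    \<gamma>s > 0.\<close>
  define \<epsilon>0 where "\<epsilon>0 = \<gamma> * (1 - \<kappa>) / K"
  have "\<epsilon>0 > 0" using gamma K_pos \<open>\<kappa> < 1\<close> by (simp add: \<epsilon>0_def)
  have main: "slow_fast S F g1 g2 \<sigma> \<alpha> \<gamma>s \<gamma>f K \<gamma> \<epsilon> \<Omega>"
    if \<epsilon>: "0 < \<epsilon>" "\<epsilon> < \<epsilon>0" and \<Omega>: "admissible_noise_set S F g1 g2 \<sigma> \<alpha> \<epsilon> P \<Omega>" for \<epsilon> \<Omega>
  proof
    have "K / (\<gamma>s + \<gamma> / \<epsilon>) \<le> K / (\<gamma> / \<epsilon>)"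
      using rates gamma K_pos \<epsilon> by (intro divide_left_mono mult_pos_pos add_pos_pos divide_pos_pos) auto
    also have "\<dots> = K * \<epsilon> / \<gamma>" by simp
    also have "\<dots> < K * \<epsilon>0 / \<gamma>"
      using \<epsilon> gamma K_pos by (intro divide_strict_right_mono mult_strict_left_mono) auto
    also have "\<dots> = 1 - \<kappa>" using gamma K_pos by (simp add: \<epsilon>0_def)
    finally show "K / (\<gamma>s + \<gamma> / \<epsilon>) + K / - (\<gamma> + \<gamma>f) < 1" by (simp add: \<kappa>_def)
    show "\<gamma> + \<gamma>f < 0" using gamma K_pos by simp
  qed (use assms \<epsilon> \<Omega> in \<open>auto simp: admissible_noise_set_def\<close>)
  show ?thesis
  proof (rule exI[of _ \<epsilon>0], intro conjI allI impI ballI)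
    show "\<epsilon>0 > 0" by fact
    fix \<epsilon> \<Omega>
    assume \<epsilon>: "0 < \<epsilon> \<and> \<epsilon> < \<epsilon>0" and \<Omega>: "admissible_noise_set S F g1 g2 \<sigma> \<alpha> \<epsilon> P \<Omega>"
    then interpret slow_fast S F g1 g2 \<sigma> \<alpha> \<gamma>s \<gamma>f K \<gamma> \<epsilon> \<Omega> by (blast intro: main)
    show "slow_manifold S F g1 g2 \<sigma> \<alpha> \<gamma> \<epsilon> \<omega> = {(x0, h_hat S F g1 g2 \<sigma> \<alpha> \<gamma> \<epsilon> \<omega> x0) | x0. True}" if "\<omega> \<in> \<Omega>" for \<omega>
      by (rule slow_manifold_eq_graph[OF that])
    show "phi_hat S F g1 g2 \<sigma> \<alpha> \<epsilon> s \<omega> ` slow_manifold S F g1 g2 \<sigma> \<alpha> \<gamma> \<epsilon> \<omega>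
        \<subseteq> slow_manifold S F g1 g2 \<sigma> \<alpha> \<gamma> \<epsilon> (path_shift s \<omega>)" if "\<omega> \<in> \<Omega>" "0 \<le> s" for \<omega> s
      using slow_manifold_invariant[OF that] by blast
    \<comment> \<open>The witnesses 1 / (1 - \<rho>) and \<gamma> / \<epsilon> vary with \<epsilon>
      but are the same for all paths and initial values.\<close>
    show "\<exists>C>0. \<exists>c>0. \<forall>\<omega>\<in>\<Omega>. \<forall>z0. \<exists>z0'\<in>slow_manifold S F g1 g2 \<sigma> \<alpha> \<gamma> \<epsilon> \<omega>.
         \<forall>t\<ge>0. norm (phi_hat S F g1 g2 \<sigma> \<alpha> \<epsilon> t \<omega> z0' - phi_hat S F g1 g2 \<sigma> \<alpha> \<epsilon> t \<omega> z0)
                  \<le> C * exp (- c * t) * norm (z0' - z0)"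
      using exponential_tracking rho mu_pos
      by (intro exI[of _ "1 / (1 - \<rho>)"] exI[of _ \<mu>] conjI) auto
  qed
qed

end
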